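(* Let $m,n\ge 1$ be integers and let $T$ be an $m$-multilinear Calderón–Zygmund operator on $\mathbb{R}^n$ associated to a kernel $K$. Then there is a constant $A_2$, depending only on $K$, $n$, $m$, and $\|T\|_{(L^2(\mathbb{R}^n))^m\to L^{2/m}(\mathbb{R}^n)}$, such that for all $f_1,\ldots,f_m\in L^1(\mathbb{R}^n)$, \[ \|T(f_1,\ldots,f_m)\|_{L^{\frac1m,\infty}(\mathbb{R}^n)}\le A_2\prod_{i=1}^m\|f_i\|_{L^1(\mathbb{R}^n)}. \] That is, for every $t>0$, \[ \left|\{x\in\mathbb{R}^n:|T(f_1,\ldots,f_m)(x)|>t\}\right|\le A_2^{\frac1m}\,t^{-\frac1m}\prod_{i=1}^m\|f_i\|_{L^1(\mathbb{R}^n)}^{\frac1m}. \]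
   Context: $|A|$ denotes the Lebesgue measure of $A\subseteq\mathbb{R}^n$. A (measurable) function $K:\mathbb{R}^{n(m+1)}\to\mathbb{C}$ is an $m$-multilinear Calderón–Zygmund kernel if there exist $C_K,\delta>0$ such that: (1) (size) $|K(x,y_1,\ldots,y_m)|\le \dfrac{C_K}{\left(\sum_{i=1}^m|x-y_i|\right)^{nm}}$ for all $x,y_1,\ldots,y_m\in\mathbb{R}^n$ with $x\ne y_j$ for some $j$; (2) (smoothness) $|K(x,y_1,\ldots,y_m)-K(x',y_1,\ldots,y_m)|\le \dfrac{C_K|x-x'|^\delta}{\left(\sum_{i=1}^m|x-y_i|\right)^{nm+\delta}}$ whenever $|x-x'|\le\frac12\max_{1\le i\le m}|x-y_i|$, and, for each $j\in\{1,\ldots,m\}$, $|K(x,y_1,\ldots,y_j,\ldots,y_m)-K(x,y_1,\ldots,y_j',\ldots,y_m)|\le \dfrac{C_K|y_j-y_j'|^\delta}{\left(\sum_{i=1}^m|x-y_i|\right)^{nm+\delta}}$ whenever $|y_j-y_j'|\le\frac12\max_{1\le i\le m}|x-y_i|$. A bounded multilinear operator $T:(L^2(\mathbb{R}^n))^m\to L^{\frac2m}(\mathbb{R}^n)$ is an $m$-multilinear Calderón–Zygmund operator associated to a kernel $K$ if $K$ is an $m$-multilinear Calderón–Zygmund kernel and \[ T(f_1,\ldots,f_m)(x)=\int_{(\mathbb{R}^n)^m}K(x,y_1,\ldots,y_m)f_1(y_1)\cdots f_m(y_m)\,dy_1\cdots dy_m \] for almost every $x\in\mathbb{R}^n\setminus\bigcap_{i=1}^m\operatorname{supp}f_i$.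 For general $f_i\in L^1(\mathbb{R}^n)$, $T(f_1,\ldots,f_m)$ is understood through the usual extension by density from continuous compactly supported functions (on which $T$ is defined since they lie in $L^2$). The quasi-norm is $\|h\|_{L^{\frac1m,\infty}(\mathbb{R}^n)}=\sup_{t>0}t\,|\{x:|h(x)|>t\}|^m$. *)

theory Defs
  imports "HOL-Analysis.Analysis"
begin

text \<open>
  The spaces \<open>\<real>\<^sup>n\<close> and \<open>(\<real>\<^sup>n)\<^sup>m\<close> are \<open>real ^ 'n\<close> and \<open>(real ^ 'n) ^ 'm\<close>, so that
  \<open>n = CARD('n) \<ge> 1\<close> and \<open>m = CARD('m) \<ge> 1\<close>. An element of an \<open>L\<^sup>p\<close> space is represented by a
  Lebesgue measurable function, and identities between such elements are stated
  almost everywhere.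
\<close>

definition Lp_space :: "real \<Rightarrow> ('a::euclidean_space \<Rightarrow> complex) set" where
  "Lp_space p = {f \<in> borel_measurable lebesgue. integrable lebesgue (\<lambda>x. cmod (f x) powr p)}"

text \<open>Only a quasi-norm for \<open>0 < p < 1\<close>; meaningful for \<open>f \<in> Lp_space p\<close> only.\<close>

definition Lp_norm :: "real \<Rightarrow> ('a::euclidean_space \<Rightarrow> complex) \<Rightarrow> real" where
  "Lp_norm p f = (LINT x|lebesgue. cmod (f x) powr p) powr (1 / p)"

text \<open>The quasi-norm of \<open>L\<^bsup>1/m,\<infinity>\<^esup>\<close>, possibly infinite; meaningful for measurable \<open>h\<close> only.\<close>

definition weak_qnorm :: "nat \<Rightarrow> ('a::euclidean_space \<Rightarrow> complex) \<Rightarrow> ennreal" where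
  "weak_qnorm m h = (SUP t\<in>{0<..}. ennreal t * emeasure lebesgue {x. t < cmod (h x)} ^ m)"

text \<open>The support of an almost-everywhere class: the complement of the largest open set
  on which the function vanishes almost everywhere.\<close>

definition ess_support :: "('a::euclidean_space \<Rightarrow> complex) \<Rightarrow> 'a set" where
  "ess_support f = - \<Union>{U. open U \<and> (AE y in lebesgue. y \<in> U \<longrightarrow> f y = 0)}"

definition Cc_space :: "('a::euclidean_space \<Rightarrow> complex) set" where
  "Cc_space = {g. continuous_on UNIV g \<and> compact (closure {x. g x \<noteq> 0})}"

text \<open>
  In the two smoothness conditions the degenerate case \<open>x = y\<^sub>1 = \<dots> = y\<^sub>m\<close> forces
  \<open>x = x'\<close> (resp. \<open>y\<^sub>j = y\<^sub>j'\<close>), and the inequality then reads \<open>0 \<le> 0\<close>.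
\<close>

definition CZ_kernel :: "(real ^ 'n \<Rightarrow> (real ^ 'n) ^ 'm \<Rightarrow> complex) \<Rightarrow> bool" where
  "CZ_kernel K \<longleftrightarrow>
    (\<lambda>(x, y). K x y) \<in> borel_measurable lebesgue \<and>
    (\<exists>C>0. \<exists>\<delta>>0.
      (\<forall>x y. (\<exists>j. x \<noteq> y $ j) \<longrightarrow>
         cmod (K x y) \<le> C / (\<Sum>i\<in>UNIV. norm (x - y $ i)) ^ (CARD('n) * CARD('m))) \<and>
      (\<forall>x x' y. norm (x - x') \<le> 1 / 2 * (MAX i. norm (x - y $ i)) \<longrightarrow>
         cmod (K x y - K x' y) \<le> C * norm (x - x') powr \<delta> /
           (\<Sum>i\<in>UNIV. norm (x - y $ i)) powr (real (CARD('n) * CARD('m)) + \<delta>)) \<and>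
      (\<forall>j x y z. norm (y $ j - z) \<le> 1 / 2 * (MAX i. norm (x - y $ i)) \<longrightarrow>
         cmod (K x y - K x (\<chi> i. if i = j then z else y $ i)) \<le> C * norm (y $ j - z) powr \<delta> /
           (\<Sum>i\<in>UNIV. norm (x - y $ i)) powr (real (CARD('n) * CARD('m)) + \<delta>)))"

text \<open>
  Operators \<open>(L\<^sup>2)\<^sup>m \<rightarrow> L\<^bsup>2/m\<^esup>\<close> act on tuples of representatives; values outside \<open>L\<^sup>2\<close> are
  irrelevant. Invariance under almost-everywhere equality follows from multilinearity
  together with the bound.
\<close>

definition multilinear_L2 ::
  "(('m \<Rightarrow> real ^ 'n \<Rightarrow> complex) \<Rightarrow> real ^ 'n \<Rightarrow> complex) \<Rightarrow> bool" where
  "multilinear_L2 T \<longleftrightarrow>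
    (\<forall>f j u v a b. (\<forall>i. f i \<in> Lp_space 2) \<and> u \<in> Lp_space 2 \<and> v \<in> Lp_space 2 \<longrightarrow>
      (AE x in lebesgue. T (f(j := (\<lambda>y. a * u y + b * v y))) x =
         a * T (f(j := u)) x + b * T (f(j := v)) x))"

definition bound_L2 ::
  "(('m::finite \<Rightarrow> real ^ 'n \<Rightarrow> complex) \<Rightarrow> real ^ 'n \<Rightarrow> complex) \<Rightarrow> real \<Rightarrow> bool" where
  "bound_L2 T B \<longleftrightarrow> 0 \<le> B \<and>
    (\<forall>f. (\<forall>i. f i \<in> Lp_space 2) \<longrightarrow>
      Lp_norm (2 / real CARD('m)) (T f) \<le> B * (\<Prod>i\<in>UNIV. Lp_norm 2 (f i)))"

definition bounded_multilinear_L2 ::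
  "(('m::finite \<Rightarrow> real ^ 'n \<Rightarrow> complex) \<Rightarrow> real ^ 'n \<Rightarrow> complex) \<Rightarrow> bool" where
  "bounded_multilinear_L2 T \<longleftrightarrow>
    (\<forall>f. (\<forall>i. f i \<in> Lp_space 2) \<longrightarrow> T f \<in> Lp_space (2 / real CARD('m))) \<and>
    multilinear_L2 T \<and> (\<exists>B. bound_L2 T B)"

definition opnorm_L2 ::
  "(('m::finite \<Rightarrow> real ^ 'n \<Rightarrow> complex) \<Rightarrow> real ^ 'n \<Rightarrow> complex) \<Rightarrow> real" where
  "opnorm_L2 T = Inf {B. bound_L2 T B}"

text \<open>
  For \<open>f\<^sub>i \<in> L\<^sup>2\<close> and \<open>x\<close> outside one of the supports, the size condition makes the integrand
  below absolutely integrable, so the Bochner integral never takes its default value.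
\<close>

definition CZ_operator ::
  "(('m::finite \<Rightarrow> real ^ 'n \<Rightarrow> complex) \<Rightarrow> real ^ 'n \<Rightarrow> complex) \<Rightarrow>
   (real ^ 'n \<Rightarrow> (real ^ 'n) ^ 'm \<Rightarrow> complex) \<Rightarrow> bool" where
  "CZ_operator T K \<longleftrightarrow>
    bounded_multilinear_L2 T \<and> CZ_kernel K \<and>
    (\<forall>f. (\<forall>i. f i \<in> Lp_space 2) \<longrightarrow>
      (AE x in lebesgue. x \<notin> (\<Inter>i. ess_support (f i)) \<longrightarrow>
         T f x = (LINT y|lebesgue. K x y * (\<Prod>i\<in>UNIV. f i (y $ i)))))"

text \<open>
  \<open>L1_extension T f h\<close>: \<open>h\<close> represents the value at \<open>f \<in> (L\<^sup>1)\<^sup>m\<close> of the continuous extension of \<open>T\<close>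
  from \<open>(C\<^sub>c)\<^sup>m\<close>, namely the limit in \<open>L\<^bsup>1/m,\<infinity>\<^esup>\<close> of \<open>T F\<^sub>k\<close> for every sequence \<open>F\<^sub>k\<close> in \<open>(C\<^sub>c)\<^sup>m\<close>
  converging to \<open>f\<close> in \<open>L\<^sup>1\<close> in each component.
\<close>

definition L1_extension ::
  "(('m::finite \<Rightarrow> real ^ 'n \<Rightarrow> complex) \<Rightarrow> real ^ 'n \<Rightarrow> complex) \<Rightarrow>
   ('m \<Rightarrow> real ^ 'n \<Rightarrow> complex) \<Rightarrow> (real ^ 'n \<Rightarrow> complex) \<Rightarrow> bool" where
  "L1_extension T f h \<longleftrightarrow>
    h \<in> borel_measurable lebesgue \<and>
    (\<forall>F :: nat \<Rightarrow> 'm \<Rightarrow> real ^ 'n \<Rightarrow> complex.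
      (\<forall>k i. F k i \<in> Cc_space) \<and>
      (\<forall>i. (\<lambda>k. Lp_norm 1 (\<lambda>x. F k i x - f i x)) \<longlonglongrightarrow> 0) \<longrightarrow>
      (\<lambda>k. weak_qnorm CARD('m) (\<lambda>x. T (F k) x - h x)) \<longlonglongrightarrow> 0)"

end

theory Submission
  imports Defs
begin

text \<open>
  Decompose each \<open>f\<^sub>i \<in> C\<^sub>c\<close> at a height \<open>\<alpha>\<^sub>i\<close> as \<open>f\<^sub>i = g\<^sub>i + b\<^sub>i\<close>. As \<open>f\<^sub>i\<close> is uniformly continuous, the
  bisection may be stopped after finitely many steps, so \<open>b\<^sub>i\<close> is a finite sum of pieces with mean
  zero. Telescoping gives \<open>T f = T g + \<Sum>\<^sub>j T (g\<^sub>1, \<dots>, b\<^sub>j, \<dots>, f\<^sub>m)\<close>. The term \<open>T g\<close> is controlled by the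
  \<open>L\<^sup>2\<close> bound. In the other terms only the cancellation of \<open>b\<^sub>j\<close> is used: seen from a point off the
  dilated cubes, every other \<open>f\<^sub>i\<close> acts like a function bounded by a multiple of \<open>\<alpha>\<^sub>i\<close>, so that
  integrating out the other variables leaves a linear estimate in \<open>b\<^sub>j\<close>.

  The telescoping identity also makes \<open>T\<close> uniformly continuous on bounded sets from \<open>(L\<^sup>1)\<^sup>m\<close> to
  \<open>L\<^bsup>1/m,\<infinity>\<^esup>\<close>. The extension is the almost everywhere limit along a rapidly converging sequence
  (Borel--Cantelli), and its properties follow from Fatou's lemma.
\<close>

section \<open>Integrals over product spaces and decaying weights\<close>

text \<open>Expanding all factors f_i = g_i + b_i at once would produce 2^m terms, many with several
  bad functions. Telescoping leaves one bad slot per term, but undecomposed f_i remain in the later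
  slots. These are neither bounded nor cancelling, which is why the decomposition must also carry a
  weighted estimate for f_i itself. The weights come from the kernel. With S the sum of the |x -
  y_i|, smoothness in y_j gives decay S^-(nm + \<delta>), which is at most a constant times a
  product of m one-variable weights of exponent n + \<delta>/m, each integrable with \<delta>/m to
  spare. If R is the distance from x to the centre of a piece of b_j, every variable i other than j
  integrates to R^(-\<delta>/m) and variable j contributes R^(-n - \<delta>/m). The product is R^-(n
  + \<delta>), integrable away from the piece. With finitely many pieces no limit has to be passed
  through T or through the kernel integral. All constants are fixed before T is, so they depend only
  on K, n, m and the L2 bound. Strictly positive bounds a_i stand in for the L1 norms, so that
  vanishing functions and small differences need no separate treatment.\<close>

lemma mem_box_vec:
  fixes l u x :: "'a::euclidean_space ^ 'm"
  shows "x \<in> box l u \<longleftrightarrow> (\<forall>i. x $ i \<in> box (l $ i) (u $ i))"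
  by (auto simp: mem_box Basis_vec_def inner_axis)

lemma prod_Basis_vec:
  fixes f :: "'a::euclidean_space ^ 'm \<Rightarrow> real"
  shows "prod f Basis = (\<Prod>i\<in>UNIV. \<Prod>b\<in>Basis. f (axis i b))"
proof -
  have "prod f Basis = (\<Prod>z\<in>UNIV \<times> Basis. f (axis (fst z) (snd z)))"
  proof (rule prod.reindex_bij_betw[symmetric, of "\<lambda>z. axis (fst z) (snd z)"])
    show "bij_betw (\<lambda>z. axis (fst z) (snd z)) (UNIV \<times> (Basis :: 'a set)) (Basis :: ('a ^ 'm) set)"
      unfolding bij_betw_def
      by (auto simp: Basis_vec_def inj_on_def axis_eq_axis image_iff) blast+
  qed
  then show ?thesis
    by (simp add: prod.cartesian_product case_prod_unfold)
qed

lemma measurable_vec_lambda [measurable]: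
  "(\<lambda>f. \<chi> i. f i) \<in> measurable (Pi\<^sub>M (UNIV :: 'm::finite set) (\<lambda>_. borel)) (borel :: ('a::euclidean_space ^ 'm) measure)"
proof (subst borel_measurable_euclidean_space, intro ballI)
  fix b :: "'a ^ 'm" assume "b \<in> Basis"
  then obtain i u where b: "b = axis i u" by (auto simp: Basis_vec_def)
  show "(\<lambda>f. (\<chi> i. f i) \<bullet> b) \<in> borel_measurable (Pi\<^sub>M (UNIV :: 'm set) (\<lambda>_. borel))"
    unfolding b inner_axis by simp
qed

lemma measurable_vec_lambda_lborel:
  "(\<lambda>f. \<chi> i. f i) \<in> measurable (Pi\<^sub>M (UNIV :: 'm::finite set) (\<lambda>_. lborel)) (borel :: ('a::euclidean_space ^ 'm) measure)"
  by (subst measurable_cong_sets[where M' = "Pi\<^sub>M (UNIV :: 'm set) (\<lambda>_. borel)", OF sets_PiM_cong refl])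
     (auto simp: measurable_vec_lambda)

text \<open>Lebesgue measure is determined by its values on boxes, and a box of vectors pulls back
  to a product of boxes. This carries the Fubini and Tonelli theorems of \<open>Pi\<^sub>M\<close>
  over to \<open>(real ^ 'n) ^ 'm\<close>.\<close>

lemma lborel_vec_eq:
  "(lborel :: ('a::euclidean_space ^ 'm) measure) =
    distr (Pi\<^sub>M (UNIV :: 'm set) (\<lambda>_. lborel)) borel (\<lambda>f. \<chi> i. f i)"
proof (rule lborel_eqI)
  interpret product_sigma_finite "\<lambda>_ :: 'm. lborel :: 'a measure"
    by standard
  fix l u :: "'a ^ 'm"
  assume lu: "\<And>b. b \<in> Basis \<Longrightarrow> l \<bullet> b \<le> u \<bullet> b"
  have lu': "l $ i \<bullet> b \<le> u $ i \<bullet> b" if "b \<in> Basis" for i b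
    using lu[of "axis i b"] that by (simp add: inner_axis axis_in_Basis_iff)
  have "emeasure (distr (Pi\<^sub>M (UNIV :: 'm set) (\<lambda>_. lborel)) borel (\<lambda>f. \<chi> i. f i)) (box l u) =
      emeasure (Pi\<^sub>M (UNIV :: 'm set) (\<lambda>_. lborel :: 'a measure)) (\<Pi>\<^sub>E i\<in>UNIV. box (l $ i) (u $ i))"
  proof (subst emeasure_distr[OF measurable_vec_lambda_lborel])
    have "(\<lambda>f. \<chi> i. f i) -` box l u \<inter> space (Pi\<^sub>M (UNIV :: 'm set) (\<lambda>_. lborel)) = (\<Pi>\<^sub>E i\<in>UNIV. box (l $ i) (u $ i))"
      by (rule set_eqI) (simp add: mem_box_vec space_PiM PiE_iff del: mem_box)
    then show "emeasure (Pi\<^sub>M UNIV (\<lambda>_. lborel)) ((\<lambda>f. \<chi> i. f i) -` box l u \<inter> space (Pi\<^sub>M (UNIV :: 'm set) (\<lambda>_. lborel))) =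
      emeasure (Pi\<^sub>M (UNIV :: 'm set) (\<lambda>_. lborel)) (\<Pi>\<^sub>E i\<in>UNIV. box (l $ i) (u $ i))"
      by simp
  qed simp
  also have "\<dots> = (\<Prod>i\<in>UNIV. emeasure lborel (box (l $ i) (u $ i)))"
    by (rule emeasure_PiM) auto
  also have "\<dots> = (\<Prod>i\<in>UNIV. ennreal (\<Prod>b\<in>Basis. (u $ i - l $ i) \<bullet> b))"
    using lu' by (intro prod.cong refl emeasure_lborel_box) auto
  also have "\<dots> = ennreal (\<Prod>i\<in>UNIV. \<Prod>b\<in>Basis. (u $ i - l $ i) \<bullet> b)"
    using lu' by (intro prod_ennreal prod_nonneg) (auto simp: inner_diff_left)
  also have "(\<Prod>i\<in>UNIV. \<Prod>b\<in>Basis. (u $ i - l $ i) \<bullet> b) = (\<Prod>b\<in>Basis. (u - l) \<bullet> b)"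
    by (simp add: prod_Basis_vec inner_axis)
  finally show "emeasure (distr (Pi\<^sub>M (UNIV :: 'm set) (\<lambda>_. lborel)) borel (\<lambda>f. \<chi> i. f i)) (box l u) =
      ennreal (\<Prod>b\<in>Basis. (u - l) \<bullet> b)" .
qed simp

lemma borel_measurable_vec_component [measurable]:
  "(\<lambda>y. y $ i) \<in> borel_measurable (borel :: ('a::euclidean_space ^ 'm) measure)"
  by (intro borel_measurable_continuous_onI continuous_intros)

lemma nn_integral_vec_prod:
  fixes f :: "'m::finite \<Rightarrow> 'a::euclidean_space \<Rightarrow> ennreal"
  assumes [measurable]: "\<And>i. f i \<in> borel_measurable borel"
  shows "(\<integral>\<^sup>+ y. (\<Prod>i\<in>UNIV. f i (y $ i)) \<partial>lborel) = (\<Prod>i\<in>UNIV. \<integral>\<^sup>+ z. f i z \<partial>lborel)"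
proof -
  interpret product_sigma_finite "\<lambda>_ :: 'm. lborel :: 'a measure"
    by standard
  have "(\<integral>\<^sup>+ y. (\<Prod>i\<in>UNIV. f i (y $ i)) \<partial>lborel) =
      (\<integral>\<^sup>+ y. (\<Prod>i\<in>UNIV. f i (y i)) \<partial>Pi\<^sub>M (UNIV :: 'm set) (\<lambda>_. lborel :: 'a measure))"
    by (subst lborel_vec_eq, subst nn_integral_distr[OF measurable_vec_lambda_lborel]) simp_all
  also have "\<dots> = (\<Prod>i\<in>UNIV. \<integral>\<^sup>+ z. f i z \<partial>lborel)"
    by (rule product_nn_integral_prod) auto
  finally show ?thesis .
qed

text \<open>Fubini with coordinate \<open>j\<close> innermost. The hypothesis \<open>indep\<close>
  expresses that \<open>H\<close> ignores coordinate \<open>j\<close>, so \<open>H\<close> leaves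
  the inner integral and only the mean of \<open>b\<close> remains. It will be applied to the kernel
  with \<open>y $ j\<close> frozen.\<close>

lemma integral_vec_split_zero:
  fixes b :: "'a::euclidean_space \<Rightarrow> complex" and H :: "'a ^ 'm \<Rightarrow> complex"
  assumes int: "integrable lborel (\<lambda>y. b (y $ j) * H y)"
    and indep: "\<And>y z. H (\<chi> i. if i = j then z else y $ i) = H y"
    and b0: "(LINT z|lborel. b z) = 0"
  shows "(LINT y|lborel. b (y $ j) * H y) = 0"
proof -
  interpret product_sigma_finite "\<lambda>_ :: 'm. lborel :: 'a measure"
    by standard
  let ?V = "\<lambda>f :: 'm \<Rightarrow> 'a. \<chi> i. f i"
  let ?I = "UNIV - {j}"
  have U: "insert j ?I = UNIV" by auto
  have int': "integrable (Pi\<^sub>M (UNIV :: 'm set) (\<lambda>_. lborel)) (\<lambda>f. b (f j) * H (?V f))"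
    using int unfolding lborel_vec_eq
    by (subst (asm) integrable_distr_eq[OF measurable_vec_lambda_lborel])
       (use int in \<open>auto dest: borel_measurable_integrable\<close>)
  have "(LINT y|lborel. b (y $ j) * H y) =
      (LINT f|Pi\<^sub>M (UNIV :: 'm set) (\<lambda>_. lborel). b (f j) * H (?V f))"
    by (subst lborel_vec_eq, subst integral_distr[OF measurable_vec_lambda_lborel])
       (use int in \<open>auto dest: borel_measurable_integrable\<close>)
  also have "\<dots> = (LINT f|Pi\<^sub>M ?I (\<lambda>_. lborel). LINT z|lborel. b ((f(j := z)) j) * H (?V (f(j := z))))"
    using product_integral_insert[of ?I j "\<lambda>f. b (f j) * H (?V f)"] int' by (simp add: U)
  also have "\<dots> = (LINT f|Pi\<^sub>M ?I (\<lambda>_. lborel). (LINT z|lborel. b z) * H (?V f))"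
  proof (intro Bochner_Integration.integral_cong refl)
    fix f :: "'m \<Rightarrow> 'a"
    have "H (?V (f(j := z))) = H (?V f)" for z
    proof -
      have "?V (f(j := z)) = (\<chi> i. if i = j then z else ?V f $ i)" by (auto simp: vec_eq_iff)
      then show ?thesis using indep by simp
    qed
    then show "(LINT z|lborel. b ((f(j := z)) j) * H (?V (f(j := z)))) = (LINT z|lborel. b z) * H (?V f)"
      by simp
  qed
  also have "\<dots> = 0" by (simp add: b0)
  finally show ?thesis .
qed

section \<open>Dyadic shells and integrals of decaying weights\<close>

lemma two_power_bracket:
  fixes u \<rho> :: real
  assumes "0 < \<rho>" "0 \<le> u"
  shows "\<exists>k. u \<le> \<rho> * 2 ^ Suc k \<and> \<rho> * 2 ^ k \<le> \<rho> + u"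
proof -
  obtain N where "u / \<rho> < 2 ^ N" using real_arch_pow[of 2 "u / \<rho>"] by auto
  then have "u \<le> \<rho> * 2 ^ Suc N" using assms by (simp add: field_simps)
  then have ex: "\<exists>k. u \<le> \<rho> * 2 ^ Suc k" by blast
  \<comment> \<open>Minimality of \<open>k\<close> gives the lower bound when \<open>k > 0\<close>;
    the summand \<open>\<rho>\<close> on the right-hand side is what makes \<open>k = 0\<close>
    work.\<close>
  define k where "k = (LEAST k. u \<le> \<rho> * 2 ^ Suc k)"
  have 1: "u \<le> \<rho> * 2 ^ Suc k" unfolding k_def by (rule LeastI_ex[OF ex])
  have "\<rho> * 2 ^ k \<le> \<rho> + u"
  proof (cases k)
    case (Suc l)
    then have "\<not> u \<le> \<rho> * 2 ^ Suc l" using not_less_Least[of l "\<lambda>k. u \<le> \<rho> * 2 ^ Suc k"] k_def by auto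
    then show ?thesis using Suc assms by simp
  qed (use assms in simp)
  with 1 show ?thesis by blast
qed

lemma ennreal_le_suminf: "f k \<le> (\<Sum>k. f k)" for f :: "nat \<Rightarrow> ennreal"
proof -
  have "sum f {k} \<le> suminf f" by (rule sum_le_suminf) auto
  then show ?thesis by simp
qed

text \<open>On the shell of radius about \<open>\<rho> * 2 ^ k\<close> the weight times the volume
  is comparable to \<open>\<rho> powr - \<epsilon> * (2 powr - \<epsilon>) ^ k\<close>, a geometric
  series. The constant must not depend on \<open>x\<close> or \<open>\<rho>\<close>, because
  \<open>\<rho>\<close> will later be half the distance to the centre of a bad piece.\<close>

lemma nn_integral_decay_bound:
  fixes \<epsilon> :: real
  assumes "0 < \<epsilon>"
  shows "\<exists>J>0. \<forall>(x::'a::euclidean_space) \<rho>. 0 < \<rho> \<longrightarrow>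
    (\<integral>\<^sup>+ y. ennreal ((\<rho> + norm (x - y)) powr - (real DIM('a) + \<epsilon>)) \<partial>lborel) \<le> ennreal (J * \<rho> powr - \<epsilon>)"
proof -
  let ?n = "DIM('a)"
  define q where "q = real ?n + \<epsilon>"
  define V where "V = unit_ball_vol (real ?n)"
  have V: "V > 0" unfolding V_def by simp
  define \<theta> where "\<theta> = 2 powr - \<epsilon>"
  have \<theta>: "0 < \<theta>" "\<theta> < 1" unfolding \<theta>_def using assms
    by (auto simp: powr_less_one)
  \<comment> \<open>The factor \<open>2 ^ ?n\<close> arises because the shell lies in a ball of
    radius \<open>\<rho> * 2 ^ Suc k\<close>, while the weight is estimated at
    \<open>\<rho> * 2 ^ k\<close>.\<close>
  define J where "J = V * 2 ^ ?n / (1 - \<theta>)"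
  have "(\<integral>\<^sup>+ y. ennreal ((\<rho> + norm (x - y)) powr - q) \<partial>lborel) \<le> ennreal (J * \<rho> powr - \<epsilon>)"
    if \<rho>: "0 < \<rho>" for x :: 'a and \<rho>
  proof -
    let ?B = "\<lambda>k. cball x (\<rho> * 2 ^ Suc k)"
    have term_eq: "(\<rho> * 2 ^ k) powr - q * (V * (\<rho> * 2 ^ Suc k) ^ ?n) = V * 2 ^ ?n * \<rho> powr - \<epsilon> * \<theta> ^ k" for k
    proof -
      have "(\<rho> * 2 ^ Suc k) ^ ?n = 2 ^ ?n * (\<rho> * 2 ^ k) powr real ?n"
        using \<rho> by (simp add: powr_realpow power_mult_distrib)
      moreover have "(\<rho> * 2 ^ k) powr - q * (\<rho> * 2 ^ k) powr real ?n = (\<rho> * 2 ^ k) powr - \<epsilon>"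
        unfolding q_def by (simp flip: powr_add)
      moreover have "(\<rho> * 2 ^ k) powr - \<epsilon> = \<rho> powr - \<epsilon> * \<theta> ^ k"
        unfolding \<theta>_def using \<rho> by (simp add: powr_mult powr_powr mult.commute flip: powr_realpow)
      ultimately show ?thesis by (simp add: mult.assoc mult.left_commute)
    qed
    have "(\<integral>\<^sup>+ y. ennreal ((\<rho> + norm (x - y)) powr - q) \<partial>lborel) \<le>
        (\<integral>\<^sup>+ y. (\<Sum>k. ennreal ((\<rho> * 2 ^ k) powr - q) * indicator (?B k) y) \<partial>lborel)"
    proof (intro nn_integral_mono)
      fix y :: 'a
      obtain k where k: "norm (x - y) \<le> \<rho> * 2 ^ Suc k" "\<rho> * 2 ^ k \<le> \<rho> + norm (x - y)"
        using two_power_bracket[OF \<rho>, of "norm (x - y)"] by auto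
      have "(\<rho> + norm (x - y)) powr - q \<le> (\<rho> * 2 ^ k) powr - q"
        using k \<rho> assms by (intro powr_mono2') (auto simp: q_def)
      then have "ennreal ((\<rho> + norm (x - y)) powr - q) \<le> ennreal ((\<rho> * 2 ^ k) powr - q) * indicator (?B k) y"
        using k by (auto simp: indicator_def dist_norm intro!: ennreal_leI)
      also have "\<dots> \<le> (\<Sum>k. ennreal ((\<rho> * 2 ^ k) powr - q) * indicator (?B k) y)"
        by (rule ennreal_le_suminf[of "\<lambda>k. ennreal ((\<rho> * 2 ^ k) powr - q) * indicator (?B k) y" k])
      finally show "ennreal ((\<rho> + norm (x - y)) powr - q) \<le>
          (\<Sum>k. ennreal ((\<rho> * 2 ^ k) powr - q) * indicator (?B k) y)" .
    qed
    also have "\<dots> = (\<Sum>k. ennreal ((\<rho> * 2 ^ k) powr - q) * emeasure lborel (?B k))"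
    proof (subst nn_integral_suminf)
      show "(\<Sum>k. \<integral>\<^sup>+ y. ennreal ((\<rho> * 2 ^ k) powr - q) * indicator (?B k) y \<partial>lborel) =
          (\<Sum>k. ennreal ((\<rho> * 2 ^ k) powr - q) * emeasure lborel (?B k))"
        by (simp only: nn_integral_cmult_indicator sets_lborel borel_closed[OF closed_cball])
    next
      fix k show "(\<lambda>y. ennreal ((\<rho> * 2 ^ k) powr - q) * indicator (?B k) y) \<in> borel_measurable lborel"
        by (intro borel_measurable_times_ennreal borel_measurable_const borel_measurable_indicator) simp
    qed
    also have "\<dots> = (\<Sum>k. ennreal (V * 2 ^ ?n * \<rho> powr - \<epsilon> * \<theta> ^ k))"
    proof -
      have "ennreal ((\<rho> * 2 ^ k) powr - q) * emeasure lborel (?B k) = ennreal (V * 2 ^ ?n * \<rho> powr - \<epsilon> * \<theta> ^ k)" for k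
      proof -
        have "emeasure lborel (?B k) = ennreal (V * (\<rho> * 2 ^ Suc k) ^ ?n)"
          using \<rho> by (subst emeasure_cball) (simp_all add: V_def)
        then show ?thesis
          by (simp only: ennreal_mult'[symmetric] term_eq[symmetric] powr_ge_zero)
      qed
      then show ?thesis by (simp only:)
    qed
    also have "\<dots> = ennreal (\<Sum>k. V * 2 ^ ?n * \<rho> powr - \<epsilon> * \<theta> ^ k)"
      using V \<theta> by (intro suminf_ennreal2 summable_mult summable_geometric) simp_all
    also have "(\<Sum>k. V * 2 ^ ?n * \<rho> powr - \<epsilon> * \<theta> ^ k) = J * \<rho> powr - \<epsilon>"
      using \<theta> suminf_mult[OF summable_geometric[of \<theta>], of "V * 2 ^ ?n * \<rho> powr - \<epsilon>"]
      by (simp add: suminf_geometric J_def)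
    finally show ?thesis .
  qed
  moreover have "J > 0" using V \<theta> by (simp add: J_def)
  ultimately show ?thesis unfolding q_def by (intro exI[of _ J]) simp
qed

section \<open>Stopping cubes\<close>

text \<open>Half-open, so that bisection gives an exact partition and no boundary null sets have to
  be discarded; \<open>a\<close> is the lower corner.\<close>

definition hcube :: "real ^ 'n \<Rightarrow> real \<Rightarrow> (real ^ 'n) set" where
  "hcube a s = {x. \<forall>i. a $ i \<le> x $ i \<and> x $ i < a $ i + s}"

lemma hcube_borel [measurable]: "hcube a s \<in> sets borel"
  unfolding hcube_def by measurable

lemma emeasure_hcube:
  fixes a :: "real ^ 'n"
  assumes "0 < s"
  shows "emeasure lborel (hcube a s) = ennreal (s ^ CARD('n))"
proof (rule antisym)
  let ?u = "a + (\<chi> i. s)"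
  have prod: "(\<Prod>b\<in>Basis. (?u - a) \<bullet> b) = s ^ CARD('n)"
    by (simp add: prod_Basis_vec inner_axis)
  have le: "a \<bullet> b \<le> ?u \<bullet> b" if "b \<in> Basis" for b
    using that assms by (auto simp: Basis_vec_def inner_axis)
  have "emeasure lborel (hcube a s) \<le> emeasure lborel (cbox a ?u)"
    by (intro emeasure_mono) (auto simp: hcube_def mem_box_cart less_imp_le)
  also have "\<dots> = ennreal (s ^ CARD('n))"
    using le by (subst emeasure_lborel_cbox) (simp_all only: prod)
  finally show "emeasure lborel (hcube a s) \<le> ennreal (s ^ CARD('n))" .
  have "ennreal (s ^ CARD('n)) = emeasure lborel (box a ?u)"
    using le by (subst emeasure_lborel_box) (simp_all only: prod)
  also have "\<dots> \<le> emeasure lborel (hcube a s)"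
    by (intro emeasure_mono) (auto simp: hcube_def mem_box_cart less_imp_le)
  finally show "ennreal (s ^ CARD('n)) \<le> emeasure lborel (hcube a s)" .
qed

text \<open>The ball is centred at the corner, and the l1 norm gives the crude factor
  \<open>CARD('n)\<close>. This is where \<open>real CARD('n) ^ CARD('n)\<close> in the volume bound
  of \<open>CZ_decomposition\<close> originates.\<close>

lemma hcube_subset_cball:
  fixes a :: "real ^ 'n"
  assumes "0 < s"
  shows "hcube a s \<subseteq> cball a (real CARD('n) * s)"
proof
  fix x assume x: "x \<in> hcube a s"
  have "norm (x - a) \<le> (\<Sum>i\<in>UNIV. \<bar>(x - a) $ i\<bar>)" by (rule norm_le_l1_cart)
  also have "\<dots> \<le> (\<Sum>i\<in>(UNIV :: 'n set). s)"
  proof (intro sum_mono)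
    fix i show "\<bar>(x - a) $ i\<bar> \<le> s"
      using x[unfolded hcube_def, THEN CollectD, THEN spec, of i] by auto
  qed
  finally show "x \<in> cball a (real CARD('n) * s)" by (simp add: dist_norm norm_minus_commute)
qed

text \<open>The subcubes are indexed by the set \<open>S\<close> of coordinates in which the upper
  half is taken.\<close>

lemma hcube_bisect:
  fixes a :: "real ^ 'n"
  assumes "0 < s"
  defines "A \<equiv> \<lambda>S. a + (\<chi> i. if i \<in> S then s / 2 else 0)"
  shows "hcube (A S) (s / 2) \<subseteq> hcube a s"
    and "x \<in> hcube a s \<Longrightarrow> \<exists>S. x \<in> hcube (A S) (s / 2)"
    and "S \<noteq> S' \<Longrightarrow> hcube (A S) (s / 2) \<inter> hcube (A S') (s / 2) = {}"
proof -
  show "hcube (A S) (s / 2) \<subseteq> hcube a s"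
  proof
    fix x assume x: "x \<in> hcube (A S) (s / 2)"
    show "x \<in> hcube a s" unfolding hcube_def
    proof (intro CollectI allI)
      fix i show "a $ i \<le> x $ i \<and> x $ i < a $ i + s"
        using x[unfolded hcube_def A_def, THEN CollectD, THEN spec, of i] assms(1)
        by (auto split: if_splits)
    qed
  qed
  show "\<exists>S. x \<in> hcube (A S) (s / 2)" if "x \<in> hcube a s"
  proof
    show "x \<in> hcube (A {i. a $ i + s / 2 \<le> x $ i}) (s / 2)" unfolding hcube_def
    proof (intro CollectI allI)
      fix i show "A {i. a $ i + s / 2 \<le> x $ i} $ i \<le> x $ i \<and> x $ i < A {i. a $ i + s / 2 \<le> x $ i} $ i + s / 2"
        using that[unfolded hcube_def, THEN CollectD, THEN spec, of i] by (auto simp: A_def)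
    qed
  qed
  show "hcube (A S) (s / 2) \<inter> hcube (A S') (s / 2) = {}" if "S \<noteq> S'"
  proof -
    from that obtain i where i: "i \<in> S \<longleftrightarrow> i \<notin> S'" by blast
    have False if "x \<in> hcube (A S) (s / 2)" "x \<in> hcube (A S') (s / 2)" for x
      using that[unfolded hcube_def A_def, THEN CollectD, THEN spec, of i] i
      by (auto split: if_splits)
    then show ?thesis by blast
  qed
qed

text \<open>\<open>I\<close> stands for the integral of |f| over a set, \<open>Z\<close> for the
  starting cube, and \<open>r\<close> for the side length at which bisection is broken off. Each
  member of \<open>F\<close> is a corner with a side length. A point missed by \<open>F\<close>
  still lies in a cube of side \<open>r\<close> over which the mean is at most \<alpha>; this
  replaces the statement about small cubes in the limit that an infinite process would give.\<close>

definition stopping_cubes ::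
  "((real ^ 'n) set \<Rightarrow> ennreal) \<Rightarrow> real \<Rightarrow> (real ^ 'n) set \<Rightarrow> real \<Rightarrow> ((real ^ 'n) \<times> real) set \<Rightarrow> bool" where
  "stopping_cubes I \<alpha> Z r F \<longleftrightarrow> finite F \<and> disjoint_family_on (\<lambda>p. hcube (fst p) (snd p)) F \<and>
    (\<forall>p\<in>F. 0 < snd p \<and> hcube (fst p) (snd p) \<subseteq> Z \<and>
      ennreal (\<alpha> * snd p ^ CARD('n)) \<le> I (hcube (fst p) (snd p)) \<and>
      I (hcube (fst p) (snd p)) \<le> ennreal (2 ^ CARD('n) * \<alpha> * snd p ^ CARD('n))) \<and>
    (\<forall>x\<in>Z. (\<exists>p\<in>F. x \<in> hcube (fst p) (snd p)) \<or>
      (\<exists>c. x \<in> hcube c r \<and> hcube c r \<subseteq> Z \<and> I (hcube c r) \<le> ennreal (\<alpha> * r ^ CARD('n))))"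

text \<open>Induction on the number of bisections left: a half whose mean exceeds \<alpha> is
  selected and not divided again, and every other half satisfies the hypothesis needed to
  recurse.\<close>

lemma stopping_cubes_exist:
  fixes I :: "(real ^ 'n) set \<Rightarrow> ennreal"
  assumes mono: "\<And>A B. A \<subseteq> B \<Longrightarrow> I A \<le> I B"
    and "0 < s" "I (hcube a s) \<le> ennreal (\<alpha> * s ^ CARD('n))"
  shows "\<exists>F. stopping_cubes I \<alpha> (hcube a s) (s / 2 ^ k) F"
  using assms(2,3)
proof (induction k arbitrary: a s)
  case 0
  then show ?case by (intro exI[of _ "{}"]) (auto simp: stopping_cubes_def disjoint_family_on_def)
next
  case (Suc k)
  define A where "A = (\<lambda>S. a + (\<chi> i. if i \<in> S then s / 2 else 0))"
  have sub: "hcube (A S) (s / 2) \<subseteq> hcube a s" for S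
    unfolding A_def by (rule hcube_bisect(1)[OF Suc.prems(1)])
  have cov: "\<exists>S. x \<in> hcube (A S) (s / 2)" if "x \<in> hcube a s" for x
    unfolding A_def by (rule hcube_bisect(2)[OF Suc.prems(1) that])
  have dis: "hcube (A S) (s / 2) \<inter> hcube (A S') (s / 2) = {}" if "S \<noteq> S'" for S S'
    unfolding A_def by (rule hcube_bisect(3)[OF Suc.prems(1) that])
  let ?r = "s / 2 ^ Suc k"
  have "\<exists>F. stopping_cubes I \<alpha> (hcube (A S) (s / 2)) ?r F" for S
  proof (cases "I (hcube (A S) (s / 2)) \<le> ennreal (\<alpha> * (s / 2) ^ CARD('n))")
    case True
    then show ?thesis using Suc.IH[of "s / 2" "A S"] Suc.prems(1) by simp
  next
    case False
    \<comment> \<open>The upper bound for a selected cube comes from its parent, which was not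
      selected and has \<open>2 ^ CARD('n)\<close> times the volume.\<close>
    have "I (hcube (A S) (s / 2)) \<le> I (hcube a s)" by (rule mono[OF sub])
    also have "\<dots> \<le> ennreal (2 ^ CARD('n) * \<alpha> * (s / 2) ^ CARD('n))"
      using Suc.prems(2) by (simp add: power_divide)
    finally show ?thesis
      using False Suc.prems(1) unfolding stopping_cubes_def
      by (intro exI[of _ "{(A S, s / 2)}"]) (auto simp: disjoint_family_on_def)
  qed
  then obtain F where F: "\<And>S. stopping_cubes I \<alpha> (hcube (A S) (s / 2)) ?r (F S)" by metis
  note FD = F[unfolded stopping_cubes_def]
  have F2: "hcube (fst p) (snd p) \<inter> hcube (fst q) (snd q) = {}" if "p \<in> F S" "q \<in> F S" "p \<noteq> q" for S p q
    using FD[of S] that by (auto simp: disjoint_family_on_def)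
  have F3: "0 < snd p \<and> hcube (fst p) (snd p) \<subseteq> hcube (A S) (s / 2) \<and>
      ennreal (\<alpha> * snd p ^ CARD('n)) \<le> I (hcube (fst p) (snd p)) \<and>
      I (hcube (fst p) (snd p)) \<le> ennreal (2 ^ CARD('n) * \<alpha> * snd p ^ CARD('n))" if "p \<in> F S" for S p
    using FD[of S] that by blast
  have F4: "(\<exists>p\<in>F S. x \<in> hcube (fst p) (snd p)) \<or>
      (\<exists>c. x \<in> hcube c ?r \<and> hcube c ?r \<subseteq> hcube (A S) (s / 2) \<and> I (hcube c ?r) \<le> ennreal (\<alpha> * ?r ^ CARD('n)))"
    if "x \<in> hcube (A S) (s / 2)" for S x
    using FD[of S] that by blast
  have "stopping_cubes I \<alpha> (hcube a s) ?r (\<Union>S. F S)"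
    unfolding stopping_cubes_def disjoint_family_on_def
  proof (intro conjI ballI impI)
    show "finite (\<Union>S. F S)" using FD by auto
  next
    fix p q assume "p \<in> (\<Union>S. F S)" "q \<in> (\<Union>S. F S)" and pq: "p \<noteq> q"
    then obtain S S' where S: "p \<in> F S" "q \<in> F S'" by blast
    show "hcube (fst p) (snd p) \<inter> hcube (fst q) (snd q) = {}"
    proof (cases "S = S'")
      case True then show ?thesis using F2 S pq by blast
    next
      case False then show ?thesis using F3[OF S(1)] F3[OF S(2)] dis[OF False] by blast
    qed
  next
    fix p assume "p \<in> (\<Union>S. F S)"
    then obtain S where S: "p \<in> F S" by blast
    show "0 < snd p" "hcube (fst p) (snd p) \<subseteq> hcube a s"
      "ennreal (\<alpha> * snd p ^ CARD('n)) \<le> I (hcube (fst p) (snd p))"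
      "I (hcube (fst p) (snd p)) \<le> ennreal (2 ^ CARD('n) * \<alpha> * snd p ^ CARD('n))"
      using F3[OF S] sub[of S] by auto
  next
    fix x assume "x \<in> hcube a s"
    then obtain S where S: "x \<in> hcube (A S) (s / 2)" using cov by blast
    show "(\<exists>p\<in>\<Union>S. F S. x \<in> hcube (fst p) (snd p)) \<or>
      (\<exists>c. x \<in> hcube c ?r \<and> hcube c ?r \<subseteq> hcube a s \<and> I (hcube c ?r) \<le> ennreal (\<alpha> * ?r ^ CARD('n)))"
      using F4[OF S] sub[of S] by blast
  qed
  then show ?case by blast
qed

section \<open>Continuous functions of compact support and their stopping cubes\<close>

lemma Cc_space_borel: "f \<in> Cc_space \<Longrightarrow> f \<in> borel_measurable borel"
  by (auto simp: Cc_space_def intro: borel_measurable_continuous_onI)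

lemma Cc_space_bounded_support:
  assumes "f \<in> Cc_space"
  obtains R where "0 < R" "\<And>x. f x \<noteq> 0 \<Longrightarrow> norm x < R"
proof -
  have "bounded {x. f x \<noteq> 0}"
    using assms by (auto simp: Cc_space_def dest!: compact_imp_bounded intro: bounded_subset closure_subset)
  then obtain R where "R > 0" "\<And>x. f x \<noteq> 0 \<Longrightarrow> norm x < R"
    by (auto simp: bounded_pos_less)
  then show ?thesis using that by blast
qed

lemma Cc_space_bounded:
  assumes "f \<in> Cc_space"
  obtains B where "0 < B" "\<And>x. cmod (f x) \<le> B"
proof -
  obtain R where R: "0 < R" "\<And>x. f x \<noteq> 0 \<Longrightarrow> norm x < R" using Cc_space_bounded_support[OF assms] by blast
  have "compact (f ` cball 0 R)"
    using assms by (intro compact_continuous_image) (auto simp: Cc_space_def intro: continuous_on_subset)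
  then obtain B where B: "B > 0" "\<And>x. x \<in> cball 0 R \<Longrightarrow> cmod (f x) \<le> B"
    by (auto dest!: compact_imp_bounded simp: bounded_pos)
  have "cmod (f x) \<le> B" for x
    using B R(2)[of x] by (cases "f x = 0") (auto simp: dist_norm)
  then show ?thesis using that B by blast
qed

lemma Cc_space_integrable:
  assumes "f \<in> Cc_space"
  shows "integrable lborel f"
proof -
  obtain R where R: "0 < R" "\<And>x. f x \<noteq> 0 \<Longrightarrow> norm x < R" using Cc_space_bounded_support[OF assms] by blast
  have "integrable lborel (\<lambda>x. indicator (cball 0 R) x *\<^sub>R f x)"
    using assms by (intro borel_integrable_compact) (auto simp: Cc_space_def intro: continuous_on_subset)
  also have "(\<lambda>x. indicator (cball 0 R) x *\<^sub>R f x) = f"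
    using R(2) by (force simp: indicator_def dist_norm)
  finally show ?thesis .
qed

text \<open>Uniform continuity takes the place of the Lebesgue differentiation theorem: once
  \<open>f\<close> oscillates by less than \<alpha> on the final cubes, a mean of at most \<alpha>
  forces |f| \<le> 2\<alpha> pointwise.\<close>

lemma stopping_cubes_Cc_space:
  fixes f :: "real ^ 'n \<Rightarrow> complex"
  assumes f: "f \<in> Cc_space" and lam: "0 < \<alpha>"
  defines "I \<equiv> \<lambda>Q. \<integral>\<^sup>+ y. indicator Q y * ennreal (cmod (f y)) \<partial>lborel"
  shows "\<exists>Z r F. stopping_cubes I \<alpha> Z r F \<and> (\<forall>x. x \<notin> (\<Union>p\<in>F. hcube (fst p) (snd p)) \<longrightarrow> cmod (f x) \<le> 2 * \<alpha>)"
proof -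
  let ?n = "CARD('n)"
  note [measurable] = Cc_space_borel[OF f]
  have cont: "continuous_on UNIV f" using f by (simp add: Cc_space_def)
  define L where "L = (LINT y|lborel. cmod (f y))"
  have intf: "integrable lborel (\<lambda>y. cmod (f y))" using Cc_space_integrable[OF f] by simp
  have L: "0 \<le> L" "(\<integral>\<^sup>+ y. ennreal (cmod (f y)) \<partial>lborel) = ennreal L"
    unfolding L_def using intf by (auto simp: nn_integral_eq_integral)
  obtain R where R: "0 < R" "\<And>x. f x \<noteq> 0 \<Longrightarrow> norm x < R" using Cc_space_bounded_support[OF f] by blast
  \<comment> \<open>Each summand has a purpose: 1 gives \<open>s \<le> s ^ ?n\<close>,
    \<open>2 * R\<close> makes the cube contain the support, and \<open>L / \<alpha>\<close> brings
    the mean over the starting cube down to at most \<alpha>.\<close>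
  define s where "s = 1 + 2 * R + L / \<alpha>"
  have s: "0 < s" "1 \<le> s" "2 * R \<le> s" "L / \<alpha> \<le> s" unfolding s_def using R(1) divide_nonneg_pos[OF L(1) lam] by linarith+
  define a :: "real ^ 'n" where "a = (\<chi> i. - s / 2)"
  have "I (hcube a s) \<le> ennreal L"
    unfolding L(2)[symmetric] I_def by (intro nn_integral_mono) (auto simp: indicator_def)
  also have "L \<le> \<alpha> * s ^ ?n"
  proof -
    have "L \<le> \<alpha> * s" using s(4) lam by (simp add: field_simps)
    also have "\<dots> \<le> \<alpha> * s ^ ?n" using s(2) lam by (simp add: self_le_power)
    finally show ?thesis .
  qed
  finally have start: "I (hcube a s) \<le> ennreal (\<alpha> * s ^ ?n)" by (simp add: ennreal_leI)
  have outside: "f x = 0" if "x \<notin> hcube a s" for x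
  proof (rule ccontr)
    assume "f x \<noteq> 0"
    then have x: "norm x < R" by (rule R)
    have "- s / 2 \<le> x $ i \<and> x $ i < s / 2" for i
      using component_le_norm_cart[of x i] x s(3) by auto
    then have "x \<in> hcube a s" by (simp add: hcube_def a_def)
    with that show False by simp
  qed
  \<comment> \<open>A compact ball containing the half-open starting cube, on which \<open>f\<close>
    is uniformly continuous.\<close>
  define Z where "Z = cball a (real ?n * s)"
  have "uniformly_continuous_on Z f"
    unfolding Z_def by (intro compact_uniformly_continuous continuous_on_subset[OF cont]) auto
  then obtain d where d: "d > 0" "\<And>x y. x \<in> Z \<Longrightarrow> y \<in> Z \<Longrightarrow> dist x y < d \<Longrightarrow> dist (f x) (f y) < \<alpha>"
    unfolding uniformly_continuous_on_def using lam by metis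
  obtain k where "2 * (real ?n * s) / d < 2 ^ k" using real_arch_pow[of 2] by auto
  then have k: "2 * (real ?n * (s / 2 ^ k)) < d" using d by (simp add: field_simps)
  have "I B \<le> I C" if "B \<subseteq> C" for B C
    unfolding I_def using that by (intro nn_integral_mono mult_right_mono) (auto simp: indicator_def)
  from stopping_cubes_exist[of I, OF this s(1) start, of k]
  obtain F where F: "stopping_cubes I \<alpha> (hcube a s) (s / 2 ^ k) F" by blast
  have F4: "(\<exists>p\<in>F. x \<in> hcube (fst p) (snd p)) \<or>
      (\<exists>c. x \<in> hcube c (s / 2 ^ k) \<and> hcube c (s / 2 ^ k) \<subseteq> hcube a s \<and>
        I (hcube c (s / 2 ^ k)) \<le> ennreal (\<alpha> * (s / 2 ^ k) ^ ?n))" if "x \<in> hcube a s" for x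
    using F that unfolding stopping_cubes_def by blast
  have "(\<exists>p\<in>F. x \<in> hcube (fst p) (snd p)) \<or> cmod (f x) \<le> 2 * \<alpha>" for x
  proof (cases "x \<in> hcube a s \<and> \<not> (\<exists>p\<in>F. x \<in> hcube (fst p) (snd p))")
    case False
    then show ?thesis using outside[of x] lam by auto
  next
    case True
    then obtain c where c: "x \<in> hcube c (s / 2 ^ k)" "hcube c (s / 2 ^ k) \<subseteq> hcube a s"
      "I (hcube c (s / 2 ^ k)) \<le> ennreal (\<alpha> * (s / 2 ^ k) ^ ?n)" using F4 by blast
    define r where "r = s / 2 ^ k"
    have r: "0 < r" using s by (simp add: r_def)
    \<comment> \<open>Any two points of the small cube are within
      \<open>2 * (real ?n * r) < d\<close>. Averaging this inequality over the cube bounds |f(x)| -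
      \<alpha> by the mean, hence by \<alpha>. Where |f(x)| < \<alpha>, \<open>ennreal\<close>
      truncates the left side to 0, which is harmless.\<close>
    have near: "cmod (f x) - \<alpha> \<le> cmod (f y)" if y: "y \<in> hcube c r" for y
    proof -
      have "x \<in> cball c (real ?n * r)" "y \<in> cball c (real ?n * r)"
        using hcube_subset_cball[OF r, of c] c y by (auto simp: r_def)
      then have "dist x y \<le> 2 * (real ?n * r)"
        using dist_triangle2[of x y c] by (simp add: dist_commute)
      moreover have "x \<in> Z" "y \<in> Z"
        using hcube_subset_cball[OF s(1), of a] c y by (auto simp: r_def Z_def)
      ultimately have "dist (f x) (f y) < \<alpha>" using d(2) k by (simp add: r_def)
      then show ?thesis using norm_triangle_ineq2[of "f x" "f y"] by (simp add: dist_norm)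
    qed
    have "ennreal (cmod (f x) - \<alpha>) * ennreal (r ^ ?n) = (\<integral>\<^sup>+ y. ennreal (cmod (f x) - \<alpha>) * indicator (hcube c r) y \<partial>lborel)"
      using r by (simp add: nn_integral_cmult_indicator emeasure_hcube)
    also have "\<dots> \<le> I (hcube c r)"
      unfolding I_def using near by (intro nn_integral_mono) (auto simp: indicator_def intro!: ennreal_leI)
    also have "\<dots> \<le> ennreal (\<alpha> * r ^ ?n)" using c by (simp add: r_def)
    finally have "ennreal ((cmod (f x) - \<alpha>) * r ^ ?n) \<le> ennreal (\<alpha> * r ^ ?n)"
      using r by (simp add: ennreal_mult'')
    then have "(cmod (f x) - \<alpha>) * r ^ ?n \<le> \<alpha> * r ^ ?n" using lam r by (simp add: ennreal_le_iff)
    then have "cmod (f x) - \<alpha> \<le> \<alpha>" using r by simp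
    then show ?thesis by simp
  qed
  with F show ?thesis by blast
qed

section \<open>The Calderon--Zygmund decomposition\<close>

lemma nn_integral_split_disjoint:
  fixes h :: "'a::euclidean_space \<Rightarrow> ennreal"
  assumes [measurable]: "h \<in> borel_measurable borel" "\<And>p. p \<in> F \<Longrightarrow> Q p \<in> sets borel"
    and F: "finite F" "disjoint_family_on Q F"
  shows "(\<integral>\<^sup>+ y. h y \<partial>lborel) = (\<integral>\<^sup>+ y. indicator (- (\<Union>p\<in>F. Q p)) y * h y \<partial>lborel) +
    (\<Sum>p\<in>F. \<integral>\<^sup>+ y. indicator (Q p) y * h y \<partial>lborel)"
proof -
  have U [measurable]: "- (\<Union>p\<in>F. Q p) \<in> sets borel"
    using F(1) assms(2) by (intro borel_comp sets.finite_UN)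
  have "h y = indicator (- (\<Union>p\<in>F. Q p)) y * h y + (\<Sum>p\<in>F. indicator (Q p) y * h y)" for y
  proof -
    have "(\<Sum>p\<in>F. indicator (Q p) y * h y) = indicator (\<Union>p\<in>F. Q p) y * h y"
      by (simp add: indicator_UN_disjoint[OF F] sum_distrib_right)
    then show ?thesis by (simp add: indicator_def)
  qed
  then have "(\<integral>\<^sup>+ y. h y \<partial>lborel) =
      (\<integral>\<^sup>+ y. indicator (- (\<Union>p\<in>F. Q p)) y * h y + (\<Sum>p\<in>F. indicator (Q p) y * h y) \<partial>lborel)"
    by (rule nn_integral_cong)
  also have "\<dots> = (\<integral>\<^sup>+ y. indicator (- (\<Union>p\<in>F. Q p)) y * h y \<partial>lborel) +
      (\<integral>\<^sup>+ y. (\<Sum>p\<in>F. indicator (Q p) y * h y) \<partial>lborel)"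
    using U by (intro nn_integral_add borel_measurable_times_ennreal borel_measurable_indicator) measurable
  also have "(\<integral>\<^sup>+ y. (\<Sum>p\<in>F. indicator (Q p) y * h y) \<partial>lborel) =
      (\<Sum>p\<in>F. \<integral>\<^sup>+ y. indicator (Q p) y * h y \<partial>lborel)"
    by (rule nn_integral_sum) auto
  finally show ?thesis .
qed

text \<open>Seen from a point off the dilated cube the weight is essentially constant on the cube, so
  \<open>f\<close> may be replaced there by its mean: against such weights \<open>f\<close> behaves like a function bounded
  by \<open>\<beta>\<close>. This makes cancellation in a single variable sufficient below.\<close>

lemma cz_weight_bound:
  fixes f :: "real ^ 'n \<Rightarrow> complex"
  assumes [measurable]: "f \<in> borel_measurable borel" and r: "0 < r"
    and q: "0 \<le> q" and rho: "0 < \<rho>"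
    and x: "x \<notin> cball c (3 * (real CARD('n) * r))"
    and avg: "(\<integral>\<^sup>+ y. indicator (hcube c r) y * ennreal (cmod (f y)) \<partial>lborel) \<le> ennreal (\<beta> * r ^ CARD('n))"
    and be: "0 \<le> \<beta>"
  defines "w \<equiv> \<lambda>y. (\<rho> + norm (x - y)) powr - q"
  shows "(\<integral>\<^sup>+ y. indicator (hcube c r) y * (ennreal (cmod (f y)) * ennreal (w y)) \<partial>lborel) \<le>
    ennreal (2 powr q * \<beta>) * (\<integral>\<^sup>+ y. indicator (hcube c r) y * ennreal (w y) \<partial>lborel)"
proof -
  let ?n = "CARD('n)" and ?Q = "hcube c r"
  define d where "d = real ?n * r"
  have d: "0 < d" using r by (simp add: d_def)
  have xd: "3 * d < norm (x - c)" using x by (simp add: d_def dist_norm norm_minus_commute)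
  have Qd: "norm (y - c) \<le> d" if "y \<in> ?Q" for y
    using hcube_subset_cball[OF r, of c] that by (auto simp: d_def dist_norm norm_minus_commute)
  \<comment> \<open>Off the triple ball |x - y| is at least \<open>2 * d\<close>, while two points
    of the cube are at most \<open>2 * d\<close> apart; so distances from \<open>x\<close> vary at
    most by a factor 2 over the cube.\<close>
  have w_comp: "w y \<le> 2 powr q * w z" if yz: "y \<in> ?Q" "z \<in> ?Q" for y z
  proof -
    have "norm (x - z) \<le> norm (x - y) + norm (y - c) + norm (z - c)"
      using norm_triangle_ineq[of "x - y" "y - z"] norm_triangle_ineq4[of "y - c" "z - c"] by simp
    moreover have "norm (x - c) \<le> norm (x - y) + norm (y - c)"
      using norm_triangle_ineq[of "x - y" "y - c"] by simp
    ultimately have "norm (x - z) \<le> 2 * norm (x - y)" using Qd[OF yz(1)] Qd[OF yz(2)] xd by linarith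
    then have "\<rho> + norm (x - z) \<le> 2 * (\<rho> + norm (x - y))" using rho by simp
    then have "(2 * (\<rho> + norm (x - y))) powr - q \<le> (\<rho> + norm (x - z)) powr - q"
      using rho q by (intro powr_mono2') (auto intro: add_pos_nonneg)
    moreover have "(2 * (\<rho> + norm (x - y))) powr - q = 2 powr - q * w y"
      using rho by (simp add: powr_mult w_def del: distrib_left_numeral)
    ultimately have "2 powr q * (2 powr - q * w y) \<le> 2 powr q * w z" by (simp add: w_def)
    also have "2 powr q * (2 powr - q * w y) = w y" by (simp add: powr_minus)
    finally show ?thesis .
  qed
  have w0: "0 \<le> w y" for y by (simp add: w_def)
  have [measurable]: "w \<in> borel_measurable borel" unfolding w_def by measurable
  define A where "A = (\<integral>\<^sup>+ y. indicator ?Q y * (ennreal (cmod (f y)) * ennreal (w y)) \<partial>lborel)"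
  have A_le: "A \<le> ennreal (2 powr q * \<beta> * r ^ ?n) * ennreal (w z)" if z: "z \<in> ?Q" for z
  proof -
    have "A \<le> (\<integral>\<^sup>+ y. ennreal (2 powr q * w z) * (indicator ?Q y * ennreal (cmod (f y))) \<partial>lborel)"
      unfolding A_def
    proof (intro nn_integral_mono)
      fix y
      show "indicator ?Q y * (ennreal (cmod (f y)) * ennreal (w y)) \<le>
          ennreal (2 powr q * w z) * (indicator ?Q y * ennreal (cmod (f y)))"
      proof (cases "y \<in> ?Q")
        case True
        then have "ennreal (w y) \<le> ennreal (2 powr q * w z)" using w_comp z by (intro ennreal_leI) auto
        from mult_left_mono[OF this, of "ennreal (cmod (f y))"] show ?thesis
          using True by (simp add: mult.commute)
      qed simp
    qed
    also have "\<dots> = ennreal (2 powr q * w z) * (\<integral>\<^sup>+ y. indicator ?Q y * ennreal (cmod (f y)) \<partial>lborel)"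
      by (rule nn_integral_cmult) measurable
    also have "\<dots> \<le> ennreal (2 powr q * w z) * ennreal (\<beta> * r ^ ?n)"
      using avg by (intro mult_left_mono) auto
    also have "\<dots> = ennreal (2 powr q * \<beta> * r ^ ?n) * ennreal (w z)"
      using w0 be r by (simp flip: ennreal_mult add: mult_ac)
    finally show ?thesis .
  qed
  \<comment> \<open>The bound for \<open>A\<close> holds for every \<open>z\<close> in the cube, so
    it may be averaged over \<open>z\<close>; the volume \<open>r ^ ?n\<close> then cancels.\<close>
  have "A * ennreal (r ^ ?n) = (\<integral>\<^sup>+ z. A * indicator ?Q z \<partial>lborel)"
    using r by (simp add: nn_integral_cmult_indicator emeasure_hcube)
  also have "\<dots> \<le> (\<integral>\<^sup>+ z. ennreal (2 powr q * \<beta> * r ^ ?n) * (indicator ?Q z * ennreal (w z)) \<partial>lborel)"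
    using A_le by (intro nn_integral_mono) (auto simp: indicator_def)
  also have "\<dots> = ennreal (2 powr q * \<beta> * r ^ ?n) * (\<integral>\<^sup>+ z. indicator ?Q z * ennreal (w z) \<partial>lborel)"
    by (rule nn_integral_cmult) measurable
  also have "\<dots> = ennreal (2 powr q * \<beta>) * (\<integral>\<^sup>+ z. indicator ?Q z * ennreal (w z) \<partial>lborel) * ennreal (r ^ ?n)"
    using be r by (simp add: ennreal_mult mult_ac)
  finally have "ennreal (r ^ ?n) * A \<le> ennreal (r ^ ?n) *
      (ennreal (2 powr q * \<beta>) * (\<integral>\<^sup>+ z. indicator ?Q z * ennreal (w z) \<partial>lborel))"
    by (simp add: mult_ac)
  then show ?thesis
    unfolding A_def[symmetric] using r by (subst (asm) ennreal_mult_le_mult_iff) auto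
qed

text \<open>A pair \<open>p \<in> P\<close> consists of the centre and the radius of a ball containing the support
  of \<open>b p\<close>. The last clause is the bound of \<open>cz_weight_bound\<close> summed over all cubes.\<close>

definition CZ_decomposition ::
  "(real ^ 'n \<Rightarrow> complex) \<Rightarrow> real \<Rightarrow> real \<Rightarrow> ((real ^ 'n) \<times> real) set \<Rightarrow> (real ^ 'n \<Rightarrow> complex) \<Rightarrow>
    ((real ^ 'n) \<times> real \<Rightarrow> real ^ 'n \<Rightarrow> complex) \<Rightarrow> bool" where
  "CZ_decomposition f \<alpha> A P g b \<longleftrightarrow> finite P \<and> (\<forall>p\<in>P. 0 < snd p) \<and>
    g \<in> borel_measurable borel \<and> (\<forall>x. cmod (g x) \<le> 2 * 2 ^ CARD('n) * \<alpha>) \<and>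
    (\<integral>\<^sup>+ y. ennreal (cmod (g y)) \<partial>lborel) \<le> ennreal A \<and>
    (\<forall>p\<in>P. b p \<in> borel_measurable borel) \<and>
    (\<forall>p\<in>P. \<forall>x. b p x \<noteq> 0 \<longrightarrow> x \<in> cball (fst p) (snd p)) \<and>
    (\<forall>p\<in>P. (LINT y|lborel. b p y) = 0) \<and>
    (\<Sum>p\<in>P. \<integral>\<^sup>+ y. ennreal (cmod (b p y)) \<partial>lborel) \<le> ennreal (2 * A) \<and>
    (\<forall>x. f x = g x + (\<Sum>p\<in>P. b p x)) \<and>
    (\<Sum>p\<in>P. \<alpha> * snd p ^ CARD('n)) \<le> real CARD('n) ^ CARD('n) * A \<and>
    (\<forall>x q \<rho>. 0 \<le> q \<longrightarrow> 0 < \<rho> \<longrightarrow> x \<notin> (\<Union>p\<in>P. cball (fst p) (3 * snd p)) \<longrightarrow>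
      (\<integral>\<^sup>+ y. ennreal (cmod (f y)) * ennreal ((\<rho> + norm (x - y)) powr - q) \<partial>lborel) \<le>
      ennreal (2 powr q * (2 * 2 ^ CARD('n) * \<alpha>)) * (\<integral>\<^sup>+ y. ennreal ((\<rho> + norm (x - y)) powr - q) \<partial>lborel))"

text \<open>On each stopping cube \<open>g\<close> is the mean of \<open>f\<close>, elsewhere it is
  \<open>f\<close>; each \<open>b p\<close> is \<open>f\<close> minus its mean on one cube. Selected
  cubes have means of at least \<alpha> and are disjoint, so their total volume is at most
  \<open>A / \<alpha>\<close>.\<close>

lemma CZ_decomposition_exists:
  fixes f :: "real ^ 'n \<Rightarrow> complex"
  assumes f: "f \<in> Cc_space" and al: "0 < \<alpha>" and A: "(\<integral>\<^sup>+ y. ennreal (cmod (f y)) \<partial>lborel) \<le> ennreal A" "0 \<le> A"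
  shows "\<exists>P g b. CZ_decomposition f \<alpha> A P g b"
proof -
  let ?n = "CARD('n)"
  note [measurable] = Cc_space_borel[OF f]
  define Q where "Q = (\<lambda>p :: (real ^ 'n) \<times> real. hcube (fst p) (snd p))"
  define J where "J = (\<lambda>Z. \<integral>\<^sup>+ y. indicator Z y * ennreal (cmod (f y)) \<partial>lborel)"
  obtain Z r F where F: "stopping_cubes J \<alpha> Z r F"
    and F4: "\<And>x. x \<notin> (\<Union>p\<in>F. Q p) \<Longrightarrow> cmod (f x) \<le> 2 * \<alpha>"
    using stopping_cubes_Cc_space[OF f al] unfolding Q_def J_def by blast
  have fin: "finite F" and disj: "disjoint_family_on Q F"
    using F unfolding stopping_cubes_def Q_def by blast+
  have Qm [measurable]: "Q p \<in> sets borel" for p unfolding Q_def by measurable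
  note split = nn_integral_split_disjoint[where Q = Q, OF _ Qm fin disj]
  define I where "I p = (\<integral>\<^sup>+ y. indicator (Q p) y * ennreal (cmod (f y)) \<partial>lborel)" for p
  have pos: "0 < snd p" and lo: "ennreal (\<alpha> * snd p ^ ?n) \<le> I p" and up: "I p \<le> ennreal (2 ^ ?n * \<alpha> * snd p ^ ?n)"
    if "p \<in> F" for p
    using F that unfolding stopping_cubes_def I_def Q_def J_def by blast+
  have emQ: "emeasure lborel (Q p) = ennreal (snd p ^ ?n)" if "p \<in> F" for p
    using pos[OF that] by (simp add: Q_def emeasure_hcube)
  have measQ: "measure lborel (Q p) = snd p ^ ?n" if "p \<in> F" for p
    using emQ[OF that] pos[OF that] by (simp add: measure_def)
  have intf: "integrable lborel f" by (rule Cc_space_integrable[OF f])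
  have intfQ: "integrable lborel (\<lambda>y. indicator (Q p) y *\<^sub>R f y)" for p
    using intf by (intro integrable_mult_indicator) auto
  define m where "m p = (LINT y|lborel. indicator (Q p) y *\<^sub>R f y) / of_real (snd p ^ ?n)" for p
  have m_le: "ennreal (cmod (m p) * snd p ^ ?n) \<le> I p" if p: "p \<in> F" for p
  proof -
    have "ennreal (cmod (m p) * snd p ^ ?n) = ennreal (cmod (LINT y|lborel. indicator (Q p) y *\<^sub>R f y))"
      using pos[OF p] by (simp add: m_def norm_divide norm_power)
    also have "\<dots> \<le> (\<integral>\<^sup>+ y. ennreal (cmod (indicator (Q p) y *\<^sub>R f y)) \<partial>lborel)"
      by (rule integral_norm_bound_ennreal[OF intfQ])
    also have "\<dots> = I p" unfolding I_def by (intro nn_integral_cong) (auto simp: indicator_def)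
    finally show ?thesis .
  qed
  have m_bd: "cmod (m p) \<le> 2 ^ ?n * \<alpha>" if p: "p \<in> F" for p
  proof -
    have "ennreal (cmod (m p) * snd p ^ ?n) \<le> ennreal (2 ^ ?n * \<alpha> * snd p ^ ?n)"
      using m_le[OF p] up[OF p] by (rule order_trans)
    then show ?thesis using pos[OF p] al by (simp add: ennreal_le_iff)
  qed
  define b where "b p y = indicator (Q p) y *\<^sub>R (f y - m p)" for p y
  \<comment> \<open>With this definition the identity \<open>f = g + \<Sum> b\<close> is immediate.
    That \<open>g\<close> is a mean on a cube then follows because disjointness leaves a single
    nonzero summand.\<close>
  define g where "g y = f y - (\<Sum>p\<in>F. b p y)" for y
  have bm [measurable]: "b p \<in> borel_measurable borel" for p unfolding b_def by measurable
  have gm [measurable]: "g \<in> borel_measurable borel" unfolding g_def by measurable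
  have bsum: "(\<Sum>p\<in>F. b p y) = f y - m p" if "p \<in> F" "y \<in> Q p" for p y
  proof -
    have "b p' y = 0" if "p' \<in> F - {p}" for p'
      using disj that \<open>p \<in> F\<close> \<open>y \<in> Q p\<close> by (auto simp: disjoint_family_on_def b_def indicator_def)
    then have "(\<Sum>p'\<in>F - {p}. b p' y) = 0" by (intro sum.neutral) blast
    then show ?thesis using that by (simp add: sum.remove[OF fin that(1)] b_def)
  qed
  have g_in: "g y = m p" if "p \<in> F" "y \<in> Q p" for p y
    using bsum[OF that] by (simp add: g_def)
  have g_out: "g y = f y" if "y \<notin> (\<Union>p\<in>F. Q p)" for y
    using that by (auto simp: g_def b_def intro!: sum.neutral)
  have Isum: "(\<integral>\<^sup>+ y. indicator (- (\<Union>p\<in>F. Q p)) y * ennreal (cmod (f y)) \<partial>lborel) + (\<Sum>p\<in>F. I p) \<le> ennreal A"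
    using A(1) unfolding I_def by (subst split[symmetric]) auto
  then have Isum': "(\<Sum>p\<in>F. I p) \<le> ennreal A"
    by (rule order_trans[rotated]) simp
  \<comment> \<open>Passes from corner and side of a cube to centre and radius of a ball around it.
    As \<open>D\<close> is injective on \<open>F\<close>, the pieces can be reindexed by balls
    through its inverse \<open>E\<close>.\<close>
  define D where "D p = (fst p, real ?n * snd p)" for p :: "(real ^ 'n) \<times> real"
  have injD: "inj_on D F" by (auto simp: D_def inj_on_def prod_eq_iff)
  define E where "E = inv_into F D"
  have ED: "E (D p) = p" if "p \<in> F" for p unfolding E_def using injD that by (rule inv_into_f_f)
  have Q_ball: "Q p \<subseteq> cball (fst p) (real ?n * snd p)" if "p \<in> F" for p
    unfolding Q_def by (rule hcube_subset_cball[OF pos[OF that]])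
  have "CZ_decomposition f \<alpha> A (D ` F) g (\<lambda>p. b (E p))"
    unfolding CZ_decomposition_def
  proof (intro conjI ballI allI impI)
    show "finite (D ` F)" using fin by simp
    show "0 < snd p" if "p \<in> D ` F" for p using that pos by (auto simp: D_def)
    show "g \<in> borel_measurable borel" by measurable
    show "cmod (g x) \<le> 2 * 2 ^ ?n * \<alpha>" for x
    proof (cases "x \<in> (\<Union>p\<in>F. Q p)")
      case True
      then obtain p where p: "p \<in> F" "x \<in> Q p" by blast
      have "cmod (g x) \<le> 2 ^ ?n * \<alpha>" using g_in[OF p] m_bd[OF p(1)] by simp
      also have "\<dots> \<le> 2 * 2 ^ ?n * \<alpha>" using al by simp
      finally show ?thesis .
    next
      case False
      then have "cmod (g x) \<le> 2 * \<alpha>" using F4[OF False] g_out[OF False] by simp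
      also have "\<dots> \<le> 2 * 2 ^ ?n * \<alpha>" using al by simp
      finally show ?thesis .
    qed
    show "(\<integral>\<^sup>+ y. ennreal (cmod (g y)) \<partial>lborel) \<le> ennreal A"
    proof -
      have "(\<integral>\<^sup>+ y. ennreal (cmod (g y)) \<partial>lborel) =
          (\<integral>\<^sup>+ y. indicator (- (\<Union>p\<in>F. Q p)) y * ennreal (cmod (g y)) \<partial>lborel) +
          (\<Sum>p\<in>F. \<integral>\<^sup>+ y. indicator (Q p) y * ennreal (cmod (g y)) \<partial>lborel)"
        by (rule split) measurable
      also have "\<dots> \<le> (\<integral>\<^sup>+ y. indicator (- (\<Union>p\<in>F. Q p)) y * ennreal (cmod (f y)) \<partial>lborel) + (\<Sum>p\<in>F. I p)"
      proof (intro add_mono sum_mono nn_integral_mono)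
        fix y show "indicator (- (\<Union>p\<in>F. Q p)) y * ennreal (cmod (g y)) \<le>
            indicator (- (\<Union>p\<in>F. Q p)) y * ennreal (cmod (f y))"
          using g_out[of y] by (auto simp: indicator_def)
      next
        fix p assume p: "p \<in> F"
        have "(\<integral>\<^sup>+ y. indicator (Q p) y * ennreal (cmod (g y)) \<partial>lborel) =
            (\<integral>\<^sup>+ y. ennreal (cmod (m p)) * indicator (Q p) y \<partial>lborel)"
          using g_in[OF p] by (intro nn_integral_cong) (auto simp: indicator_def)
        also have "\<dots> = ennreal (cmod (m p) * snd p ^ ?n)"
          using emQ[OF p] pos[OF p] by (simp add: nn_integral_cmult_indicator ennreal_mult)
        also have "\<dots> \<le> I p" by (rule m_le[OF p])
        finally show "(\<integral>\<^sup>+ y. indicator (Q p) y * ennreal (cmod (g y)) \<partial>lborel) \<le> I p" .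
      qed
      also have "\<dots> \<le> ennreal A" by (rule Isum)
      finally show ?thesis .
    qed
    show "b (E p) \<in> borel_measurable borel" for p by measurable
    show "x \<in> cball (fst p) (snd p)" if "p \<in> D ` F" "b (E p) x \<noteq> 0" for p x
    proof -
      from that(1) obtain q where q: "q \<in> F" "p = D q" by blast
      then have "x \<in> Q q" using that(2) by (auto simp: ED b_def indicator_def split: if_splits)
      then show ?thesis using Q_ball[OF q(1)] by (auto simp: q(2) D_def)
    qed
    show "(LINT y|lborel. b (E p) y) = 0" if "p \<in> D ` F" for p
    proof -
      from that obtain q where q: "q \<in> F" "p = D q" by blast
      have i2: "integrable lborel (\<lambda>y. indicator (Q q) y *\<^sub>R m q)"
        using emQ[OF q(1)] by (intro integrable_scaleR_left integrable_real_indicator) auto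
      have "(LINT y|lborel. b q y) = (LINT y|lborel. indicator (Q q) y *\<^sub>R f y - indicator (Q q) y *\<^sub>R m q)"
        unfolding b_def by (simp add: scaleR_diff_right)
      also have "\<dots> = (LINT y|lborel. indicator (Q q) y *\<^sub>R f y) - (LINT y|lborel. indicator (Q q) y *\<^sub>R m q)"
        by (rule Bochner_Integration.integral_diff[OF intfQ i2])
      also have "(LINT y|lborel. indicator (Q q) y *\<^sub>R m q) = (snd q ^ ?n) *\<^sub>R m q"
        using measQ[OF q(1)] emQ[OF q(1)] by (subst integral_scaleR_left) auto
      also have "\<dots> = (LINT y|lborel. indicator (Q q) y *\<^sub>R f y)"
        using pos[OF q(1)] by (simp add: m_def scaleR_conv_of_real)
      finally show ?thesis using q ED by simp
    qed
    have b_le: "(\<integral>\<^sup>+ y. ennreal (cmod (b p y)) \<partial>lborel) \<le> 2 * I p" if p: "p \<in> F" for p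
    proof -
      have "(\<integral>\<^sup>+ y. ennreal (cmod (b p y)) \<partial>lborel) \<le>
        (\<integral>\<^sup>+ y. indicator (Q p) y * ennreal (cmod (f y)) + ennreal (cmod (m p)) * indicator (Q p) y \<partial>lborel)"
      proof (intro nn_integral_mono)
        fix y
        have "ennreal (cmod (f y - m p)) \<le> ennreal (cmod (f y)) + ennreal (cmod (m p))"
          using norm_triangle_ineq4[of "f y" "m p"] by (simp flip: ennreal_plus add: ennreal_leI)
        then show "ennreal (cmod (b p y)) \<le> indicator (Q p) y * ennreal (cmod (f y)) + ennreal (cmod (m p)) * indicator (Q p) y"
          by (auto simp: b_def indicator_def)
      qed
      also have "\<dots> = I p + ennreal (cmod (m p) * snd p ^ ?n)"
        using emQ[OF p] pos[OF p]
        by (subst nn_integral_add) (auto simp: nn_integral_cmult_indicator ennreal_mult I_def)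
      also have "\<dots> \<le> I p + I p" using m_le[OF p] by (intro add_left_mono)
      finally show ?thesis by (simp add: mult_2)
    qed
    show "(\<Sum>p\<in>D ` F. \<integral>\<^sup>+ y. ennreal (cmod (b (E p) y)) \<partial>lborel) \<le> ennreal (2 * A)"
    proof -
      have "(\<Sum>p\<in>D ` F. \<integral>\<^sup>+ y. ennreal (cmod (b (E p) y)) \<partial>lborel) = (\<Sum>p\<in>F. \<integral>\<^sup>+ y. ennreal (cmod (b p y)) \<partial>lborel)"
        using injD by (simp add: sum.reindex ED)
      also have "\<dots> \<le> (\<Sum>p\<in>F. 2 * I p)" using b_le by (rule sum_mono)
      also have "\<dots> = 2 * (\<Sum>p\<in>F. I p)" by (simp add: sum_distrib_left)
      also have "\<dots> \<le> 2 * ennreal A" using Isum' by (intro mult_left_mono) auto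
      also have "\<dots> = ennreal (2 * A)" using A(2) by (simp add: ennreal_mult)
      finally show ?thesis .
    qed
    show "f x = g x + (\<Sum>p\<in>D ` F. b (E p) x)" for x
      using injD by (simp add: sum.reindex ED g_def)
    show "(\<Sum>p\<in>D ` F. \<alpha> * snd p ^ ?n) \<le> real ?n ^ ?n * A"
    proof -
      have "ennreal (\<Sum>p\<in>F. \<alpha> * snd p ^ ?n) = (\<Sum>p\<in>F. ennreal (\<alpha> * snd p ^ ?n))"
        using al pos by (intro sum_ennreal[symmetric]) (auto intro: less_imp_le)
      also have "\<dots> \<le> (\<Sum>p\<in>F. I p)" using lo by (rule sum_mono)
      also have "\<dots> \<le> ennreal A" by (rule Isum')
      finally have "(\<Sum>p\<in>F. \<alpha> * snd p ^ ?n) \<le> A" using A(2) by (simp add: ennreal_le_iff)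
      then have "real ?n ^ ?n * (\<Sum>p\<in>F. \<alpha> * snd p ^ ?n) \<le> real ?n ^ ?n * A" by (intro mult_left_mono) auto
      moreover have "(\<Sum>p\<in>D ` F. \<alpha> * snd p ^ ?n) = real ?n ^ ?n * (\<Sum>p\<in>F. \<alpha> * snd p ^ ?n)"
        unfolding sum.reindex[OF injD] by (simp add: D_def power_mult_distrib sum_distrib_left mult_ac)
      ultimately show ?thesis by simp
    qed
    fix x and q \<rho> :: real
    assume q: "0 \<le> q" and rho: "0 < \<rho>" and x: "x \<notin> (\<Union>p\<in>D ` F. cball (fst p) (3 * snd p))"
    define w where "w = (\<lambda>y. (\<rho> + norm (x - y)) powr - q)"
    have [measurable]: "w \<in> borel_measurable borel" unfolding w_def by measurable
    \<comment> \<open>One constant serves both regions: off the cubes |f| \<le> 2\<alpha> holds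
      pointwise, and on each cube \<open>cz_weight_bound\<close> applies with mean bound
      \<open>2 ^ ?n * \<alpha>\<close>.\<close>
    let ?C = "ennreal (2 powr q * (2 * 2 ^ ?n * \<alpha>))"
    have "(\<integral>\<^sup>+ y. ennreal (cmod (f y)) * ennreal (w y) \<partial>lborel) =
        (\<integral>\<^sup>+ y. indicator (- (\<Union>p\<in>F. Q p)) y * (ennreal (cmod (f y)) * ennreal (w y)) \<partial>lborel) +
        (\<Sum>p\<in>F. \<integral>\<^sup>+ y. indicator (Q p) y * (ennreal (cmod (f y)) * ennreal (w y)) \<partial>lborel)"
      by (rule split) measurable
    also have "\<dots> \<le> ?C * (\<integral>\<^sup>+ y. indicator (- (\<Union>p\<in>F. Q p)) y * ennreal (w y) \<partial>lborel) +
        (\<Sum>p\<in>F. ?C * (\<integral>\<^sup>+ y. indicator (Q p) y * ennreal (w y) \<partial>lborel))"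
    proof (intro add_mono sum_mono)
      have U [measurable]: "- (\<Union>p\<in>F. Q p) \<in> sets borel" using fin Qm by (intro borel_comp sets.finite_UN)
      have "2 * \<alpha> \<le> 2 powr q * (2 * 2 ^ ?n * \<alpha>)"
      proof -
        have "1 * (2 * 1 * \<alpha>) \<le> 2 powr q * (2 * 2 ^ ?n * \<alpha>)"
          using al q by (intro mult_mono) (auto simp: ge_one_powr_ge_zero)
        then show ?thesis by simp
      qed
      then have "ennreal (cmod (f y)) \<le> ?C" if "y \<notin> (\<Union>p\<in>F. Q p)" for y
        using F4[OF that] by (intro ennreal_leI) simp
      then have "(\<integral>\<^sup>+ y. indicator (- (\<Union>p\<in>F. Q p)) y * (ennreal (cmod (f y)) * ennreal (w y)) \<partial>lborel) \<le>
          (\<integral>\<^sup>+ y. ?C * (indicator (- (\<Union>p\<in>F. Q p)) y * ennreal (w y)) \<partial>lborel)"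
        by (intro nn_integral_mono) (auto simp: indicator_def intro!: mult_right_mono)
      also have "\<dots> = ?C * (\<integral>\<^sup>+ y. indicator (- (\<Union>p\<in>F. Q p)) y * ennreal (w y) \<partial>lborel)"
        using U by (intro nn_integral_cmult borel_measurable_times_ennreal borel_measurable_indicator) measurable
      finally show "(\<integral>\<^sup>+ y. indicator (- (\<Union>p\<in>F. Q p)) y * (ennreal (cmod (f y)) * ennreal (w y)) \<partial>lborel) \<le>
          ?C * (\<integral>\<^sup>+ y. indicator (- (\<Union>p\<in>F. Q p)) y * ennreal (w y) \<partial>lborel)" .
    next
      fix p assume p: "p \<in> F"
      have "(\<integral>\<^sup>+ y. indicator (Q p) y * (ennreal (cmod (f y)) * ennreal (w y)) \<partial>lborel) \<le>
          ennreal (2 powr q * (2 ^ ?n * \<alpha>)) * (\<integral>\<^sup>+ y. indicator (Q p) y * ennreal (w y) \<partial>lborel)"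
        unfolding Q_def w_def
      proof (rule cz_weight_bound)
        show "x \<notin> cball (fst p) (3 * (real ?n * snd p))" using x p by (auto simp: D_def)
      qed (use pos[OF p] up[OF p] al q rho in \<open>auto simp: I_def Q_def\<close>)
      also have "\<dots> \<le> ?C * (\<integral>\<^sup>+ y. indicator (Q p) y * ennreal (w y) \<partial>lborel)"
        using al by (intro mult_right_mono ennreal_leI) auto
      finally show "(\<integral>\<^sup>+ y. indicator (Q p) y * (ennreal (cmod (f y)) * ennreal (w y)) \<partial>lborel) \<le>
          ?C * (\<integral>\<^sup>+ y. indicator (Q p) y * ennreal (w y) \<partial>lborel)" .
    qed
    also have "\<dots> = ?C * ((\<integral>\<^sup>+ y. indicator (- (\<Union>p\<in>F. Q p)) y * ennreal (w y) \<partial>lborel) +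
        (\<Sum>p\<in>F. \<integral>\<^sup>+ y. indicator (Q p) y * ennreal (w y) \<partial>lborel))"
      by (simp add: distrib_left sum_distrib_left)
    also have "\<dots> = ?C * (\<integral>\<^sup>+ y. ennreal (w y) \<partial>lborel)"
      using split[of "\<lambda>y. ennreal (w y)"] by simp
    finally show "(\<integral>\<^sup>+ y. ennreal (cmod (f y)) * ennreal ((\<rho> + norm (x - y)) powr - q) \<partial>lborel) \<le>
        ?C * (\<integral>\<^sup>+ y. ennreal ((\<rho> + norm (x - y)) powr - q) \<partial>lborel)"
      unfolding w_def .
  qed
  then show ?thesis by blast
qed

section \<open>Cancellation against the kernel\<close>

lemma prod_mono_ennreal:
  fixes f g :: "'i \<Rightarrow> ennreal"
  assumes "\<And>i. i \<in> A \<Longrightarrow> f i \<le> g i"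
  shows "prod f A \<le> prod g A"
  using assms by (induction A rule: infinite_finite_induct) (auto intro!: mult_mono)

text \<open>Fixing \<open>C\<close> and \<open>\<delta>\<close> here makes every constant built from
  them a function of the kernel, independent of the operator.\<close>

locale CZ_kernel_bounds =
  fixes K :: "real ^ 'n \<Rightarrow> (real ^ 'n) ^ 'm \<Rightarrow> complex" and C \<delta> :: real
  assumes C_pos: "0 < C" and \<delta>_pos: "0 < \<delta>"
    and size: "\<And>x y. \<exists>j. x \<noteq> y $ j \<Longrightarrow>
      cmod (K x y) \<le> C / (\<Sum>i\<in>UNIV. norm (x - y $ i)) ^ (CARD('n) * CARD('m))"
    and smooth: "\<And>j x y z. norm (y $ j - z) \<le> 1 / 2 * (MAX i. norm (x - y $ i)) \<Longrightarrow>
      cmod (K x y - K x (\<chi> i. if i = j then z else y $ i)) \<le> C * norm (y $ j - z) powr \<delta> /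
        (\<Sum>i\<in>UNIV. norm (x - y $ i)) powr (real (CARD('n) * CARD('m)) + \<delta>)"
begin

lemma norm_le_sum_norm: "norm (x - y $ i) \<le> (\<Sum>i\<in>UNIV. norm (x - y $ i))"
  for x :: "real ^ 'n" and y :: "(real ^ 'n) ^ 'm"
  by (rule member_le_sum) auto

lemma smooth_component:
  assumes "norm (y $ j - z) \<le> 1 / 2 * norm (x - y $ k)"
  shows "cmod (K x y - K x (\<chi> i. if i = j then z else y $ i)) \<le> C * norm (y $ j - z) powr \<delta> /
        (\<Sum>i\<in>UNIV. norm (x - y $ i)) powr (real (CARD('n) * CARD('m)) + \<delta>)"
proof (rule smooth)
  have "norm (x - y $ k) \<le> (MAX i. norm (x - y $ i))" by (rule Max_ge) auto
  with assms show "norm (y $ j - z) \<le> 1 / 2 * (MAX i. norm (x - y $ i))" by linarith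
qed

text \<open>Smoothness in the single variables yields joint continuity in \<open>y\<close> by
  changing one coordinate after another. The purpose is Borel measurability of the slice
  \<open>K x\<close> at each fixed \<open>x\<close>, off the point with all coordinates equal to
  \<open>x\<close>.\<close>

lemma kernel_continuous_at:
  assumes ne: "y0 $ k \<noteq> x"
  shows "isCont (K x) y0"
proof -
  let ?S = "\<lambda>y :: (real ^ 'n) ^ 'm. \<Sum>i\<in>UNIV. norm (x - y $ i)"
  let ?e = "real (CARD('n) * CARD('m)) + \<delta>"
  \<comment> \<open>\<open>Y A y\<close> has moved from \<open>y0\<close> to \<open>y\<close> in the
    coordinates of \<open>A\<close> only; the induction on \<open>A\<close> ends at
    \<open>Y UNIV y = y\<close>.\<close>
  define Y where "Y A y = (\<chi> i. if i \<in> A then y $ i else y0 $ i)" for A and y :: "(real ^ 'n) ^ 'm"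
  have Y_lim: "(Y A \<longlongrightarrow> y0) (at y0)" for A
    unfolding Y_def
  proof (rule vec_tendstoI)
    fix i
    show "((\<lambda>y. (\<chi> i. if i \<in> A then y $ i else y0 $ i) $ i) \<longlongrightarrow> y0 $ i) (at y0)"
      by (cases "i \<in> A") (auto intro!: tendsto_vec_nth tendsto_ident_at)
  qed
  have S_lim: "((\<lambda>y. ?S (Y A y)) \<longlongrightarrow> ?S y0) (at y0)" for A
    by (intro tendsto_sum tendsto_norm tendsto_diff tendsto_const tendsto_vec_nth Y_lim)
  have S_pos: "0 < ?S y0"
    using ne by (intro less_le_trans[OF _ norm_le_sum_norm[of x y0 k]]) auto
  have "((\<lambda>y. K x (Y A y)) \<longlongrightarrow> K x y0) (at y0)" if "finite A" for A
    using that
  proof induction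
    case empty
    have "Y {} y = y0" for y by (simp add: Y_def)
    then show ?case by simp
  next
    case (insert j A)
    let ?d = "\<lambda>y. norm (y0 $ j - y $ j)"
    have d_lim: "(?d \<longlongrightarrow> 0) (at y0)"
      by (auto intro!: tendsto_eq_intros tendsto_vec_nth)
    have "((\<lambda>y. 1 / 2 * norm (x - Y A y $ k) - ?d y) \<longlongrightarrow> 1 / 2 * norm (x - y0 $ k) - 0) (at y0)"
      by (intro tendsto_diff tendsto_mult tendsto_const tendsto_norm tendsto_vec_nth Y_lim d_lim)
    \<comment> \<open>Near \<open>y0\<close> the next coordinate moves by less than half of |x -
      Y_k|, so the smoothness condition is available for this move.\<close>
    then have "eventually (\<lambda>y. 0 < 1 / 2 * norm (x - Y A y $ k) - ?d y) (at y0)"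
      using ne by (intro order_tendstoD) auto
    then have ev: "eventually (\<lambda>y. norm (K x (Y A y) - K x (Y (insert j A) y)) \<le> C * ?d y powr \<delta> / ?S (Y A y) powr ?e) (at y0)"
    proof eventually_elim
      case (elim y)
      have eq: "Y A y $ j = y0 $ j" using insert by (simp add: Y_def)
      have "Y (insert j A) y = (\<chi> i. if i = j then y $ j else Y A y $ i)"
        by (auto simp: Y_def vec_eq_iff)
      then show ?case using smooth_component[of "Y A y" j "y $ j" x k] elim eq by simp
    qed
    have "((\<lambda>y. C * ?d y powr \<delta> / ?S (Y A y) powr ?e) \<longlongrightarrow> C * 0 powr \<delta> / ?S y0 powr ?e) (at y0)"
      using S_pos \<delta>_pos
      by (intro tendsto_divide tendsto_mult tendsto_const tendsto_powr' tendsto_powr S_lim d_lim) auto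
    then have "((\<lambda>y. C * ?d y powr \<delta> / ?S (Y A y) powr ?e) \<longlongrightarrow> 0) (at y0)" by simp
    then have "((\<lambda>y. K x (Y A y) - K x (Y (insert j A) y)) \<longlongrightarrow> 0) (at y0)"
      by (rule Lim_null_comparison[OF ev])
    from tendsto_diff[OF insert.IH this] show ?case by simp
  qed
  from this[of UNIV] show ?thesis by (simp add: Y_def isCont_def)
qed

lemma kernel_continuous_on: "continuous_on {y. y \<noteq> (\<chi> i. x)} (K x)"
proof (rule continuous_at_imp_continuous_on, rule ballI)
  fix y :: "(real ^ 'n) ^ 'm" assume "y \<in> {y. y \<noteq> (\<chi> i. x)}"
  then obtain k where "y $ k \<noteq> x" by (auto simp: vec_eq_iff)
  then show "isCont (K x) y" by (rule kernel_continuous_at)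
qed

text \<open>Nothing is known of \<open>K x\<close> at the diagonal point; a factor vanishing there
  hides its value.\<close>

lemma kernel_mult_borel:
  assumes [measurable]: "\<phi> \<in> borel_measurable borel" and 0: "\<phi> (\<chi> i. x) = 0"
  shows "(\<lambda>y. K x y * \<phi> y) \<in> borel_measurable borel"
proof -
  let ?U = "{y :: (real ^ 'n) ^ 'm. y \<noteq> (\<chi> i. x)}"
  have "?U = - {\<chi> i. x}" by auto
  then have U: "?U \<in> sets borel" by simp
  have [measurable]: "(\<lambda>y. indicator ?U y *\<^sub>R K x y) \<in> borel_measurable borel"
    by (rule borel_measurable_continuous_on_indicator[OF U kernel_continuous_on])
  have "(\<lambda>y. K x y * \<phi> y) = (\<lambda>y. (indicator ?U y *\<^sub>R K x y) * \<phi> y)"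
    using 0 by (auto simp: indicator_def fun_eq_iff)
  also have "\<dots> \<in> borel_measurable borel" by measurable
  finally show ?thesis .
qed

lemma kernel_slice_borel:
  assumes "c \<noteq> x"
  shows "(\<lambda>y. K x (\<chi> i. if i = j then c else y $ i)) \<in> borel_measurable borel"
proof (rule borel_measurable_continuous_onI)
  have "continuous_on UNIV (\<lambda>y :: (real ^ 'n) ^ 'm. \<chi> i. if i = j then c else y $ i)"
  proof (rule continuous_on_vec_lambda)
    fix i show "continuous_on UNIV (\<lambda>y :: (real ^ 'n) ^ 'm. if i = j then c else y $ i)"
      by (cases "i = j") (auto intro!: continuous_intros)
  qed
  moreover have "(\<chi> i. if i = j then c else y $ i) \<noteq> (\<chi> i. x)" for y :: "(real ^ 'n) ^ 'm"
    using assms by (auto simp: vec_eq_iff)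
  ultimately show "continuous_on UNIV (\<lambda>y. K x (\<chi> i. if i = j then c else y $ i))"
    by (intro continuous_on_compose2[OF kernel_continuous_on]) auto
qed

lemma size_lower:
  assumes "0 < r" "r \<le> norm (x - y $ k)"
  shows "cmod (K x y) \<le> C / r ^ (CARD('n) * CARD('m))"
proof -
  let ?S = "\<Sum>i\<in>UNIV. norm (x - y $ i)"
  have "r \<le> ?S" using assms norm_le_sum_norm[of x y k] by linarith
  have "x \<noteq> y $ k" using assms by auto
  then have "cmod (K x y) \<le> C / ?S ^ (CARD('n) * CARD('m))" by (intro size) blast
  also have "\<dots> \<le> C / r ^ (CARD('n) * CARD('m))"
    using assms \<open>r \<le> ?S\<close> C_pos by (intro divide_left_mono power_mono mult_pos_pos) auto
  finally show ?thesis .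
qed

lemma prod_vec_integrable:
  fixes h :: "'m \<Rightarrow> real ^ 'n \<Rightarrow> complex"
  assumes h: "\<And>i. integrable lborel (h i)"
  shows "integrable lborel (\<lambda>y :: (real ^ 'n) ^ 'm. \<Prod>i\<in>UNIV. h i (y $ i))"
proof (rule integrableI_bounded)
  have [measurable]: "h i \<in> borel_measurable borel" for i using h[of i] by auto
  show "(\<lambda>y :: (real ^ 'n) ^ 'm. \<Prod>i\<in>UNIV. h i (y $ i)) \<in> borel_measurable lborel" by measurable
  have "(\<integral>\<^sup>+ y. ennreal (norm (\<Prod>i\<in>UNIV. h i (y $ i))) \<partial>(lborel :: ((real ^ 'n) ^ 'm) measure)) =
      (\<integral>\<^sup>+ y. (\<Prod>i\<in>UNIV. ennreal (cmod (h i (y $ i)))) \<partial>(lborel :: ((real ^ 'n) ^ 'm) measure))"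
    by (intro nn_integral_cong) (simp add: prod_norm[symmetric] prod_ennreal)
  also have "\<dots> = (\<Prod>i\<in>UNIV. \<integral>\<^sup>+ z. ennreal (cmod (h i z)) \<partial>lborel)"
    by (rule nn_integral_vec_prod) measurable
  also have "\<dots> < \<infinity>"
    using h by (simp add: integrable_iff_bounded ennreal_prod_eq_top less_top[symmetric] less_imp_neq)
  finally show "(\<integral>\<^sup>+ y. ennreal (norm (\<Prod>i\<in>UNIV. h i (y $ i))) \<partial>(lborel :: ((real ^ 'n) ^ 'm) measure)) < \<infinity>" .
qed

text \<open>Because \<open>h j\<close> has mean zero, \<open>K\<close> may be replaced by its
  difference from the kernel with \<open>y $ j\<close> frozen at the centre \<open>c\<close>.
  Smoothness then gives decay that splits into one weight per variable, and Tonelli separates the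
  integrals. The hypothesis on \<open>\<Lambda>\<close> is what a function bounded by a multiple of
  \<open>\<Lambda> i\<close> would satisfy, but it also covers unbounded functions seen from
  afar.\<close>

lemma kernel_cancellation:
  fixes h :: "'m \<Rightarrow> real ^ 'n \<Rightarrow> complex" and \<Lambda> :: "'m \<Rightarrow> real"
  assumes h: "\<And>i. integrable lborel (h i)"
    and supp: "\<And>z. h j z \<noteq> 0 \<Longrightarrow> z \<in> cball c d"
    and mean: "(LINT z|lborel. h j z) = 0"
    and d: "0 < d" and x: "x \<notin> cball c (3 * d)"
    and \<beta>: "(\<integral>\<^sup>+ z. ennreal (cmod (h j z)) \<partial>lborel) \<le> ennreal \<beta>" "0 \<le> \<beta>"
    and \<Lambda>0: "\<And>i. 0 \<le> \<Lambda> i"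
    and \<Lambda>: "\<And>i \<rho>. i \<noteq> j \<Longrightarrow> 0 < \<rho> \<Longrightarrow>
      (\<integral>\<^sup>+ z. ennreal (cmod (h i z)) * ennreal ((\<rho> + norm (x - z)) powr - (real CARD('n) + \<delta> / real CARD('m))) \<partial>lborel) \<le>
      ennreal (\<Lambda> i * \<rho> powr - (\<delta> / real CARD('m)))"
  shows "integrable lborel (\<lambda>y. K x y * (\<Prod>i\<in>UNIV. h i (y $ i)))"
    and "cmod (LINT y|lborel. K x y * (\<Prod>i\<in>UNIV. h i (y $ i))) \<le>
      C * 2 powr (real (CARD('n) * CARD('m)) + \<delta>) * (\<Prod>i\<in>UNIV - {j}. \<Lambda> i) * \<beta> *
        (d powr \<delta> * (norm (x - c) / 2) powr - (real CARD('n) + \<delta>))"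
proof -
  let ?n = "CARD('n)" and ?m = "CARD('m)"
  define R where "R = norm (x - c)"
  define q where "q = real ?n + \<delta> / real ?m"
  define e where "e = real (?n * ?m) + \<delta>"
  \<comment> \<open>\<open>q\<close> is chosen so that \<open>CARD('m)\<close> equal weights share
    the full decay exponent \<open>e\<close> of the smoothness condition.\<close>
  have qm: "q * real ?m = e" by (simp add: q_def e_def field_simps)
  have q0: "0 \<le> q" unfolding q_def using \<delta>_pos by (intro add_nonneg_nonneg) auto
  have R: "3 * d < R" using x by (simp add: R_def dist_norm norm_minus_commute)
  have [measurable]: "h i \<in> borel_measurable borel" for i using h[of i] by auto
  define H where "H = (\<lambda>y :: (real ^ 'n) ^ 'm. \<Prod>i\<in>UNIV. h i (y $ i))"
  have H_int: "integrable lborel H" unfolding H_def by (rule prod_vec_integrable[OF h])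
  have [measurable]: "H \<in> borel_measurable borel" unfolding H_def by measurable
  have H_near: "norm (y $ j - c) \<le> d" if "H y \<noteq> 0" for y
  proof -
    have "h j (y $ j) \<noteq> 0" using that by (auto simp: H_def)
    from supp[OF this] show ?thesis by (simp add: dist_norm norm_minus_commute)
  qed
  have far: "R - d \<le> norm (x - y $ j)" if "H y \<noteq> 0" for y
    using H_near[OF that] norm_triangle_ineq[of "x - y $ j" "y $ j - c"] by (simp add: R_def)
  define u where "u = (\<lambda>y :: (real ^ 'n) ^ 'm. \<chi> i. if i = j then c else y $ i)"
  have xc: "c \<noteq> x" using R d by (auto simp: R_def)
  have [measurable]: "(\<lambda>y. K x (u y)) \<in> borel_measurable borel"
    unfolding u_def by (rule kernel_slice_borel[OF xc])
  let ?B = "C / d ^ (?n * ?m)"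
  have b1: "norm (K x y * H y) \<le> norm (?B *\<^sub>R H y)" for y
  proof (cases "H y = 0")
    case False
    have "cmod (K x y) \<le> ?B" using far[OF False] R d by (intro size_lower[of d x y j]) auto
    from mult_right_mono[OF this, of "cmod (H y)"] show ?thesis
      using C_pos d by (simp add: norm_mult)
  qed simp
  have b2: "norm (K x (u y) * H y) \<le> norm (?B *\<^sub>R H y)" for y
  proof -
    have "cmod (K x (u y)) \<le> ?B" using R d by (intro size_lower[of d x "u y" j]) (auto simp: u_def R_def)
    from mult_right_mono[OF this, of "cmod (H y)"] show ?thesis
      using C_pos d by (simp add: norm_mult)
  qed
  have "H (\<chi> i. x) = 0" using far[of "\<chi> i. x"] R d by auto
  then have m1: "(\<lambda>y. K x y * H y) \<in> borel_measurable lborel" using kernel_mult_borel[of H x] by simp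
  have m2: "(\<lambda>y. K x (u y) * H y) \<in> borel_measurable lborel" by measurable
  have i1: "integrable lborel (\<lambda>y. K x y * H y)"
    by (rule Bochner_Integration.integrable_bound[OF integrable_scaleR_right[OF H_int, of ?B] m1])
       (rule AE_I2, rule b1)
  have i2: "integrable lborel (\<lambda>y. K x (u y) * H y)"
    by (rule Bochner_Integration.integrable_bound[OF integrable_scaleR_right[OF H_int, of ?B] m2])
       (rule AE_I2, rule b2)
  from i1 show "integrable lborel (\<lambda>y. K x y * (\<Prod>i\<in>UNIV. h i (y $ i)))" by (simp add: H_def)
  have H_split: "H y = h j (y $ j) * (\<Prod>i\<in>UNIV - {j}. h i (y $ i))" for y
    unfolding H_def by (rule prod.remove) auto
  \<comment> \<open>Since \<open>u y\<close> does not involve \<open>y $ j\<close>, the factor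
    \<open>h j\<close> is the only one depending on that variable, and its mean is zero.\<close>
  have zero: "(LINT y|lborel. K x (u y) * H y) = 0"
  proof -
    let ?G = "\<lambda>y. K x (u y) * (\<Prod>i\<in>UNIV - {j}. h i (y $ i))"
    have eq: "(\<lambda>y. K x (u y) * H y) = (\<lambda>y. h j (y $ j) * ?G y)"
      by (simp add: H_split fun_eq_iff mult_ac)
    have "(LINT y|lborel. h j (y $ j) * ?G y) = 0"
    proof (rule integral_vec_split_zero[OF _ _ mean])
      show "integrable lborel (\<lambda>y. h j (y $ j) * ?G y)" using i2 unfolding eq .
      fix y z
      have "u (\<chi> i. if i = j then z else y $ i) = u y" by (auto simp: u_def vec_eq_iff)
      then show "?G (\<chi> i. if i = j then z else y $ i) = ?G y" by (auto intro!: prod.cong)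
    qed
    then show ?thesis unfolding eq .
  qed
  have diff: "(LINT y|lborel. K x y * H y) = (LINT y|lborel. (K x y - K x (u y)) * H y)"
    using Bochner_Integration.integral_diff[OF i1 i2] zero by (simp add: left_diff_distrib)
  have i3: "integrable lborel (\<lambda>y. (K x y - K x (u y)) * H y)"
    using Bochner_Integration.integrable_diff[OF i1 i2] by (simp add: left_diff_distrib)
  define w where "w = (\<lambda>z. (R / 2 + norm (x - z)) powr - q)"
  have [measurable]: "w \<in> borel_measurable borel" unfolding w_def by measurable
  have w0: "0 \<le> w z" for z by (simp add: w_def)
  have point: "cmod ((K x y - K x (u y)) * H y) \<le> C * d powr \<delta> * 2 powr e * (\<Prod>i\<in>UNIV. cmod (h i (y $ i)) * w (y $ i))" for y
  proof (cases "H y = 0")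
    case True
    then show ?thesis using C_pos w0 by (auto intro!: mult_nonneg_nonneg prod_nonneg)
  next
    case False
    let ?S = "\<Sum>i\<in>UNIV. norm (x - y $ i)"
    \<comment> \<open>From \<open>3 * d < R\<close>: |y_j - c| \<le> d \<le> (R - d) / 2 \<le> |x -
      y_j| / 2.\<close>
    have "norm (y $ j - c) \<le> 1 / 2 * norm (x - y $ j)"
      using H_near[OF False] far[OF False] R by linarith
    then have "cmod (K x y - K x (u y)) \<le> C * norm (y $ j - c) powr \<delta> / ?S powr e"
      unfolding u_def e_def by (rule smooth_component)
    also have "\<dots> \<le> C * d powr \<delta> / ?S powr e"
      using H_near[OF False] C_pos \<delta>_pos by (intro divide_right_mono mult_left_mono powr_mono2) auto
    also have "\<dots> = C * d powr \<delta> * ?S powr - e" by (simp add: powr_minus_divide)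
    also have "\<dots> \<le> C * d powr \<delta> * (2 powr e * (\<Prod>i\<in>UNIV. w (y $ i)))"
    proof (intro mult_left_mono)
      \<comment> \<open>Both parts are at most \<open>?S\<close>: each |x - y_i| trivially, and R /
        2 because R - d \<le> |x - y_j| exceeds it. The doubling costs the factor
        \<open>2 powr e\<close>, and adding \<open>R / 2\<close> keeps every weight integrable near
        \<open>x\<close>.\<close>
      have S1: "R / 2 + norm (x - y $ i) \<le> 2 * ?S" for i
        using norm_le_sum_norm[of x y i] norm_le_sum_norm[of x y j] far[OF False] R d by linarith
      have S0: "0 < ?S" using norm_le_sum_norm[of x y j] far[OF False] R d by linarith
      have "?S powr - e = 2 powr e * (2 * ?S) powr - e"
        using S0 by (simp add: powr_mult powr_minus)
      also have "(2 * ?S) powr - e = (\<Prod>i\<in>(UNIV :: 'm set). (2 * ?S) powr - q)"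
        using S0 by (simp add: powr_power qm[symmetric] mult.commute del: of_nat_mult)
      also have "\<dots> \<le> (\<Prod>i\<in>UNIV. w (y $ i))"
        unfolding w_def using S1 R d q0
        by (intro prod_mono conjI powr_mono2') (auto intro: add_pos_nonneg)
      finally show "?S powr - e \<le> 2 powr e * (\<Prod>i\<in>UNIV. w (y $ i))" by (simp add: mult_left_mono)
    qed (use C_pos in auto)
    finally have "cmod ((K x y - K x (u y)) * H y) \<le> C * d powr \<delta> * (2 powr e * (\<Prod>i\<in>UNIV. w (y $ i))) * cmod (H y)"
      unfolding norm_mult by (rule mult_right_mono) simp
    also have "\<dots> = C * d powr \<delta> * 2 powr e * (\<Prod>i\<in>UNIV. cmod (h i (y $ i)) * w (y $ i))"
      by (simp add: H_def prod_norm[symmetric] prod.distrib mult_ac)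
    finally show ?thesis .
  qed
  define A where "A = C * d powr \<delta> * 2 powr e"
  have A0: "0 \<le> A" using C_pos by (simp add: A_def)
  \<comment> \<open>Normalised so that all factors, the one at \<open>j\<close> included, carry the
    same power \<open>(R / 2) powr - (\<delta> / real ?m)\<close>; their product supplies
    \<open>(R / 2) powr - \<delta>\<close>.\<close>
  define \<Lambda>' where "\<Lambda>' i = (if i = j then \<beta> * (R / 2) powr - real ?n else \<Lambda> i)" for i
  have \<Lambda>'0: "0 \<le> \<Lambda>' i" for i using \<Lambda>0 \<beta> by (simp add: \<Lambda>'_def)
  have fac: "(\<integral>\<^sup>+ z. ennreal (cmod (h i z) * w z) \<partial>lborel) \<le> ennreal (\<Lambda>' i * (R / 2) powr - (\<delta> / real ?m))" for i
  proof (cases "i = j")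
    case False
    then show ?thesis using \<Lambda>[OF False, of "R / 2"] R d by (simp add: \<Lambda>'_def w_def q_def ennreal_mult)
  next
    case True
    have "(\<integral>\<^sup>+ z. ennreal (cmod (h j z) * w z) \<partial>lborel) \<le> (\<integral>\<^sup>+ z. ennreal ((R / 2) powr - q) * ennreal (cmod (h j z)) \<partial>lborel)"
    proof (intro nn_integral_mono)
      fix z
      have "w z \<le> (R / 2) powr - q" unfolding w_def using R d q0 by (intro powr_mono2') auto
      from mult_right_mono[OF this, of "cmod (h j z)"]
      have "cmod (h j z) * w z \<le> (R / 2) powr - q * cmod (h j z)" by (simp add: mult.commute)
      then show "ennreal (cmod (h j z) * w z) \<le> ennreal ((R / 2) powr - q) * ennreal (cmod (h j z))"
        by (simp flip: ennreal_mult add: ennreal_leI)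
    qed
    also have "\<dots> = ennreal ((R / 2) powr - q) * (\<integral>\<^sup>+ z. ennreal (cmod (h j z)) \<partial>lborel)"
      by (rule nn_integral_cmult) measurable
    also have "\<dots> \<le> ennreal ((R / 2) powr - q) * ennreal \<beta>" using \<beta> by (intro mult_left_mono) auto
    also have "\<dots> = ennreal (\<Lambda>' j * (R / 2) powr - (\<delta> / real ?m))"
      using \<beta> by (simp add: \<Lambda>'_def q_def powr_add[symmetric] ennreal_mult[symmetric] mult_ac)
    finally show ?thesis using True by simp
  qed
  have "ennreal (cmod (LINT y|lborel. (K x y - K x (u y)) * H y)) \<le>
      (\<integral>\<^sup>+ y. ennreal (cmod ((K x y - K x (u y)) * H y)) \<partial>lborel)"
    by (rule integral_norm_bound_ennreal[OF i3])
  also have "\<dots> \<le> (\<integral>\<^sup>+ y. ennreal A * (\<Prod>i\<in>UNIV. ennreal (cmod (h i (y $ i)) * w (y $ i))) \<partial>lborel)"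
  proof (intro nn_integral_mono)
    fix y
    have "ennreal (cmod ((K x y - K x (u y)) * H y)) \<le> ennreal (A * (\<Prod>i\<in>UNIV. cmod (h i (y $ i)) * w (y $ i)))"
      unfolding A_def by (rule ennreal_leI[OF point])
    also have "\<dots> = ennreal A * (\<Prod>i\<in>UNIV. ennreal (cmod (h i (y $ i)) * w (y $ i)))"
      using A0 w0 by (subst ennreal_mult') (auto simp: prod_ennreal)
    finally show "ennreal (cmod ((K x y - K x (u y)) * H y)) \<le> ennreal A * (\<Prod>i\<in>UNIV. ennreal (cmod (h i (y $ i)) * w (y $ i)))" .
  qed
  also have "\<dots> = ennreal A * (\<integral>\<^sup>+ y. (\<Prod>i\<in>UNIV. ennreal (cmod (h i (y $ i)) * w (y $ i))) \<partial>(lborel :: ((real ^ 'n) ^ 'm) measure))"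
    by (rule nn_integral_cmult) measurable
  also have "(\<integral>\<^sup>+ y. (\<Prod>i\<in>UNIV. ennreal (cmod (h i (y $ i)) * w (y $ i))) \<partial>(lborel :: ((real ^ 'n) ^ 'm) measure)) =
      (\<Prod>i\<in>UNIV. \<integral>\<^sup>+ z. ennreal (cmod (h i z) * w z) \<partial>lborel)"
    by (rule nn_integral_vec_prod) measurable
  also have "\<dots> \<le> (\<Prod>i\<in>UNIV. ennreal (\<Lambda>' i * (R / 2) powr - (\<delta> / real ?m)))"
    using fac by (rule prod_mono_ennreal)
  also have "\<dots> = ennreal (\<Prod>i\<in>UNIV. \<Lambda>' i * (R / 2) powr - (\<delta> / real ?m))"
    using \<Lambda>'0 by (intro prod_ennreal) auto
  finally have "ennreal (cmod (LINT y|lborel. (K x y - K x (u y)) * H y)) \<le>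
      ennreal A * ennreal (\<Prod>i\<in>UNIV. \<Lambda>' i * (R / 2) powr - (\<delta> / real ?m))"
    by (simp add: mult_left_mono)
  also have "\<dots> = ennreal (A * (\<Prod>i\<in>UNIV. \<Lambda>' i * (R / 2) powr - (\<delta> / real ?m)))"
    using A0 by (simp add: ennreal_mult')
  finally have "cmod (LINT y|lborel. (K x y - K x (u y)) * H y) \<le> A * (\<Prod>i\<in>UNIV. \<Lambda>' i * (R / 2) powr - (\<delta> / real ?m))"
    using A0 \<Lambda>'0 by (subst (asm) ennreal_le_iff) (auto intro!: mult_nonneg_nonneg prod_nonneg)
  also have "(\<Prod>i\<in>UNIV. \<Lambda>' i * (R / 2) powr - (\<delta> / real ?m)) = (\<Prod>i\<in>UNIV. \<Lambda>' i) * (R / 2) powr - \<delta>"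
    using R d by (simp add: prod.distrib powr_power)
  also have "(\<Prod>i\<in>UNIV. \<Lambda>' i) = \<beta> * (R / 2) powr - real ?n * (\<Prod>i\<in>UNIV - {j}. \<Lambda> i)"
    by (subst prod.remove[of _ j]) (auto simp: \<Lambda>'_def intro!: prod.cong)
  also have "A * (\<beta> * (R / 2) powr - real ?n * (\<Prod>i\<in>UNIV - {j}. \<Lambda> i) * (R / 2) powr - \<delta>) =
      C * 2 powr e * (\<Prod>i\<in>UNIV - {j}. \<Lambda> i) * \<beta> * (d powr \<delta> * ((R / 2) powr - real ?n * (R / 2) powr - \<delta>))"
    by (simp add: A_def mult_ac)
  also have "(R / 2) powr - real ?n * (R / 2) powr - \<delta> = (R / 2) powr - (real ?n + \<delta>)"
    by (simp add: powr_add[symmetric])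
  finally show "cmod (LINT y|lborel. K x y * (\<Prod>i\<in>UNIV. h i (y $ i))) \<le>
      C * 2 powr (real (CARD('n) * CARD('m)) + \<delta>) * (\<Prod>i\<in>UNIV - {j}. \<Lambda> i) * \<beta> *
        (d powr \<delta> * (norm (x - c) / 2) powr - (real CARD('n) + \<delta>))"
    using diff by (simp add: H_def e_def R_def)
qed

end

section \<open>Good and bad parts\<close>

lemma ennreal_real_bound:
  assumes "(a::ennreal) \<le> ennreal b"
  shows "a = ennreal (enn2real a)"
  using assms ennreal_less_top[of b] by (metis ennreal_enn2real le_less_trans)

text \<open>Interpolation between L1 and bounded functions: |h|^2 \<le> B |h|. For a good function
  \<open>B\<close> is proportional to the height, which is what the L2 estimate of
  \<open>T g\<close> needs.\<close>

lemma bounded_integrable_Lp2: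
  fixes h :: "'a::euclidean_space \<Rightarrow> complex"
  assumes h: "integrable lborel h" and B: "\<And>x. cmod (h x) \<le> B"
    and A: "(\<integral>\<^sup>+ y. ennreal (cmod (h y)) \<partial>lborel) \<le> ennreal A" "0 \<le> A"
  shows "h \<in> Lp_space 2" "Lp_norm 2 h \<le> (B * A) powr (1 / 2)"
proof -
  have [measurable]: "h \<in> borel_measurable borel" using h by auto
  have B0: "0 \<le> B" using B[of 0] norm_ge_zero[of "h 0"] by linarith
  have bd: "cmod (h x) powr 2 \<le> B * cmod (h x)" for x
  proof -
    have "cmod (h x) powr 2 = cmod (h x) * cmod (h x)" by (simp add: power2_eq_square)
    also have "\<dots> \<le> B * cmod (h x)" by (intro mult_right_mono B) simp
    finally show ?thesis .
  qed
  have "integrable lborel (\<lambda>x. B * cmod (h x))" using h by simp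
  then have i: "integrable lborel (\<lambda>x. cmod (h x) powr 2)"
    by (rule Bochner_Integration.integrable_bound) (use bd B0 in \<open>auto intro!: AE_I2 simp: abs_mult\<close>)
  then have i': "integrable lebesgue (\<lambda>x. cmod (h x) powr 2)"
    by (subst integrable_completion) auto
  then show "h \<in> Lp_space 2" by (auto simp: Lp_space_def intro: measurable_completion)
  have "(LINT x|lebesgue. cmod (h x) powr 2) = (LINT x|lborel. cmod (h x) powr 2)"
    by (subst integral_completion) auto
  also have "\<dots> \<le> (LINT x|lborel. B * cmod (h x))"
    using h by (intro integral_mono i bd) auto
  also have "\<dots> = B * (LINT x|lborel. cmod (h x))" by simp
  also have "\<dots> \<le> B * A"
  proof (intro mult_left_mono B0)
    have "ennreal (LINT x|lborel. cmod (h x)) = (\<integral>\<^sup>+ y. ennreal (cmod (h y)) \<partial>lborel)"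
      using h by (intro nn_integral_eq_integral[symmetric]) auto
    then have "ennreal (LINT x|lborel. cmod (h x)) \<le> ennreal A" using A(1) by (simp only:)
    then show "(LINT x|lborel. cmod (h x)) \<le> A" by (simp only: ennreal_le_iff[OF A(2)])
  qed
  finally show "Lp_norm 2 h \<le> (B * A) powr (1 / 2)"
    unfolding Lp_norm_def by (intro powr_mono2) auto
qed

lemma Lp_Chebyshev:
  fixes u :: "'a::euclidean_space \<Rightarrow> complex"
  assumes u: "u \<in> Lp_space p" and p: "0 < p" and t: "0 < t" and B: "Lp_norm p u \<le> B"
  shows "emeasure lebesgue {x. t < cmod (u x)} \<le> ennreal ((B / t) powr p)"
proof -
  have [measurable]: "u \<in> borel_measurable lebesgue" and i: "integrable lebesgue (\<lambda>x. cmod (u x) powr p)"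
    using u by (auto simp: Lp_space_def)
  let ?I = "LINT x|lebesgue. cmod (u x) powr p"
  have I0: "0 \<le> ?I" by simp
  have "emeasure lebesgue {x. t < cmod (u x)} = (\<integral>\<^sup>+ x. indicator {x. t < cmod (u x)} x \<partial>lebesgue)"
    by (rule nn_integral_indicator[symmetric]) (use borel_measurable_less[of "\<lambda>_. t" lebesgue "\<lambda>x. cmod (u x)"] in simp)
  also have "\<dots> \<le> (\<integral>\<^sup>+ x. ennreal (cmod (u x) powr p / t powr p) \<partial>lebesgue)"
  proof (intro nn_integral_mono)
    fix x
    show "indicator {x. t < cmod (u x)} x \<le> ennreal (cmod (u x) powr p / t powr p)"
    proof (cases "t < cmod (u x)")
      case True
      then have "t powr p \<le> cmod (u x) powr p" using t p by (intro powr_mono2) auto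
      then have "1 \<le> cmod (u x) powr p / t powr p" using t by (simp add: le_divide_eq)
      then show ?thesis using True by (simp flip: ennreal_1 add: ennreal_leI)
    qed simp
  qed
  also have "\<dots> = ennreal (LINT x|lebesgue. cmod (u x) powr p / t powr p)"
    using i by (intro nn_integral_eq_integral) auto
  also have "(LINT x|lebesgue. cmod (u x) powr p / t powr p) = ?I / t powr p" by simp
  also have "?I = (?I powr (1 / p)) powr p" using I0 p by (simp add: powr_powr)
  also have "(?I powr (1 / p)) powr p / t powr p = (?I powr (1 / p) / t) powr p"
    using t by (simp add: powr_divide)
  also have "ennreal \<dots> \<le> ennreal ((B / t) powr p)"
    using B t p unfolding Lp_norm_def by (intro ennreal_leI powr_mono2 divide_right_mono) auto
  finally show ?thesis .
qed

text \<open>The arguments are replaced one slot at a time, and each replacement is one use of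
  linearity. An enumeration \<open>idx\<close> is needed since the index type carries no order. As
  there are finitely many slots, the exceptional null sets can be united.\<close>

lemma multilinear_L2_telescope:
  fixes T :: "('m::finite \<Rightarrow> real ^ 'n \<Rightarrow> complex) \<Rightarrow> real ^ 'n \<Rightarrow> complex" and idx :: "'m \<Rightarrow> nat"
  assumes T: "multilinear_L2 T" and u: "\<And>i. u i \<in> Lp_space 2" and v: "\<And>i. v i \<in> Lp_space 2"
    and idx: "bij_betw idx UNIV {..<CARD('m)}"
  shows "AE x in lebesgue. T u x = T v x +
    (\<Sum>j\<in>UNIV. T (\<lambda>i. if idx i < idx j then v i else if i = j then (\<lambda>y. u i y - v i y) else u i) x)"
proof -
  define H where "H j = (\<lambda>i. if idx i < idx j then v i else if i = j then (\<lambda>y. u i y - v i y) else u i)" for j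
  \<comment> \<open>After \<open>k\<close> replacements the slots numbered below \<open>k\<close>
    hold \<open>v\<close>; thus \<open>W 0 = u\<close> and \<open>W CARD('m) = v\<close>.\<close>
  define W where "W k = (\<lambda>i. if idx i < k then v i else u i)" for k
  have inj: "idx i = idx j \<longleftrightarrow> i = j" for i j
    using idx by (auto simp: bij_betw_def inj_on_def)
  have lt: "idx i < CARD('m)" for i using idx by (auto simp: bij_betw_def)
  have W0: "W 0 = u" by (simp add: W_def)
  have Wm: "W CARD('m) = v" using lt by (simp add: W_def)
  have step: "AE x in lebesgue. T (W (idx j)) x - T (W (Suc (idx j))) x = T (H j) x" for j
  proof -
    have W2: "\<forall>i. W (idx j) i \<in> Lp_space 2" using u v by (simp add: W_def)
    have 1: "(W (idx j))(j := u j) = W (idx j)" by (auto simp: W_def)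
    have 2: "(W (idx j))(j := v j) = W (Suc (idx j))"
      using inj by (auto simp: W_def fun_eq_iff less_Suc_eq)
    have 3: "(W (idx j))(j := (\<lambda>y. 1 * u j y + (- 1) * v j y)) = H j"
      using inj by (auto simp: W_def H_def fun_eq_iff)
    have "AE x in lebesgue. T ((W (idx j))(j := (\<lambda>y. 1 * u j y + (- 1) * v j y))) x =
        1 * T ((W (idx j))(j := u j)) x + (- 1) * T ((W (idx j))(j := v j)) x"
      using T W2 u v unfolding multilinear_L2_def by blast
    then show ?thesis unfolding 1 2 3 by eventually_elim simp
  qed
  have "AE x in lebesgue. \<forall>j. T (W (idx j)) x - T (W (Suc (idx j))) x = T (H j) x"
    using step by (simp add: AE_all_countable)
  then have "AE x in lebesgue. T u x = T v x + (\<Sum>j\<in>UNIV. T (H j) x)"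
  proof eventually_elim
    case (elim x)
    have "(\<Sum>j\<in>UNIV. T (H j) x) = (\<Sum>j\<in>UNIV. T (W (idx j)) x - T (W (Suc (idx j))) x)"
      using elim by simp
    also have "\<dots> = (\<Sum>k<CARD('m). T (W k) x - T (W (Suc k)) x)"
      using sum.reindex_bij_betw[OF idx, of "\<lambda>k. T (W k) x - T (W (Suc k)) x"] by simp
    also have "\<dots> = T u x - T v x" using sum_lessThan_telescope'[of "\<lambda>k. T (W k) x" "CARD('m)"] by (simp only: W0 Wm)
    finally show ?case by simp
  qed
  then show ?thesis by (simp add: H_def)
qed

text \<open>The factor \<open>d powr \<epsilon>\<close> makes the integral scale invariant, so one
  constant serves bad pieces of every size. It follows from \<open>nn_integral_decay_bound\<close>
  with \<open>\<rho> = d\<close>.\<close>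

lemma nn_integral_tail_bound:
  assumes e: "0 < \<epsilon>"
  shows "\<exists>J>0. \<forall>(c::real ^ 'n) d. 0 < d \<longrightarrow>
    (\<integral>\<^sup>+ x. indicator (- cball c (3 * d)) x * ennreal (d powr \<epsilon> * (norm (x - c) / 2) powr - (real CARD('n) + \<epsilon>)) \<partial>lborel) \<le> ennreal J"
proof -
  let ?n = "CARD('n)"
  let ?q = "real ?n + \<epsilon>"
  obtain J where J: "0 < J" "\<And>(x::real ^ 'n) \<rho>. 0 < \<rho> \<Longrightarrow>
      (\<integral>\<^sup>+ y. ennreal ((\<rho> + norm (x - y)) powr - ?q) \<partial>lborel) \<le> ennreal (J * \<rho> powr - \<epsilon>)"
    using nn_integral_decay_bound[OF e, where ?'a = "real ^ 'n"] by auto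
  have powr_quarter: "(a / 4) powr - r = 4 powr r * a powr - r" if "0 \<le> a" for a r :: real
    using that by (simp add: powr_divide powr_minus divide_simps)
  have "(\<integral>\<^sup>+ x. indicator (- cball c (3 * d)) x * ennreal (d powr \<epsilon> * (norm (x - c) / 2) powr - ?q) \<partial>lborel) \<le> ennreal (4 powr ?q * J)"
    if d: "0 < d" for c :: "real ^ 'n" and d
  proof -
    have "(\<integral>\<^sup>+ x. indicator (- cball c (3 * d)) x * ennreal (d powr \<epsilon> * (norm (x - c) / 2) powr - ?q) \<partial>lborel) \<le>
        (\<integral>\<^sup>+ x. ennreal (4 powr ?q * d powr \<epsilon>) * ennreal ((d + norm (c - x)) powr - ?q) \<partial>lborel)"
    proof (intro nn_integral_mono)
      fix x
      show "indicator (- cball c (3 * d)) x * ennreal (d powr \<epsilon> * (norm (x - c) / 2) powr - ?q) \<le>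
          ennreal (4 powr ?q * d powr \<epsilon>) * ennreal ((d + norm (c - x)) powr - ?q)"
      proof (cases "x \<in> cball c (3 * d)")
        case False
        then have x: "3 * d < norm (c - x)" by (simp add: dist_norm)
        \<comment> \<open>Off the ball \<open>d + norm (c - x) \<le> 2 * norm (c - x)\<close>,
          whence the quotient by 4.\<close>
        have "(norm (x - c) / 2) powr - ?q \<le> ((d + norm (c - x)) / 4) powr - ?q"
          using x d e by (intro powr_mono2') (auto simp: norm_minus_commute)
        also have "\<dots> = 4 powr ?q * (d + norm (c - x)) powr - ?q"
          using d by (intro powr_quarter) auto
        finally have "d powr \<epsilon> * (norm (x - c) / 2) powr - ?q \<le> d powr \<epsilon> * (4 powr ?q * (d + norm (c - x)) powr - ?q)"
          by (rule mult_left_mono) simp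
        then have "ennreal (d powr \<epsilon> * (norm (x - c) / 2) powr - ?q) \<le> ennreal (d powr \<epsilon> * (4 powr ?q * (d + norm (c - x)) powr - ?q))"
          by (rule ennreal_leI)
        also have "\<dots> = ennreal (4 powr ?q * d powr \<epsilon>) * ennreal ((d + norm (c - x)) powr - ?q)"
          by (simp flip: ennreal_mult add: mult_ac)
        finally show ?thesis using False by simp
      qed simp
    qed
    also have "\<dots> = ennreal (4 powr ?q * d powr \<epsilon>) * (\<integral>\<^sup>+ x. ennreal ((d + norm (c - x)) powr - ?q) \<partial>lborel)"
      by (rule nn_integral_cmult) measurable
    also have "\<dots> \<le> ennreal (4 powr ?q * d powr \<epsilon>) * ennreal (J * d powr - \<epsilon>)"
      by (intro mult_left_mono J d) simp
    also have "\<dots> = ennreal (4 powr ?q * J * (d powr \<epsilon> * d powr - \<epsilon>))"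
      using J(1) by (simp flip: ennreal_mult add: mult_ac)
    also have "d powr \<epsilon> * d powr - \<epsilon> = 1" using d by (simp flip: powr_add)
    finally show ?thesis by simp
  qed
  then show ?thesis using J(1) by (intro exI[of _ "4 powr ?q * J"]) simp
qed

context CZ_kernel_bounds
begin

text \<open>The product is linear in slot \<open>j\<close>, so every piece \<open>b p\<close> can be
  cancelled against its own ball, with the same weights \<open>\<Lambda>\<close> for the other
  variables.\<close>

lemma kernel_cancellation_sum:
  fixes h :: "'m \<Rightarrow> real ^ 'n \<Rightarrow> complex" and \<Lambda> :: "'m \<Rightarrow> real" and b :: "(real ^ 'n) \<times> real \<Rightarrow> real ^ 'n \<Rightarrow> complex"
  assumes h: "\<And>i. i \<noteq> j \<Longrightarrow> integrable lborel (h i)" and hj: "h j = (\<lambda>z. \<Sum>p\<in>P. b p z)"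
    and b: "\<And>p. p \<in> P \<Longrightarrow> integrable lborel (b p)"
    and supp: "\<And>p z. p \<in> P \<Longrightarrow> b p z \<noteq> 0 \<Longrightarrow> z \<in> cball (fst p) (snd p)"
    and mean: "\<And>p. p \<in> P \<Longrightarrow> (LINT z|lborel. b p z) = 0"
    and d: "\<And>p. p \<in> P \<Longrightarrow> 0 < snd p" and x: "x \<notin> (\<Union>p\<in>P. cball (fst p) (3 * snd p))"
    and \<beta>: "\<And>p. p \<in> P \<Longrightarrow> (\<integral>\<^sup>+ z. ennreal (cmod (b p z)) \<partial>lborel) \<le> ennreal (\<beta> p)" "\<And>p. p \<in> P \<Longrightarrow> 0 \<le> \<beta> p"
    and \<Lambda>0: "\<And>i. 0 \<le> \<Lambda> i"
    and \<Lambda>: "\<And>i \<rho>. i \<noteq> j \<Longrightarrow> 0 < \<rho> \<Longrightarrow>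
      (\<integral>\<^sup>+ z. ennreal (cmod (h i z)) * ennreal ((\<rho> + norm (x - z)) powr - (real CARD('n) + \<delta> / real CARD('m))) \<partial>lborel) \<le>
      ennreal (\<Lambda> i * \<rho> powr - (\<delta> / real CARD('m)))"
  shows "integrable lborel (\<lambda>y. K x y * (\<Prod>i\<in>UNIV. h i (y $ i)))"
    and "cmod (LINT y|lborel. K x y * (\<Prod>i\<in>UNIV. h i (y $ i))) \<le>
      C * 2 powr (real (CARD('n) * CARD('m)) + \<delta>) * (\<Prod>i\<in>UNIV - {j}. \<Lambda> i) *
        (\<Sum>p\<in>P. \<beta> p * (snd p powr \<delta> * (norm (x - fst p) / 2) powr - (real CARD('n) + \<delta>)))"
proof -
  let ?G = "\<lambda>p y. K x y * (\<Prod>i\<in>UNIV. (h(j := b p)) i (y $ i))"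
  let ?D = "C * 2 powr (real (CARD('n) * CARD('m)) + \<delta>) * (\<Prod>i\<in>UNIV - {j}. \<Lambda> i)"
  have G: "integrable lborel (?G p)" "cmod (LINT y|lborel. ?G p y) \<le>
      ?D * \<beta> p * (snd p powr \<delta> * (norm (x - fst p) / 2) powr - (real CARD('n) + \<delta>))" if p: "p \<in> P" for p
  proof -
    note kc = kernel_cancellation[of "h(j := b p)" j "fst p" "snd p" x "\<beta> p" \<Lambda>]
    show "integrable lborel (?G p)"
      by (rule kc(1)) (use p h b supp mean d x \<beta> \<Lambda>0 \<Lambda> in auto)
    show "cmod (LINT y|lborel. ?G p y) \<le>
      ?D * \<beta> p * (snd p powr \<delta> * (norm (x - fst p) / 2) powr - (real CARD('n) + \<delta>))"
      by (rule kc(2)) (use p h b supp mean d x \<beta> \<Lambda>0 \<Lambda> in auto)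
  qed
  have eq: "K x y * (\<Prod>i\<in>UNIV. h i (y $ i)) = (\<Sum>p\<in>P. ?G p y)" for y
  proof -
    have "(\<Prod>i\<in>UNIV. (h(j := b p)) i (y $ i)) = b p (y $ j) * (\<Prod>i\<in>UNIV - {j}. h i (y $ i))" for p
      by (subst prod.remove[of _ j]) (auto intro!: prod.cong)
    moreover have "(\<Prod>i\<in>UNIV. h i (y $ i)) = (\<Sum>p\<in>P. b p (y $ j)) * (\<Prod>i\<in>UNIV - {j}. h i (y $ i))"
      by (subst prod.remove[of _ j]) (auto simp: hj)
    ultimately show ?thesis by (simp add: sum_distrib_left sum_distrib_right)
  qed
  show "integrable lborel (\<lambda>y. K x y * (\<Prod>i\<in>UNIV. h i (y $ i)))"
    unfolding eq using G(1) by (rule Bochner_Integration.integrable_sum)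
  have "cmod (LINT y|lborel. K x y * (\<Prod>i\<in>UNIV. h i (y $ i))) = cmod (\<Sum>p\<in>P. LINT y|lborel. ?G p y)"
    unfolding eq using G(1) by (subst Bochner_Integration.integral_sum) auto
  also have "\<dots> \<le> (\<Sum>p\<in>P. ?D * \<beta> p * (snd p powr \<delta> * (norm (x - fst p) / 2) powr - (real CARD('n) + \<delta>)))"
    by (rule order_trans[OF norm_sum]) (intro sum_mono G(2))
  also have "\<dots> = ?D * (\<Sum>p\<in>P. \<beta> p * (snd p powr \<delta> * (norm (x - fst p) / 2) powr - (real CARD('n) + \<delta>)))"
    by (simp add: sum_distrib_left mult.assoc)
  finally show "cmod (LINT y|lborel. K x y * (\<Prod>i\<in>UNIV. h i (y $ i))) \<le>
        ?D * (\<Sum>p\<in>P. \<beta> p * (snd p powr \<delta> * (norm (x - fst p) / 2) powr - (real CARD('n) + \<delta>)))" .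
qed

text \<open>Chebyshev in L1 off \<Omega>: the kernel formula bounds |u| there by a sum of tails, one
  for each piece, and each tail integrates to at most \<open>J\<close>. The result is linear in the
  total mass \<open>B\<close> of the bad function.\<close>

lemma bad_part_weak_bound:
  fixes h :: "'m \<Rightarrow> real ^ 'n \<Rightarrow> complex" and \<Lambda> :: "'m \<Rightarrow> real" and b :: "(real ^ 'n) \<times> real \<Rightarrow> real ^ 'n \<Rightarrow> complex"
  assumes P: "finite P"
    and h: "\<And>i. i \<noteq> j \<Longrightarrow> integrable lborel (h i)" and hj: "h j = (\<lambda>z. \<Sum>p\<in>P. b p z)"
    and b: "\<And>p. p \<in> P \<Longrightarrow> integrable lborel (b p)"
    and supp: "\<And>p z. p \<in> P \<Longrightarrow> b p z \<noteq> 0 \<Longrightarrow> z \<in> cball (fst p) (snd p)"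
    and mean: "\<And>p. p \<in> P \<Longrightarrow> (LINT z|lborel. b p z) = 0"
    and d: "\<And>p. p \<in> P \<Longrightarrow> 0 < snd p"
    and \<Omega>: "(\<Union>p\<in>P. cball (fst p) (3 * snd p)) \<subseteq> \<Omega>" "\<Omega> \<in> sets borel"
    and B: "(\<Sum>p\<in>P. \<integral>\<^sup>+ z. ennreal (cmod (b p z)) \<partial>lborel) \<le> ennreal B" "0 \<le> B"
    and \<Lambda>0: "\<And>i. 0 \<le> \<Lambda> i"
    and \<Lambda>: "\<And>i x \<rho>. i \<noteq> j \<Longrightarrow> x \<notin> \<Omega> \<Longrightarrow> 0 < \<rho> \<Longrightarrow>
      (\<integral>\<^sup>+ z. ennreal (cmod (h i z)) * ennreal ((\<rho> + norm (x - z)) powr - (real CARD('n) + \<delta> / real CARD('m))) \<partial>lborel) \<le>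
      ennreal (\<Lambda> i * \<rho> powr - (\<delta> / real CARD('m)))"
    and J: "0 \<le> J" "\<And>(c::real ^ 'n) d. 0 < d \<Longrightarrow>
      (\<integral>\<^sup>+ x. indicator (- cball c (3 * d)) x * ennreal (d powr \<delta> * (norm (x - c) / 2) powr - (real CARD('n) + \<delta>)) \<partial>lborel) \<le> ennreal J"
    and u: "u \<in> borel_measurable lebesgue"
      "AE x in lebesgue. x \<notin> (\<Inter>i. ess_support (h i)) \<longrightarrow> u x = (LINT y|lebesgue. K x y * (\<Prod>i\<in>UNIV. h i (y $ i)))"
    and \<tau>: "0 < \<tau>"
  shows "emeasure lebesgue {x. x \<notin> \<Omega> \<and> \<tau> < cmod (u x)} \<le>
    ennreal (C * 2 powr (real (CARD('n) * CARD('m)) + \<delta>) * (\<Prod>i\<in>UNIV - {j}. \<Lambda> i) * J * B / \<tau>)"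
proof -
  define D where "D = C * 2 powr (real (CARD('n) * CARD('m)) + \<delta>) * (\<Prod>i\<in>UNIV - {j}. \<Lambda> i)"
  define \<kappa> where "\<kappa> p x = snd p powr \<delta> * (norm (x - fst p) / 2) powr - (real CARD('n) + \<delta>)" for p and x :: "real ^ 'n"
  have \<kappa>0: "0 \<le> \<kappa> p x" for p x by (simp add: \<kappa>_def)
  have [measurable]: "\<kappa> p \<in> borel_measurable borel" for p unfolding \<kappa>_def by measurable
  have D0: "0 \<le> D" unfolding D_def using C_pos \<Lambda>0 by (auto intro!: mult_nonneg_nonneg prod_nonneg)
  define \<beta> where "\<beta> p = enn2real (\<integral>\<^sup>+ z. ennreal (cmod (b p z)) \<partial>lborel)" for p
  have \<beta>: "(\<integral>\<^sup>+ z. ennreal (cmod (b p z)) \<partial>lborel) = ennreal (\<beta> p)" if p: "p \<in> P" for p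
  proof -
    have "(\<integral>\<^sup>+ z. ennreal (cmod (b p z)) \<partial>lborel) \<le> (\<Sum>p\<in>P. \<integral>\<^sup>+ z. ennreal (cmod (b p z)) \<partial>lborel)"
      using p P by (intro member_le_sum) auto
    also have "\<dots> \<le> ennreal B" by (rule B)
    finally show ?thesis unfolding \<beta>_def by (rule ennreal_real_bound)
  qed
  have \<beta>0: "0 \<le> \<beta> p" for p by (simp add: \<beta>_def)
  have [measurable]: "\<Omega> \<in> sets borel" "\<Omega> \<in> sets lebesgue" "u \<in> borel_measurable lebesgue" using \<Omega> u by auto
  define G where "G x = D * (\<Sum>p\<in>P. \<beta> p * \<kappa> p x)" for x
  have [measurable]: "G \<in> borel_measurable borel" unfolding G_def by measurable
  have "AE x in lebesgue. x \<notin> \<Omega> \<longrightarrow> cmod (u x) \<le> G x"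
    using u(2)
  proof eventually_elim
    case (elim x)
    show ?case
    proof
      assume x: "x \<notin> \<Omega>"
      have x': "x \<notin> (\<Union>p\<in>P. cball (fst p) (3 * snd p))" using x \<Omega> by blast
      \<comment> \<open>The complement of the undilated balls is an open set on which
        \<open>h j\<close> vanishes. So \<open>x\<close> is outside the support of one factor, hence
        outside the intersection of all supports, and the kernel formula applies.\<close>
      let ?U = "- (\<Union>p\<in>P. cball (fst p) (snd p))"
      have "open ?U" using P by (intro open_Compl closed_UN) auto
      moreover have "h j y = 0" if "y \<in> ?U" for y
        unfolding hj using supp that by (intro sum.neutral) blast
      moreover have "x \<in> ?U" using x' d by (fastforce simp: dist_norm)
      moreover have "AE y in lebesgue. y \<in> ?U \<longrightarrow> h j y = 0"
        using calculation(2) by (intro AE_I2) blast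
      ultimately have "x \<in> \<Union>{U. open U \<and> (AE y in lebesgue. y \<in> U \<longrightarrow> h j y = 0)}" by blast
      then have "x \<notin> ess_support (h j)" unfolding ess_support_def by blast
      then have eq: "u x = (LINT y|lebesgue. K x y * (\<Prod>i\<in>UNIV. h i (y $ i)))" using elim by blast
      note kc = kernel_cancellation_sum[of j h b P x \<beta> \<Lambda>, OF h hj b supp mean d x' _ \<beta>0 \<Lambda>0 \<Lambda>[OF _ x]]
      have int: "integrable lborel (\<lambda>y. K x y * (\<Prod>i\<in>UNIV. h i (y $ i)))"
        by (rule kc(1)) (auto simp: \<beta>)
      have "u x = (LINT y|lborel. K x y * (\<Prod>i\<in>UNIV. h i (y $ i)))"
        unfolding eq using int by (intro integral_completion) auto
      then show "cmod (u x) \<le> G x"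
        unfolding G_def D_def \<kappa>_def using kc(2) by (simp add: \<beta>)
    qed
  qed
  then have "AE x in lebesgue. indicator {x. x \<notin> \<Omega> \<and> \<tau> < cmod (u x)} x \<le>
      ennreal (1 / \<tau>) * (indicator (- \<Omega>) x * ennreal (G x))"
  proof eventually_elim
    case (elim x)
    show ?case
    proof (cases "x \<notin> \<Omega> \<and> \<tau> < cmod (u x)")
      case True
      then have "1 \<le> 1 / \<tau> * G x" using elim \<tau> by (auto simp: le_divide_eq)
      then have "1 \<le> ennreal (1 / \<tau> * G x)" by (simp flip: ennreal_1 add: ennreal_leI)
      also have "\<dots> = ennreal (1 / \<tau>) * ennreal (G x)" using \<tau> by (intro ennreal_mult') auto
      finally show ?thesis using True by simp
    qed simp
  qed
  then have "(\<integral>\<^sup>+ x. indicator {x. x \<notin> \<Omega> \<and> \<tau> < cmod (u x)} x \<partial>lebesgue) \<le>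
      (\<integral>\<^sup>+ x. ennreal (1 / \<tau>) * (indicator (- \<Omega>) x * ennreal (G x)) \<partial>lebesgue)"
    by (rule nn_integral_mono_AE)
  also have "\<dots> = ennreal (1 / \<tau>) * (\<integral>\<^sup>+ x. indicator (- \<Omega>) x * ennreal (G x) \<partial>lborel)"
    by (simp add: nn_integral_completion nn_integral_cmult)
  also have "(\<integral>\<^sup>+ x. indicator (- \<Omega>) x * ennreal (G x) \<partial>lborel) \<le>
      (\<integral>\<^sup>+ x. (\<Sum>p\<in>P. ennreal (D * \<beta> p) * (indicator (- cball (fst p) (3 * snd p)) x * ennreal (\<kappa> p x))) \<partial>lborel)"
  proof (intro nn_integral_mono)
    fix x
    show "indicator (- \<Omega>) x * ennreal (G x) \<le>
      (\<Sum>p\<in>P. ennreal (D * \<beta> p) * (indicator (- cball (fst p) (3 * snd p)) x * ennreal (\<kappa> p x)))"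
    proof (cases "x \<in> \<Omega>")
      case False
      have "G x = (\<Sum>p\<in>P. D * \<beta> p * \<kappa> p x)" by (simp add: G_def sum_distrib_left mult.assoc)
      then have "ennreal (G x) = (\<Sum>p\<in>P. ennreal (D * \<beta> p * \<kappa> p x))"
        using D0 \<beta>0 \<kappa>0 by (simp only: sum_ennreal mult_nonneg_nonneg)
      also have "\<dots> = (\<Sum>p\<in>P. ennreal (D * \<beta> p) * (indicator (- cball (fst p) (3 * snd p)) x * ennreal (\<kappa> p x)))"
      proof (intro sum.cong refl)
        fix p assume "p \<in> P"
        then have "x \<notin> cball (fst p) (3 * snd p)" using False \<Omega> by blast
        then show "ennreal (D * \<beta> p * \<kappa> p x) = ennreal (D * \<beta> p) * (indicator (- cball (fst p) (3 * snd p)) x * ennreal (\<kappa> p x))"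
          using D0 \<beta>0 \<kappa>0 by (simp add: ennreal_mult' del: mem_cball)
      qed
      finally show ?thesis using False by simp
    qed simp
  qed
  also have "\<dots> = (\<Sum>p\<in>P. ennreal (D * \<beta> p) * (\<integral>\<^sup>+ x. indicator (- cball (fst p) (3 * snd p)) x * ennreal (\<kappa> p x) \<partial>lborel))"
    by (subst nn_integral_sum) (simp_all add: nn_integral_cmult)
  also have "\<dots> \<le> (\<Sum>p\<in>P. ennreal (D * \<beta> p) * ennreal J)"
    unfolding \<kappa>_def by (intro sum_mono mult_left_mono J d) auto
  also have "\<dots> = (\<Sum>p\<in>P. ennreal (D * \<beta> p * J))"
    using D0 \<beta>0 J by (intro sum.cong refl ennreal_mult[symmetric] mult_nonneg_nonneg) auto
  also have "\<dots> = ennreal (\<Sum>p\<in>P. D * \<beta> p * J)"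
    using D0 \<beta>0 J by (intro sum_ennreal mult_nonneg_nonneg) auto
  also have "(\<Sum>p\<in>P. D * \<beta> p * J) = D * J * (\<Sum>p\<in>P. \<beta> p)"
    by (simp add: sum_distrib_left mult_ac)
  also have "\<dots> \<le> D * J * B"
  proof (intro mult_left_mono)
    have "ennreal (\<Sum>p\<in>P. \<beta> p) = (\<Sum>p\<in>P. \<integral>\<^sup>+ z. ennreal (cmod (b p z)) \<partial>lborel)"
      using \<beta>0 by (subst sum_ennreal[symmetric]) (auto simp: \<beta>)
    then have "ennreal (\<Sum>p\<in>P. \<beta> p) \<le> ennreal B" using B(1) by (simp only:)
    then show "(\<Sum>p\<in>P. \<beta> p) \<le> B" by (simp only: ennreal_le_iff[OF B(2)])
  qed (use D0 J in auto)
  finally have "(\<integral>\<^sup>+ x. indicator {x. x \<notin> \<Omega> \<and> \<tau> < cmod (u x)} x \<partial>lebesgue) \<le> ennreal (1 / \<tau>) * ennreal (D * J * B)"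
    by (simp add: mult_left_mono ennreal_leI)
  also have "\<dots> = ennreal (D * J * B / \<tau>)"
    using \<tau> D0 J B by (simp flip: ennreal_mult')
  also have "(\<integral>\<^sup>+ x. indicator {x. x \<notin> \<Omega> \<and> \<tau> < cmod (u x)} x \<partial>lebesgue) = emeasure lebesgue {x. x \<notin> \<Omega> \<and> \<tau> < cmod (u x)}"
  proof (rule nn_integral_indicator)
    have "{x \<in> space lebesgue. x \<notin> \<Omega> \<and> \<tau> < cmod (u x)} \<in> sets lebesgue" by measurable
    then show "{x. x \<notin> \<Omega> \<and> \<tau> < cmod (u x)} \<in> sets lebesgue" by simp
  qed
  finally show ?thesis unfolding D_def .
qed

end

lemma integrable_of_nn_integral_le:
  fixes b :: "'a::euclidean_space \<Rightarrow> complex"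
  assumes [measurable]: "b \<in> borel_measurable borel"
    and fin: "(\<integral>\<^sup>+ y. ennreal (cmod (b y)) \<partial>lborel) \<le> ennreal A"
  shows "integrable lborel b"
  by (rule integrableI_bounded) (use fin in \<open>auto intro: le_less_trans\<close>)

text \<open>The decomposition heights are \<open>s * a i\<close> with \<open>s = (t / (\<Prod>i. a i)) powr (1 / m)\<close>. Then the
  exceptional set, the good part and each of the \<open>m\<close> bad parts contribute \<open>O(1 / s)\<close>.\<close>

context CZ_kernel_bounds
begin

lemma weak_bound_Cc:
  fixes N :: real
  assumes N: "0 \<le> N"
  shows "\<exists>A>0. \<forall>T :: ('m \<Rightarrow> real ^ 'n \<Rightarrow> complex) \<Rightarrow> real ^ 'n \<Rightarrow> complex.
    CZ_operator T K \<longrightarrow> bound_L2 T N \<longrightarrow>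
    (\<forall>f a t. (\<forall>i. f i \<in> Cc_space) \<longrightarrow> (\<forall>i. 0 < a i) \<longrightarrow>
      (\<forall>i. (\<integral>\<^sup>+ y. ennreal (cmod (f i y)) \<partial>lborel) \<le> ennreal (a i)) \<longrightarrow> 0 < t \<longrightarrow>
      emeasure lebesgue {x. t < cmod (T f x)} \<le> ennreal (A * ((\<Prod>i\<in>UNIV. a i) / t) powr (1 / real CARD('m))))"
proof -
  let ?n = "CARD('n)" and ?m = "CARD('m)"
  define \<epsilon> where "\<epsilon> = \<delta> / real ?m"
  define q where "q = real ?n + \<epsilon>"
  have \<epsilon>: "0 < \<epsilon>" using \<delta>_pos by (simp add: \<epsilon>_def)
  have q: "0 \<le> q" using \<epsilon> by (simp add: q_def)
  obtain J1 where J1: "0 < J1" "\<And>(x::real ^ 'n) \<rho>. 0 < \<rho> \<Longrightarrow>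
      (\<integral>\<^sup>+ y. ennreal ((\<rho> + norm (x - y)) powr - q) \<partial>lborel) \<le> ennreal (J1 * \<rho> powr - \<epsilon>)"
    using nn_integral_decay_bound[OF \<epsilon>, where ?'a = "real ^ 'n"] by (auto simp: q_def)
  obtain J2 where J2: "0 < J2" "\<And>(c::real ^ 'n) d. 0 < d \<Longrightarrow>
      (\<integral>\<^sup>+ x. indicator (- cball c (3 * d)) x * ennreal (d powr \<delta> * (norm (x - c) / 2) powr - (real ?n + \<delta>)) \<partial>lborel) \<le> ennreal J2"
    using nn_integral_tail_bound[OF \<delta>_pos, where ?'n = 'n] by auto
  define V where "V = unit_ball_vol (real ?n)"
  have V: "0 < V" by (simp add: V_def)
  define M where "M = (2 * 2 ^ ?n :: real)"
  have M: "0 < M" by (simp add: M_def)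
  define c1 where "c1 = 2 powr q * M * J1"
  have c1: "0 < c1" using M J1 by (simp add: c1_def)
  \<comment> \<open>The number of terms after telescoping, one good and \<open>?m\<close> bad; each
    is tested at the level \<open>t / m1\<close>.\<close>
  define m1 where "m1 = real ?m + 1"
  have m1: "0 < m1" by (simp add: m1_def)
  define E where "E = C * 2 powr (real (?n * ?m) + \<delta>)"
  have E: "0 < E" using C_pos by (simp add: E_def)
  \<comment> \<open>\<open>k1\<close>, \<open>k2\<close>, \<open>k3\<close> belong to the
    exceptional set, the good part and a single bad part. In \<open>k3\<close> the power
    \<open>c1 ^ (?m - 1)\<close> comes from integrating out the other variables and the 2 from the
    L1 norm of the bad function.\<close>
  define k1 where "k1 = real ?m * (V * 3 ^ ?n * real ?n ^ ?n)"
  define k2 where "k2 = (N * m1) powr (2 / real ?m) * M"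
  define k3 where "k3 = E * c1 ^ (?m - 1) * J2 * 2 * m1"
  have k: "0 < k1" "0 \<le> k2" "0 < k3"
    using V M E c1 J2 m1 by (auto simp: k1_def k2_def k3_def)
  show ?thesis
  proof (intro exI[of _ "k1 + (k2 + real ?m * k3)"] conjI allI impI)
    show "0 < k1 + (k2 + real ?m * k3)" using k by (intro add_pos_nonneg add_nonneg_nonneg) auto
    fix T :: "('m \<Rightarrow> real ^ 'n \<Rightarrow> complex) \<Rightarrow> real ^ 'n \<Rightarrow> complex" and f :: "'m \<Rightarrow> real ^ 'n \<Rightarrow> complex" and a :: "'m \<Rightarrow> real" and t :: real
    assume TK: "CZ_operator T K" and T_bd: "bound_L2 T N" and f: "\<forall>i. f i \<in> Cc_space" and a: "\<forall>i. 0 < a i"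
      and fa: "\<forall>i. (\<integral>\<^sup>+ y. ennreal (cmod (f i y)) \<partial>lborel) \<le> ennreal (a i)" and t: "0 < t"
    have T_Lp: "\<forall>f. (\<forall>i. f i \<in> Lp_space 2) \<longrightarrow> T f \<in> Lp_space (2 / real ?m)" and T_lin: "multilinear_L2 T"
      and T_repr: "\<forall>f. (\<forall>i. f i \<in> Lp_space 2) \<longrightarrow>
      (AE x in lebesgue. x \<notin> (\<Inter>i. ess_support (f i)) \<longrightarrow>
         T f x = (LINT y|lebesgue. K x y * (\<Prod>i\<in>UNIV. f i (y $ i))))"
      using TK unfolding CZ_operator_def bounded_multilinear_L2_def by blast+
    define \<pi> where "\<pi> = (\<Prod>i\<in>UNIV. a i)"
    have \<pi>: "0 < \<pi>" using a by (simp add: \<pi>_def prod_pos)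
    \<comment> \<open>The common order of magnitude of all contributions; the heights will be
      \<open>s * a i\<close> with \<open>s = 1 / \<sigma>\<close>.\<close>
    define \<sigma> where "\<sigma> = (\<pi> / t) powr (1 / real ?m)"
    have \<sigma>: "0 < \<sigma>" using \<pi> t by (simp add: \<sigma>_def)
    have \<sigma>m: "\<sigma> ^ ?m = \<pi> / t" using \<pi> t by (simp add: \<sigma>_def powr_power)
    define s where "s = 1 / \<sigma>"
    have s: "0 < s" using \<sigma> by (simp add: s_def)
    define \<tau> where "\<tau> = t / m1"
    have \<tau>: "0 < \<tau>" using t m1 by (simp add: \<tau>_def)

    have sa: "0 < s * a i" for i using s a by simp
    have "\<exists>P g b. CZ_decomposition (f i) (s * a i) (a i) P g b" for i
      using f a fa sa by (intro CZ_decomposition_exists) (auto intro: less_imp_le)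
    then obtain P :: "'m \<Rightarrow> ((real ^ 'n) \<times> real) set" and g b
      where dec: "\<And>i. CZ_decomposition (f i) (s * a i) (a i) (P i) (g i) (b i)" by metis
    note dec = dec[unfolded CZ_decomposition_def, folded M_def]
    have P: "finite (P i)" for i using dec[of i] by blast
    have d: "0 < snd p" if "p \<in> P i" for i p using dec[of i] that by blast
    have g [measurable]: "g i \<in> borel_measurable borel" for i using dec[of i] by blast
    have g_bd: "cmod (g i x) \<le> M * (s * a i)" for i x using dec[of i] by blast
    have g_L1: "(\<integral>\<^sup>+ y. ennreal (cmod (g i y)) \<partial>lborel) \<le> ennreal (a i)" for i using dec[of i] by blast
    have b: "b i p \<in> borel_measurable borel \<and>
        (\<forall>x. b i p x \<noteq> 0 \<longrightarrow> x \<in> cball (fst p) (snd p)) \<and> (LINT y|lborel. b i p y) = 0" if "p \<in> P i" for i p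
      using dec[of i] that by blast
    have b_L1: "(\<Sum>p\<in>P i. \<integral>\<^sup>+ y. ennreal (cmod (b i p y)) \<partial>lborel) \<le> ennreal (2 * a i)" for i
      using dec[of i] by blast
    have fgb: "f i x = g i x + (\<Sum>p\<in>P i. b i p x)" for i x using dec[of i] by blast
    have vol: "(\<Sum>p\<in>P i. (s * a i) * snd p ^ ?n) \<le> real ?n ^ ?n * a i" for i using dec[of i] by blast
    have f_wt: "(\<integral>\<^sup>+ y. ennreal (cmod (f i y)) * ennreal ((\<rho> + norm (x - y)) powr - q) \<partial>lborel) \<le>
        ennreal (2 powr q * (M * (s * a i))) * (\<integral>\<^sup>+ y. ennreal ((\<rho> + norm (x - y)) powr - q) \<partial>lborel)"
      if "0 < \<rho>" "x \<notin> (\<Union>p\<in>P i. cball (fst p) (3 * snd p))" for i x \<rho>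
      using dec[of i] that q by blast


    have f_int: "integrable lborel (f i)" for i using f by (simp add: Cc_space_integrable)
    have g_int: "integrable lborel (g i)" for i by (rule integrable_of_nn_integral_le[OF g g_L1])
    have b_int: "integrable lborel (b i p)" if p: "p \<in> P i" for i p
    proof -
      have "(\<integral>\<^sup>+ y. ennreal (cmod (b i p y)) \<partial>lborel) \<le> (\<Sum>p\<in>P i. \<integral>\<^sup>+ y. ennreal (cmod (b i p y)) \<partial>lborel)"
        using p P by (intro member_le_sum) auto
      also note b_L1
      finally show ?thesis using b[OF p] integrable_of_nn_integral_le[of "b i p"] by blast
    qed
    have L2: "h \<in> Lp_space 2" if "integrable lborel h" "\<And>x. cmod (h x) \<le> B" for h :: "real ^ 'n \<Rightarrow> complex" and B
      using bounded_integrable_Lp2(1)[OF that, of "LINT x|lborel. cmod (h x)"] that(1)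
      by (simp add: nn_integral_eq_integral)
    have f_L2: "f i \<in> Lp_space 2" for i
    proof -
      obtain B where "\<And>x. cmod (f i x) \<le> B" using f Cc_space_bounded[of "f i"] by blast
      then show ?thesis by (rule L2[OF f_int])
    qed
    have g_L2: "g i \<in> Lp_space 2" for i by (rule L2[OF g_int g_bd])
    have fg: "(\<lambda>y. f i y - g i y) = (\<lambda>y. \<Sum>p\<in>P i. b i p y)" for i by (simp add: fgb)
    have fg_L2: "(\<lambda>y. f i y - g i y) \<in> Lp_space 2" for i
    proof -
      obtain B where B: "\<And>x. cmod (f i x) \<le> B" using f Cc_space_bounded[of "f i"] by blast
      have "cmod (f i x - g i x) \<le> B + M * (s * a i)" for x
        using norm_triangle_ineq4[of "f i x" "g i x"] B[of x] g_bd[of i x] by linarith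
      then show ?thesis using f_int g_int by (intro L2[of "\<lambda>y. f i y - g i y"]) auto
    qed

    define \<Omega> where "\<Omega> = (\<Union>i. \<Union>p\<in>P i. cball (fst p) (3 * snd p))"
    have \<Omega>_borel [measurable]: "\<Omega> \<in> sets borel"
      using P by (auto simp: \<Omega>_def intro!: borel_closed closed_UN)
    then have \<Omega>_sets: "\<Omega> \<in> sets borel" "\<Omega> \<in> sets lebesgue" by simp_all
    have \<Omega>_meas: "emeasure lebesgue \<Omega> \<le> ennreal (k1 * \<sigma>)"
    proof -
      have 1: "emeasure lborel (\<Union>p\<in>P i. cball (fst p) (3 * snd p)) \<le> ennreal (V * 3 ^ ?n * real ?n ^ ?n * \<sigma>)" for i
      proof -
        have "emeasure lborel (\<Union>p\<in>P i. cball (fst p) (3 * snd p)) \<le> (\<Sum>p\<in>P i. emeasure lborel (cball (fst p) (3 * snd p)))"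
          using P by (intro emeasure_subadditive_finite) auto
        also have "\<dots> = (\<Sum>p\<in>P i. ennreal (V * 3 ^ ?n * snd p ^ ?n))"
          using d by (intro sum.cong refl) (simp add: emeasure_cball less_imp_le V_def power_mult_distrib mult.assoc)
        also have "\<dots> = ennreal (\<Sum>p\<in>P i. V * 3 ^ ?n * snd p ^ ?n)"
          using d V by (intro sum_ennreal) (auto intro!: mult_nonneg_nonneg less_imp_le)
        also have "(\<Sum>p\<in>P i. V * 3 ^ ?n * snd p ^ ?n) = V * 3 ^ ?n * ((\<Sum>p\<in>P i. (s * a i) * snd p ^ ?n) / (s * a i))"
          using sa[of i] s a by (simp add: sum_distrib_left sum_divide_distrib less_imp_neq[symmetric])
        also have "\<dots> \<le> V * 3 ^ ?n * (real ?n ^ ?n * a i / (s * a i))"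
          using vol[of i] sa[of i] V by (intro mult_left_mono divide_right_mono) auto
        also have "\<dots> = V * 3 ^ ?n * real ?n ^ ?n * \<sigma>"
          using a[rule_format, of i] by (simp add: s_def)
        finally show ?thesis by (simp add: ennreal_leI)
      qed
      have "emeasure lebesgue \<Omega> = emeasure lborel \<Omega>" using \<Omega>_sets by simp
      also have "\<dots> \<le> (\<Sum>i\<in>UNIV. emeasure lborel (\<Union>p\<in>P i. cball (fst p) (3 * snd p)))"
        unfolding \<Omega>_def using P by (intro emeasure_subadditive_finite) (auto intro!: borel_closed closed_UN)
      also have "\<dots> \<le> (\<Sum>i\<in>(UNIV :: 'm set). ennreal (V * 3 ^ ?n * real ?n ^ ?n * \<sigma>))"
        by (intro sum_mono 1)
      also have "\<dots> = ennreal (\<Sum>i\<in>(UNIV :: 'm set). V * 3 ^ ?n * real ?n ^ ?n * \<sigma>)"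
        using V \<sigma> by (intro sum_ennreal) auto
      also have "(\<Sum>i\<in>(UNIV :: 'm set). V * 3 ^ ?n * real ?n ^ ?n * \<sigma>) = k1 * \<sigma>"
        by (simp add: k1_def)
      finally show ?thesis .
    qed

    have good: "emeasure lebesgue {x. \<tau> < cmod (T g x)} \<le> ennreal (k2 * \<sigma>)"
    proof -
      define X where "X = M * s"
      have X: "0 < X" using M s by (simp add: X_def)
      have "Lp_norm 2 (g i) \<le> X powr (1 / 2) * a i" for i
      proof -
        have "Lp_norm 2 (g i) \<le> ((M * (s * a i)) * a i) powr (1 / 2)"
          using a by (intro bounded_integrable_Lp2(2)[OF g_int g_bd g_L1]) (auto intro: less_imp_le)
        also have "(M * (s * a i)) * a i = X * a i powr 2" using a[rule_format, of i] by (simp add: X_def power2_eq_square)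
        also have "(X * a i powr 2) powr (1 / 2) = X powr (1 / 2) * a i"
          using X a[rule_format, of i] by (simp add: powr_mult powr_powr)
        finally show ?thesis .
      qed
      then have "(\<Prod>i\<in>UNIV. Lp_norm 2 (g i)) \<le> (\<Prod>i\<in>UNIV. X powr (1 / 2) * a i)"
        by (intro prod_mono conjI) (auto simp: Lp_norm_def)
      also have "\<dots> = (X powr (1 / 2)) ^ ?m * \<pi>" by (simp add: prod.distrib \<pi>_def)
      finally have "N * (\<Prod>i\<in>UNIV. Lp_norm 2 (g i)) \<le> N * ((X powr (1 / 2)) ^ ?m * \<pi>)"
        by (rule mult_left_mono[OF _ N])
      moreover have "Lp_norm (2 / real ?m) (T g) \<le> N * (\<Prod>i\<in>UNIV. Lp_norm 2 (g i))"
        using T_bd g_L2 unfolding bound_L2_def by blast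
      ultimately have Tg: "Lp_norm (2 / real ?m) (T g) \<le> N * ((X powr (1 / 2)) ^ ?m * \<pi>)" by linarith
      \<comment> \<open>Chebyshev with exponent \<open>2 / ?m\<close> turns the m-th powers into
        squares: what remains is a constant times s * \<sigma>^2 = \<sigma>.\<close>
      have "emeasure lebesgue {x. \<tau> < cmod (T g x)} \<le> ennreal ((N * ((X powr (1 / 2)) ^ ?m * \<pi>) / \<tau>) powr (2 / real ?m))"
        using T_Lp g_L2 by (intro Lp_Chebyshev[OF _ _ \<tau> Tg]) auto
      also have "N * ((X powr (1 / 2)) ^ ?m * \<pi>) / \<tau> = (N * m1) * ((X powr (1 / 2)) ^ ?m * \<sigma> ^ ?m)"
        by (simp add: \<tau>_def \<sigma>m)
      also have "\<dots> powr (2 / real ?m) = (N * m1) powr (2 / real ?m) * (((X powr (1 / 2)) ^ ?m) powr (2 / real ?m) * (\<sigma> ^ ?m) powr (2 / real ?m))"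
        using N m1 X \<sigma> by (simp add: powr_mult)
      also have "((X powr (1 / 2)) ^ ?m) powr (2 / real ?m) = X"
        using X by (simp add: powr_powr flip: powr_realpow)
      also have "(\<sigma> ^ ?m) powr (2 / real ?m) = \<sigma> * \<sigma>"
        using \<sigma> by (simp add: powr_powr power2_eq_square flip: powr_realpow)
      also have "(N * m1) powr (2 / real ?m) * (X * (\<sigma> * \<sigma>)) = k2 * \<sigma>"
        using \<sigma> by (simp add: k2_def X_def s_def)
      finally show ?thesis .
    qed

    obtain idx where idx: "bij_betw idx (UNIV :: 'm set) {..<?m}"
      using ex_bij_betw_finite_nat[of "UNIV :: 'm set"] by (auto simp: atLeast0LessThan)
    \<comment> \<open>In \<open>H j\<close> the earlier slots hold good functions, slot
      \<open>j\<close> the bad one, and the later slots the original functions.\<close>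
    define H where "H j = (\<lambda>i. if idx i < idx j then g i else if i = j then (\<lambda>y. f i y - g i y) else f i)" for j
    have H_L2: "H j i \<in> Lp_space 2" for j i by (simp add: H_def f_L2 g_L2 fg_L2)
    have tel: "AE x in lebesgue. T f x = T g x + (\<Sum>j\<in>UNIV. T (H j) x)"
      unfolding H_def by (rule multilinear_L2_telescope[OF T_lin f_L2 g_L2 idx])
    have T_meas: "T h \<in> borel_measurable lebesgue" if "\<And>i. h i \<in> Lp_space 2" for h
      using T_Lp that by (auto simp: Lp_space_def)

    define \<Lambda> where "\<Lambda> i = c1 * (s * a i)" for i
    have \<Lambda>0: "0 \<le> \<Lambda> i" for i using c1 sa[of i] by (simp add: \<Lambda>_def)
    have wt_int: "ennreal (2 powr q * (M * (s * a i))) * (\<integral>\<^sup>+ y. ennreal ((\<rho> + norm (x - y)) powr - q) \<partial>lborel) \<le> ennreal (\<Lambda> i * \<rho> powr - \<epsilon>)"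
      if "0 < \<rho>" for i \<rho> and x :: "real ^ 'n"
    proof -
      have "ennreal (2 powr q * (M * (s * a i))) * (\<integral>\<^sup>+ y. ennreal ((\<rho> + norm (x - y)) powr - q) \<partial>lborel) \<le>
          ennreal (2 powr q * (M * (s * a i))) * ennreal (J1 * \<rho> powr - \<epsilon>)"
        by (intro mult_left_mono J1 that) simp
      also have "\<dots> = ennreal (2 powr q * (M * (s * a i)) * (J1 * \<rho> powr - \<epsilon>))"
        using M sa[of i] J1(1) by (intro ennreal_mult[symmetric]) auto
      also have "2 powr q * (M * (s * a i)) * (J1 * \<rho> powr - \<epsilon>) = \<Lambda> i * \<rho> powr - \<epsilon>"
        by (simp add: \<Lambda>_def c1_def mult_ac)
      finally show ?thesis .
    qed
    \<comment> \<open>For the earlier slots the weighted bound is immediate from boundedness of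
      \<open>g i\<close>; the factor \<open>2 powr q \<ge> 1\<close> only aligns the constant with
      that for \<open>f i\<close>, which holds off the dilated balls of \<open>f i\<close>.\<close>
    have g_wt: "(\<integral>\<^sup>+ y. ennreal (cmod (g i y)) * ennreal ((\<rho> + norm (x - y)) powr - q) \<partial>lborel) \<le>
        ennreal (2 powr q * (M * (s * a i))) * (\<integral>\<^sup>+ y. ennreal ((\<rho> + norm (x - y)) powr - q) \<partial>lborel)" for i \<rho> and x :: "real ^ 'n"
    proof -
      have "cmod (g i y) \<le> 2 powr q * (M * (s * a i))" for y
      proof -
        have "1 * (M * (s * a i)) \<le> 2 powr q * (M * (s * a i))"
          using M sa[of i] q by (intro mult_right_mono) (auto simp: ge_one_powr_ge_zero)
        with g_bd[of i y] show ?thesis by simp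
      qed
      then have "(\<integral>\<^sup>+ y. ennreal (cmod (g i y)) * ennreal ((\<rho> + norm (x - y)) powr - q) \<partial>lborel) \<le>
        (\<integral>\<^sup>+ y. ennreal (2 powr q * (M * (s * a i))) * ennreal ((\<rho> + norm (x - y)) powr - q) \<partial>lborel)"
        by (intro nn_integral_mono mult_right_mono ennreal_leI) auto
      also have "\<dots> = ennreal (2 powr q * (M * (s * a i))) * (\<integral>\<^sup>+ y. ennreal ((\<rho> + norm (x - y)) powr - q) \<partial>lborel)"
        by (rule nn_integral_cmult) measurable
      finally show ?thesis .
    qed
    have bad: "emeasure lebesgue {x. x \<notin> \<Omega> \<and> \<tau> < cmod (T (H j) x)} \<le> ennreal (k3 * \<sigma>)" for j
    proof -
      have "emeasure lebesgue {x. x \<notin> \<Omega> \<and> \<tau> < cmod (T (H j) x)} \<le>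
        ennreal (C * 2 powr (real (?n * ?m) + \<delta>) * (\<Prod>i\<in>UNIV - {j}. \<Lambda> i) * J2 * (2 * a j) / \<tau>)"
      proof (rule bad_part_weak_bound[where h = "H j" and P = "P j" and b = "b j" and \<Omega> = \<Omega>])
        show "finite (P j)" by (rule P)
        show "integrable lborel (H j i)" if "i \<noteq> j" for i using that f_int g_int by (simp add: H_def)
        show "H j j = (\<lambda>z. \<Sum>p\<in>P j. b j p z)" by (simp add: H_def fg)
        show "integrable lborel (b j p)" if "p \<in> P j" for p by (rule b_int[OF that])
        show "z \<in> cball (fst p) (snd p)" if "p \<in> P j" "b j p z \<noteq> 0" for p z using b[OF that(1)] that(2) by blast
        show "(LINT z|lborel. b j p z) = 0" if "p \<in> P j" for p using b[OF that] by blast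
        show "0 < snd p" if "p \<in> P j" for p by (rule d[OF that])
        show "(\<Union>p\<in>P j. cball (fst p) (3 * snd p)) \<subseteq> \<Omega>" unfolding \<Omega>_def by (rule UN_upper) simp
        show "\<Omega> \<in> sets borel" by (rule \<Omega>_sets)
        show "(\<Sum>p\<in>P j. \<integral>\<^sup>+ z. ennreal (cmod (b j p z)) \<partial>lborel) \<le> ennreal (2 * a j)" by (rule b_L1)
        show "0 \<le> 2 * a j" using a[rule_format, of j] by simp
        show "0 \<le> \<Lambda> i" for i by (rule \<Lambda>0)
        show "(\<integral>\<^sup>+ z. ennreal (cmod (H j i z)) * ennreal ((\<rho> + norm (x - z)) powr - (real ?n + \<delta> / real ?m)) \<partial>lborel) \<le>
            ennreal (\<Lambda> i * \<rho> powr - (\<delta> / real ?m))" if "i \<noteq> j" "x \<notin> \<Omega>" "0 < \<rho>" for i x \<rho>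
        proof -
          have x: "x \<notin> (\<Union>p\<in>P i. cball (fst p) (3 * snd p))" using that(2) unfolding \<Omega>_def by blast
          have "(\<integral>\<^sup>+ z. ennreal (cmod (H j i z)) * ennreal ((\<rho> + norm (x - z)) powr - q) \<partial>lborel) \<le>
            ennreal (2 powr q * (M * (s * a i))) * (\<integral>\<^sup>+ y. ennreal ((\<rho> + norm (x - y)) powr - q) \<partial>lborel)"
            using f_wt[OF that(3) x] g_wt[of i \<rho> x] that(1) by (simp add: H_def)
          also note wt_int[OF that(3)]
          finally show ?thesis by (simp add: q_def \<epsilon>_def)
        qed
        show "0 \<le> J2" using J2 by simp
        show "(\<integral>\<^sup>+ x. indicator (- cball c (3 * d)) x * ennreal (d powr \<delta> * (norm (x - c) / 2) powr - (real ?n + \<delta>)) \<partial>lborel) \<le> ennreal J2"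
          if "0 < d" for c :: "real ^ 'n" and d by (rule J2(2)[OF that])
        show "T (H j) \<in> borel_measurable lebesgue" by (rule T_meas[OF H_L2])
        show "AE x in lebesgue. x \<notin> (\<Inter>i. ess_support (H j i)) \<longrightarrow>
            T (H j) x = (LINT y|lebesgue. K x y * (\<Prod>i\<in>UNIV. H j i (y $ i)))"
          using T_repr H_L2 by blast
        show "0 < \<tau>" by (rule \<tau>)
      qed
      also have "C * 2 powr (real (?n * ?m) + \<delta>) * (\<Prod>i\<in>UNIV - {j}. \<Lambda> i) * J2 * (2 * a j) / \<tau> = k3 * \<sigma>"
      proof -
        have "(\<Prod>i\<in>UNIV - {j}. \<Lambda> i) = c1 ^ (?m - 1) * s ^ (?m - 1) * (\<Prod>i\<in>UNIV - {j}. a i)"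
          by (simp add: \<Lambda>_def prod.distrib card_Diff_singleton)
        moreover have "\<pi> = a j * (\<Prod>i\<in>UNIV - {j}. a i)" unfolding \<pi>_def by (rule prod.remove) auto
        ultimately have "C * 2 powr (real (?n * ?m) + \<delta>) * (\<Prod>i\<in>UNIV - {j}. \<Lambda> i) * J2 * (2 * a j) / \<tau> =
            k3 * (s ^ (?m - 1) * (\<pi> / t))"
          by (simp add: k3_def E_def \<tau>_def mult_ac)
        \<comment> \<open>Of the \<open>?m\<close> factors \<sigma>, all but one cancel against the
          powers of \<open>s\<close> in the heights of the other functions.\<close>
        also have "\<pi> / t = \<sigma> * \<sigma> ^ (?m - 1)"
          unfolding \<sigma>m[symmetric] by (subst power_Suc[symmetric]) simp
        also have "s ^ (?m - 1) * (\<sigma> * \<sigma> ^ (?m - 1)) = \<sigma>"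
          using \<sigma> by (simp add: s_def power_one_over)
        finally show ?thesis .
      qed
      finally show ?thesis .
    qed

    let ?U = "\<Omega> \<union> ({x. \<tau> < cmod (T g x)} \<union> (\<Union>j\<in>UNIV. {x. x \<notin> \<Omega> \<and> \<tau> < cmod (T (H j) x)}))"
    have lev: "{x. \<tau> < cmod (u x)} \<in> sets lebesgue" if "u \<in> borel_measurable lebesgue" for u :: "real ^ 'n \<Rightarrow> complex"
      using borel_measurable_less[of "\<lambda>_. \<tau>" lebesgue "\<lambda>x. cmod (u x)"] that by simp
    have sG: "{x. \<tau> < cmod (T g x)} \<in> sets lebesgue" by (rule lev[OF T_meas[OF g_L2]])
    have sH: "{x. x \<notin> \<Omega> \<and> \<tau> < cmod (T (H j) x)} \<in> sets lebesgue" for j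
    proof -
      have "{x. x \<notin> \<Omega> \<and> \<tau> < cmod (T (H j) x)} = {x. \<tau> < cmod (T (H j) x)} - \<Omega>" by blast
      then show ?thesis using lev[OF T_meas[OF H_L2[of j]]] \<Omega>_sets by auto
    qed
    have sHU: "(\<Union>j\<in>UNIV. {x. x \<notin> \<Omega> \<and> \<tau> < cmod (T (H j) x)}) \<in> sets lebesgue"
      using sH by (intro sets.finite_UN) auto
    have "AE x in lebesgue. x \<in> {x. t < cmod (T f x)} \<longrightarrow> x \<in> ?U"
      using tel
    proof eventually_elim
      case (elim x)
      show ?case
      proof (intro impI, rule ccontr)
        assume "x \<in> {x. t < cmod (T f x)}" and "x \<notin> ?U"
        then have "cmod (T g x) \<le> \<tau>" "\<And>j. cmod (T (H j) x) \<le> \<tau>" and tx: "t < cmod (T f x)"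
          by (auto simp: not_less)
        then have "cmod (T f x) \<le> \<tau> + (\<Sum>j\<in>(UNIV :: 'm set). \<tau>)"
          unfolding elim by (intro order_trans[OF norm_triangle_ineq] add_mono order_trans[OF norm_sum] sum_mono)
        also have "\<dots> = m1 * \<tau>" by (simp add: m1_def algebra_simps)
        also have "\<dots> = t" using m1 by (simp add: \<tau>_def)
        finally show False using tx by simp
      qed
    qed
    then have "emeasure lebesgue {x. t < cmod (T f x)} \<le> emeasure lebesgue ?U"
      by (rule emeasure_mono_AE) (rule sets.Un[OF \<Omega>_sets(2) sets.Un[OF sG sHU]])
    also have "\<dots> \<le> emeasure lebesgue \<Omega> + emeasure lebesgue ({x. \<tau> < cmod (T g x)} \<union> (\<Union>j\<in>UNIV. {x. x \<notin> \<Omega> \<and> \<tau> < cmod (T (H j) x)}))"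
      by (rule emeasure_subadditive[OF \<Omega>_sets(2) sets.Un[OF sG sHU]])
    also have "\<dots> \<le> emeasure lebesgue \<Omega> + (emeasure lebesgue {x. \<tau> < cmod (T g x)} +
        (\<Sum>j\<in>UNIV. emeasure lebesgue {x. x \<notin> \<Omega> \<and> \<tau> < cmod (T (H j) x)}))"
      using sH by (intro add_left_mono order_trans[OF emeasure_subadditive[OF sG sHU]] emeasure_subadditive_finite) auto
    also have "\<dots> \<le> ennreal (k1 * \<sigma>) + (ennreal (k2 * \<sigma>) + (\<Sum>j\<in>(UNIV :: 'm set). ennreal (k3 * \<sigma>)))"
      by (intro add_mono sum_mono \<Omega>_meas good bad)
    also have "(\<Sum>j\<in>(UNIV :: 'm set). ennreal (k3 * \<sigma>)) = ennreal (\<Sum>j\<in>(UNIV :: 'm set). k3 * \<sigma>)"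
      using k \<sigma> by (intro sum_ennreal) auto
    also have "ennreal (k1 * \<sigma>) + (ennreal (k2 * \<sigma>) + ennreal (\<Sum>j\<in>(UNIV :: 'm set). k3 * \<sigma>)) =
        ennreal ((k1 + (k2 + real ?m * k3)) * \<sigma>)"
      using k \<sigma> by (simp flip: ennreal_plus add: algebra_simps)
    finally show "emeasure lebesgue {x. t < cmod (T f x)} \<le>
        ennreal ((k1 + (k2 + real ?m * k3)) * ((\<Prod>i\<in>UNIV. a i) / t) powr (1 / real ?m))"
      by (simp add: \<sigma>_def \<pi>_def)
  qed
qed

end

section \<open>The weak quasi-norm and density of continuous functions\<close>

lemma emeasure_weak_iff:
  fixes \<mu> :: ennreal
  assumes m: "0 < m" and t: "0 < t" and Q: "0 \<le> Q"
  shows "ennreal t * \<mu> ^ m \<le> ennreal Q \<longleftrightarrow> \<mu> \<le> ennreal ((Q / t) powr (1 / real m))"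
proof (cases \<mu>)
  case top
  then show ?thesis using m t by (simp add: ennreal_mult_top top_unique)
next
  case (real r)
  have "ennreal t * \<mu> ^ m \<le> ennreal Q \<longleftrightarrow> t * r ^ m \<le> Q"
    using real t Q by (simp add: ennreal_power ennreal_mult'[symmetric])
  also have "\<dots> \<longleftrightarrow> r ^ m \<le> ((Q / t) powr (1 / real m)) ^ m"
  proof -
    have "((Q / t) powr (1 / real m)) ^ m = Q / t"
      using t Q m by (cases "Q = 0") (simp_all add: powr_power power_0_left)
    then show ?thesis using t by (simp add: le_divide_eq mult.commute)
  qed
  also have "\<dots> \<longleftrightarrow> r \<le> (Q / t) powr (1 / real m)"
    using real m by (intro power_mono_iff) auto
  also have "\<dots> \<longleftrightarrow> \<mu> \<le> ennreal ((Q / t) powr (1 / real m))"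
    using real by simp
  finally show ?thesis .
qed

text \<open>Taking m-th roots at each level passes between the quasi-norm and the distribution
  function; an infinite measure falsifies both sides.\<close>

lemma weak_qnorm_le_iff:
  assumes "0 < m" "0 \<le> Q"
  shows "weak_qnorm m h \<le> ennreal Q \<longleftrightarrow>
    (\<forall>t>0. emeasure lebesgue {x. t < cmod (h x)} \<le> ennreal ((Q / t) powr (1 / real m)))"
  using assms by (auto simp: weak_qnorm_def SUP_le_iff emeasure_weak_iff)

lemma level_set_measurable:
  assumes "u \<in> borel_measurable lebesgue"
  shows "{x. t < cmod (u x)} \<in> sets lebesgue"
  using borel_measurable_less[of "\<lambda>_. t" lebesgue "\<lambda>x. cmod (u x)"] assms by simp

lemma weak_qnorm_cong_AE:
  fixes u v :: "'a::euclidean_space \<Rightarrow> complex"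
  assumes "u \<in> borel_measurable lebesgue" "v \<in> borel_measurable lebesgue" "AE x in lebesgue. u x = v x"
  shows "weak_qnorm m u = weak_qnorm m v"
proof -
  have "emeasure lebesgue {x. t < cmod (u x)} = emeasure lebesgue {x. t < cmod (v x)}" for t
  proof (rule emeasure_eq_AE)
    show "AE x in lebesgue. x \<in> {x. t < cmod (u x)} \<longleftrightarrow> x \<in> {x. t < cmod (v x)}"
      using assms(3) by eventually_elim simp
  qed (use assms in \<open>simp_all add: level_set_measurable\<close>)
  then show ?thesis by (simp add: weak_qnorm_def)
qed

lemma weak_qnorm_minus_commute:
  "weak_qnorm m (\<lambda>x. u x - v x) = weak_qnorm m (\<lambda>x. v x - u x)"
  by (simp add: weak_qnorm_def norm_minus_commute)

text \<open>Where |u + v| > t, one of the two exceeds t / 2. Halving the level costs 2 and the m-th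
  power of a sum of two measures costs \<open>2 ^ m\<close>.\<close>

lemma weak_qnorm_add:
  fixes u v :: "'a::euclidean_space \<Rightarrow> complex"
  assumes u: "u \<in> borel_measurable lebesgue" and v: "v \<in> borel_measurable lebesgue"
  shows "weak_qnorm m (\<lambda>x. u x + v x) \<le> 2 ^ Suc m * (weak_qnorm m u + weak_qnorm m v)"
  unfolding weak_qnorm_def[of m "\<lambda>x. u x + v x"]
proof (rule SUP_least)
  fix t :: real assume "t \<in> {0<..}"
  then have t: "0 < t" by simp
  let ?\<mu> = "\<lambda>w :: 'a \<Rightarrow> complex. emeasure lebesgue {x. t / 2 < cmod (w x)}"
  have le: "ennreal (t / 2) * ?\<mu> w ^ m \<le> weak_qnorm m w" for w :: "'a \<Rightarrow> complex"
    unfolding weak_qnorm_def using t by (intro SUP_upper2[of "t / 2"]) auto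
  have "emeasure lebesgue {x. t < cmod (u x + v x)} \<le> emeasure lebesgue ({x. t / 2 < cmod (u x)} \<union> {x. t / 2 < cmod (v x)})"
  proof (rule emeasure_mono)
    show "{x. t < cmod (u x + v x)} \<subseteq> {x. t / 2 < cmod (u x)} \<union> {x. t / 2 < cmod (v x)}"
    proof
      fix x assume "x \<in> {x. t < cmod (u x + v x)}"
      then show "x \<in> {x. t / 2 < cmod (u x)} \<union> {x. t / 2 < cmod (v x)}"
        using norm_triangle_ineq[of "u x" "v x"] by auto
    qed
    show "{x. t / 2 < cmod (u x)} \<union> {x. t / 2 < cmod (v x)} \<in> sets lebesgue"
      using u v by (intro sets.Un level_set_measurable)
  qed
  also have "\<dots> \<le> ?\<mu> u + ?\<mu> v"
    using u v by (intro emeasure_subadditive level_set_measurable)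
  also have "\<dots> \<le> 2 * max (?\<mu> u) (?\<mu> v)"
    unfolding mult_2 by (intro add_mono) auto
  finally have "emeasure lebesgue {x. t < cmod (u x + v x)} ^ m \<le> (2 * max (?\<mu> u) (?\<mu> v)) ^ m"
    by (rule power_mono) simp
  also have "\<dots> = 2 ^ m * max (?\<mu> u) (?\<mu> v) ^ m" by (simp add: power_mult_distrib)
  also have "\<dots> \<le> 2 ^ m * (?\<mu> u ^ m + ?\<mu> v ^ m)"
    by (intro mult_left_mono) (auto simp: max_def)
  finally have "ennreal t * emeasure lebesgue {x. t < cmod (u x + v x)} ^ m \<le> ennreal t * (2 ^ m * (?\<mu> u ^ m + ?\<mu> v ^ m))"
    by (rule mult_left_mono) simp
  also have "ennreal t * (2 ^ m * (?\<mu> u ^ m + ?\<mu> v ^ m)) =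
      2 ^ Suc m * (ennreal (t / 2) * ?\<mu> u ^ m + ennreal (t / 2) * ?\<mu> v ^ m)"
  proof -
    have "ennreal t = 2 * ennreal (t / 2)"
      using t ennreal_mult'[of 2 "t / 2"] by simp
    then show ?thesis by (simp only: power_Suc distrib_left mult_ac)
  qed
  also have "\<dots> \<le> 2 ^ Suc m * (weak_qnorm m u + weak_qnorm m v)"
    by (intro mult_left_mono add_mono le) simp
  finally show "ennreal t * emeasure lebesgue {x. t < cmod (u x + v x)} ^ m \<le> 2 ^ Suc m * (weak_qnorm m u + weak_qnorm m v)" .
qed

lemma weak_qnorm_sum:
  fixes u :: "'i \<Rightarrow> 'a::euclidean_space \<Rightarrow> complex"
  assumes m: "0 < m" and S: "finite S" and Q: "0 \<le> Q"
    and u: "\<And>j. j \<in> S \<Longrightarrow> u j \<in> borel_measurable lebesgue" "\<And>j. j \<in> S \<Longrightarrow> weak_qnorm m (u j) \<le> ennreal Q"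
  shows "weak_qnorm m (\<lambda>x. \<Sum>j\<in>S. u j x) \<le> ennreal ((2 ^ Suc (Suc m)) ^ card S * Q)"
  using S u
proof (induction S)
  case empty
  show ?case using m by (simp add: weak_qnorm_def SUP_le_iff power_0_left not_less less_imp_le)
next
  case (insert j S)
  \<comment> \<open>\<open>c1\<close> is the loss of \<open>weak_qnorm_add\<close>; the further
    factor 2 in \<open>c\<close> absorbs the new summand \<open>Q\<close> into the accumulated
    bound.\<close>
  define c1 c :: real where "c1 = 2 ^ Suc m" and "c = 2 ^ Suc (Suc m)"
  have c: "c = 2 * c1" "1 \<le> c" "0 \<le> c1" unfolding c_def c1_def by (simp, rule one_le_power, simp_all)
  have m1: "(\<lambda>x. \<Sum>j\<in>S. u j x) \<in> borel_measurable lebesgue"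
    using insert.prems(1) by (intro borel_measurable_sum) auto
  have two: "(2 :: ennreal) ^ Suc m = ennreal c1"
    unfolding c1_def using ennreal_power[of 2 "Suc m"] by (simp del: power_Suc)
  have "weak_qnorm m (\<lambda>x. \<Sum>j\<in>insert j S. u j x) = weak_qnorm m (\<lambda>x. u j x + (\<Sum>j\<in>S. u j x))"
    using insert.hyps by simp
  also have "\<dots> \<le> 2 ^ Suc m * (weak_qnorm m (u j) + weak_qnorm m (\<lambda>x. \<Sum>j\<in>S. u j x))"
    using insert.prems(1) m1 by (intro weak_qnorm_add) auto
  also have "\<dots> \<le> 2 ^ Suc m * (ennreal Q + ennreal (c ^ card S * Q))"
    unfolding c_def using insert by (intro mult_left_mono add_mono) auto
  also have "\<dots> = ennreal (c1 * (Q + c ^ card S * Q))"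
    unfolding two using Q c by (simp flip: ennreal_plus ennreal_mult)
  also have "\<dots> \<le> ennreal (c ^ card (insert j S) * Q)"
  proof (rule ennreal_leI)
    have "1 \<le> c ^ card S" using c by (intro one_le_power)
    from mult_right_mono[OF this Q] have "Q + c ^ card S * Q \<le> 2 * (c ^ card S * Q)" by linarith
    from mult_left_mono[OF this c(3)] show "c1 * (Q + c ^ card S * Q) \<le> c ^ card (insert j S) * Q"
      using insert.hyps by (simp add: c(1) mult_ac)
  qed
  also have "c ^ card (insert j S) = (2 ^ Suc (Suc m)) ^ card (insert j S)" by (simp only: c_def)
  finally show ?case .
qed

text \<open>Fatou for level sets: because the inequality is strict, |u(x)| > t implies |U_l(x)| > t
  for all large \<open>l\<close>, so the level set lies in an increasing union of tail intersections
  up to a null set.\<close>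

lemma weak_qnorm_lower_semicontinuous:
  fixes u :: "'a::euclidean_space \<Rightarrow> complex"
  assumes m: "0 < m" and Q: "0 \<le> Q"
    and meas: "\<And>l. U l \<in> borel_measurable lebesgue"
    and lim: "AE x in lebesgue. (\<lambda>l. U l x) \<longlonglongrightarrow> u x"
    and bd: "eventually (\<lambda>l. weak_qnorm m (U l) \<le> ennreal Q) sequentially"
  shows "weak_qnorm m u \<le> ennreal Q"
  unfolding weak_qnorm_le_iff[OF m Q]
proof (intro allI impI)
  fix t :: real assume t: "0 < t"
  define A where "A l = {x. t < cmod (U l x)}" for l
  define B where "B n = (\<Inter>l\<in>{n..}. A l)" for n
  have A: "A l \<in> sets lebesgue" for l unfolding A_def by (rule level_set_measurable[OF meas])
  have B: "B n \<in> sets lebesgue" for n unfolding B_def using A by (intro sets.countable_INT) auto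
  have inc: "incseq B" by (force simp: incseq_def B_def)
  have "AE x in lebesgue. x \<in> {x. t < cmod (u x)} \<longrightarrow> x \<in> (\<Union>n. B n)"
    using lim
  proof eventually_elim
    case (elim x)
    show ?case
    proof
      assume "x \<in> {x. t < cmod (u x)}"
      then have "eventually (\<lambda>l. t < cmod (U l x)) sequentially"
        using tendsto_norm[OF elim] by (intro order_tendstoD(1)) auto
      then show "x \<in> (\<Union>n. B n)" by (auto simp: eventually_sequentially B_def A_def)
    qed
  qed
  then have "emeasure lebesgue {x. t < cmod (u x)} \<le> emeasure lebesgue (\<Union>n. B n)"
    using B by (intro emeasure_mono_AE) auto
  also have "\<dots> = (SUP n. emeasure lebesgue (B n))"
    using B inc by (intro SUP_emeasure_incseq[symmetric]) auto
  also have "\<dots> \<le> ennreal ((Q / t) powr (1 / real m))"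
  proof (rule SUP_least)
    fix n
    from bd obtain n' where n': "\<And>l. n' \<le> l \<Longrightarrow> weak_qnorm m (U l) \<le> ennreal Q"
      by (auto simp: eventually_sequentially)
    have "emeasure lebesgue (B n) \<le> emeasure lebesgue (A (max n n'))"
      using A by (intro emeasure_mono) (auto simp: B_def)
    also have "\<dots> \<le> ennreal ((Q / t) powr (1 / real m))"
      using n'[of "max n n'"] t unfolding A_def weak_qnorm_le_iff[OF m Q] by simp
    finally show "emeasure lebesgue (B n) \<le> ennreal ((Q / t) powr (1 / real m))" .
  qed
  finally show "emeasure lebesgue {x. t < cmod (u x)} \<le> ennreal ((Q / t) powr (1 / real m))" .
qed

section \<open>The L1 norm and density of compactly supported continuous functions\<close>

lemma Lp_space_1_iff: "f \<in> Lp_space 1 \<longleftrightarrow> integrable lebesgue f"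
  by (auto simp: Lp_space_def integrable_norm_iff)

lemma Lp_norm_1: "Lp_norm 1 f = (LINT x|lebesgue. cmod (f x))"
  by (simp add: Lp_norm_def)

lemma Lp_norm_nonneg: "0 \<le> Lp_norm p f"
  by (simp add: Lp_norm_def)

lemma nn_integral_Lp_norm_1:
  assumes "integrable lebesgue f"
  shows "(\<integral>\<^sup>+ x. ennreal (cmod (f x)) \<partial>lborel) = ennreal (Lp_norm 1 f)"
proof -
  have "(\<integral>\<^sup>+ x. ennreal (cmod (f x)) \<partial>lborel) = (\<integral>\<^sup>+ x. ennreal (cmod (f x)) \<partial>lebesgue)"
    by (rule nn_integral_completion[symmetric])
  also have "\<dots> = ennreal (Lp_norm 1 f)"
    unfolding Lp_norm_1 using assms by (intro nn_integral_eq_integral) auto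
  finally show ?thesis .
qed

lemma Cc_space_integrable_lebesgue: "f \<in> Cc_space \<Longrightarrow> integrable lebesgue f"
  using Cc_space_integrable[of f] Cc_space_borel[of f] by (subst integrable_completion) auto

lemma Cc_space_diff:
  fixes f g :: "'a::euclidean_space \<Rightarrow> complex"
  assumes f: "f \<in> Cc_space" and g: "g \<in> Cc_space"
  shows "(\<lambda>x. f x - g x) \<in> Cc_space"
proof -
  have "bounded ({x. f x \<noteq> 0} \<union> {x. g x \<noteq> 0})"
    using f g by (simp add: Cc_space_def)
  then have "bounded {x. f x - g x \<noteq> 0}" by (rule bounded_subset) auto
  then show ?thesis using f g by (auto simp: Cc_space_def intro!: continuous_intros)
qed

lemma Lp_norm_1_triangle:
  assumes "integrable lebesgue u" "integrable lebesgue v" "integrable lebesgue w"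
  shows "Lp_norm 1 (\<lambda>x. u x - w x) \<le> Lp_norm 1 (\<lambda>x. u x - v x) + Lp_norm 1 (\<lambda>x. v x - w x)"
proof -
  have "Lp_norm 1 (\<lambda>x. u x - w x) \<le> (LINT x|lebesgue. cmod (u x - v x) + cmod (v x - w x))"
    unfolding Lp_norm_1
  proof (intro integral_mono Bochner_Integration.integrable_add integrable_norm Bochner_Integration.integrable_diff assms)
    show "cmod (u x - w x) \<le> cmod (u x - v x) + cmod (v x - w x)" for x
      using norm_triangle_ineq[of "u x - v x" "v x - w x"] by simp
  qed
  also have "\<dots> = Lp_norm 1 (\<lambda>x. u x - v x) + Lp_norm 1 (\<lambda>x. v x - w x)"
    unfolding Lp_norm_1 using assms by (intro Bochner_Integration.integral_add) auto
  finally show ?thesis .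
qed

lemma dominated_tendsto_zero:
  fixes s :: "nat \<Rightarrow> 'a \<Rightarrow> real"
  assumes "\<And>k. s k \<in> borel_measurable M" "integrable M w"
    and "AE x in M. (\<lambda>k. s k x) \<longlonglongrightarrow> 0" "\<And>k. AE x in M. norm (s k x) \<le> w x"
  shows "(\<lambda>k. integral\<^sup>L M (s k)) \<longlonglongrightarrow> 0"
  using integral_dominated_convergence[of "\<lambda>_. 0 :: real" M s w] assms by simp

text \<open>Two uses of dominated convergence. Truncating \<open>f\<close> in size and in space is
  dominated by a multiple of |f|. Approximating the truncation uses continuous functions converging
  only almost everywhere; passing them through the same truncation supplies compact support and an
  integrable bound.\<close>

lemma Cc_space_dense_L1:
  fixes f :: "'a::euclidean_space \<Rightarrow> complex"
  assumes f: "integrable lebesgue f" and e: "0 < e"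
  shows "\<exists>g\<in>Cc_space. Lp_norm 1 (\<lambda>x. g x - f x) < e"
proof -
  \<comment> \<open>Radial projection onto the disc of radius \<open>R\<close>. Both
    \<open>cl R\<close> and the cutoff \<open>\<phi> R\<close>, which is 1 for
    \<open>norm x \<le> R\<close> and 0 for \<open>norm x \<ge> R + 1\<close>, are continuous, so
    truncation preserves continuity.\<close>
  define cl where "cl R z = (R / max R (cmod z)) *\<^sub>R z" for R :: real and z
  define \<phi> where "\<phi> R x = max 0 (min 1 (R + 1 - norm x))" for R :: real and x :: 'a
  have cl_norm: "cmod (cl R z) \<le> R" "cmod (cl R z) \<le> cmod z" "cmod z \<le> R \<Longrightarrow> cl R z = z" if "0 < R" for R z
  proof -
    have "cmod (cl R z) = R * (cmod z / max R (cmod z))" using that by (simp add: cl_def)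
    also have "\<dots> \<le> R * 1" using that by (intro mult_left_mono) (auto simp: divide_le_eq_1)
    finally show "cmod (cl R z) \<le> R" by simp
    have "cmod (cl R z) = R / max R (cmod z) * cmod z" using that by (simp add: cl_def)
    also have "\<dots> \<le> 1 * cmod z" using that by (intro mult_right_mono) (auto simp: divide_le_eq_1)
    finally show "cmod (cl R z) \<le> cmod z" by simp
    show "cl R z = z" if "cmod z \<le> R" using that \<open>0 < R\<close> by (simp add: cl_def max_absorb1)
  qed
  have cl_cont: "continuous_on UNIV (cl R)" if "0 < R" for R
    unfolding cl_def using that by (intro continuous_intros) (auto simp: max_def)
  have \<phi>_cont: "continuous_on UNIV (\<phi> R)" for R unfolding \<phi>_def by (intro continuous_intros)
  have \<phi>01: "0 \<le> \<phi> R x" "\<phi> R x \<le> 1" for R x by (auto simp: \<phi>_def)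
  have \<phi>0: "\<phi> R x = 0" if "R + 1 \<le> norm x" for R x using that by (simp add: \<phi>_def)
  have [measurable]: "\<phi> R \<in> borel_measurable lebesgue" for R
    using borel_measurable_continuous_onI[OF \<phi>_cont] by (simp add: measurable_completion)
  have [measurable]: "f \<in> borel_measurable lebesgue" using f by auto
  define F where "F R x = \<phi> R x *\<^sub>R cl R (f x)" for R x
  have F_meas [measurable]: "F R \<in> borel_measurable lebesgue" if "0 < R" for R
    unfolding F_def
    using measurable_compose[OF _ borel_measurable_continuous_onI[OF cl_cont[OF that]], of f lebesgue] by measurable
  have "(\<lambda>k. LINT x|lebesgue. cmod (F (real (Suc k)) x - f x)) \<longlonglongrightarrow> 0"
  proof (rule dominated_tendsto_zero[where w = "\<lambda>x. 2 * cmod (f x)"])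
    show "(\<lambda>x. cmod (F (real (Suc k)) x - f x)) \<in> borel_measurable lebesgue" for k
    proof -
      have [measurable]: "F (real (Suc k)) \<in> borel_measurable lebesgue" by (rule F_meas) simp
      show ?thesis by measurable
    qed
    show "integrable lebesgue (\<lambda>x. 2 * cmod (f x))" using f by simp
    show "AE x in lebesgue. (\<lambda>k. cmod (F (real (Suc k)) x - f x)) \<longlonglongrightarrow> 0"
    proof (rule AE_I2)
      fix x
      obtain k0 where k0: "norm x + cmod (f x) < real k0" using reals_Archimedean2 by blast
      have "cmod (F (real (Suc k)) x - f x) = 0" if "k0 \<le> k" for k
      proof -
        have k: "norm x + cmod (f x) < real (Suc k)" using k0 that by simp
        then have "\<phi> (real (Suc k)) x = 1" using norm_ge_zero[of "f x"] unfolding \<phi>_def by linarith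
        moreover have "cl (real (Suc k)) (f x) = f x" using k norm_ge_zero[of x] by (intro cl_norm(3)) linarith+
        ultimately show ?thesis by (simp add: F_def)
      qed
      then show "(\<lambda>k. cmod (F (real (Suc k)) x - f x)) \<longlonglongrightarrow> 0"
        by (intro tendsto_eventually) (auto simp: eventually_sequentially)
    qed
    show "AE x in lebesgue. norm (cmod (F (real (Suc k)) x - f x)) \<le> 2 * cmod (f x)" for k
    proof (rule AE_I2)
      fix x
      have "cmod (F (real (Suc k)) x) \<le> 1 * cmod (f x)"
        unfolding F_def norm_scaleR using \<phi>01[of "real (Suc k)" x] cl_norm(2)[of "real (Suc k)" "f x"] by (intro mult_mono) auto
      then show "norm (cmod (F (real (Suc k)) x - f x)) \<le> 2 * cmod (f x)"
        using norm_triangle_ineq4[of "F (real (Suc k)) x" "f x"] by simp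
    qed
  qed
  then have "eventually (\<lambda>k. (LINT x|lebesgue. cmod (F (real (Suc k)) x - f x)) < e / 2) sequentially"
    using e by (intro order_tendstoD(2)) auto
  then obtain k where k: "(LINT x|lebesgue. cmod (F (real (Suc k)) x - f x)) < e / 2"
    by (auto simp: eventually_sequentially)
  define R where "R = real (Suc k)"
  have R: "0 < R" by (simp add: R_def)
  \<comment> \<open>By definition of \<open>measurable_on\<close>, \<open>f\<close> is a pointwise
    limit of continuous functions off a negligible set.\<close>
  have "f measurable_on UNIV"
    by (rule lebesgue_measurable_imp_measurable_on) (auto simp: lebesgue_on_UNIV_eq)
  then obtain Z g where Z: "negligible Z" and g_cont: "\<And>n. continuous_on UNIV (g n)"
    and g_lim: "\<And>x. x \<notin> Z \<Longrightarrow> (\<lambda>n. g n x) \<longlonglongrightarrow> f x"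
    unfolding measurable_on_def by auto
  define G where "G n x = \<phi> R x *\<^sub>R cl R (g n x)" for n :: nat and x
  have G_cont: "continuous_on UNIV (G n)" for n
    unfolding G_def by (intro continuous_intros \<phi>_cont continuous_on_compose2[OF cl_cont[OF R] g_cont]) auto
  have G_supp: "{x. G n x \<noteq> 0} \<subseteq> cball 0 (R + 1)" for n
    using \<phi>0[of R] by (auto simp: G_def dist_norm not_le intro: less_imp_le) (meson linorder_not_less less_imp_le)
  have G_Cc: "G n \<in> Cc_space" for n
  proof -
    have "bounded {x. G n x \<noteq> 0}" by (rule bounded_subset[OF bounded_cball G_supp])
    then show ?thesis using G_cont by (simp add: Cc_space_def)
  qed
  have bdd: "cmod (\<phi> R x *\<^sub>R cl R z) \<le> R * indicator (cball 0 (R + 1)) x" for x z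
  proof (cases "x \<in> cball 0 (R + 1)")
    case True
    have "cmod (\<phi> R x *\<^sub>R cl R z) \<le> 1 * R"
      unfolding norm_scaleR using \<phi>01[of R x] cl_norm(1)[OF R, of z] by (intro mult_mono) auto
    then show ?thesis using True by simp
  next
    case False
    then show ?thesis using \<phi>0[of R x] by (simp add: dist_norm)
  qed
  have "(\<lambda>n. LINT x|lebesgue. cmod (G n x - F R x)) \<longlonglongrightarrow> 0"
  proof (rule dominated_tendsto_zero[where w = "\<lambda>x. 2 * (R * indicator (cball 0 (R + 1)) x)"])
    show "(\<lambda>x. cmod (G n x - F R x)) \<in> borel_measurable lebesgue" for n
    proof -
      have [measurable]: "F R \<in> borel_measurable lebesgue" "G n \<in> borel_measurable lebesgue"
        using F_meas[OF R] borel_measurable_continuous_onI[OF G_cont[of n]]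
        by (simp_all add: measurable_completion)
      show ?thesis by measurable
    qed
    show "integrable lebesgue (\<lambda>x. 2 * (R * indicator (cball (0::'a) (R + 1)) x))"
      by (intro integrable_mult_right integrable_real_indicator) (auto simp: emeasure_cball R less_imp_le)
    have "AE x in lebesgue. x \<notin> Z" using Z by (auto simp: negligible_iff_null_sets intro: AE_not_in)
    then show "AE x in lebesgue. (\<lambda>n. cmod (G n x - F R x)) \<longlonglongrightarrow> 0"
    proof eventually_elim
      case (elim x)
      have "isCont (cl R) (f x)" using cl_cont[OF R] by (simp add: continuous_on_eq_continuous_at)
      then have "(\<lambda>n. cl R (g n x)) \<longlonglongrightarrow> cl R (f x)" using g_lim[OF elim] by (rule isCont_tendsto_compose)
      then have "(\<lambda>n. G n x) \<longlonglongrightarrow> F R x" unfolding G_def F_def by (intro tendsto_intros)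
      then show ?case by (simp add: tendsto_norm_zero_iff LIM_zero_iff)
    qed
    show "AE x in lebesgue. norm (cmod (G n x - F R x)) \<le> 2 * (R * indicator (cball 0 (R + 1)) x)" for n
    proof (rule AE_I2)
      fix x
      show "norm (cmod (G n x - F R x)) \<le> 2 * (R * indicator (cball 0 (R + 1)) x)"
        using norm_triangle_ineq4[of "G n x" "F R x"] bdd[of x "g n x"] bdd[of x "f x"] by (simp add: G_def F_def)
    qed
  qed
  then have "eventually (\<lambda>n. (LINT x|lebesgue. cmod (G n x - F R x)) < e / 2) sequentially"
    using e by (intro order_tendstoD(2)) auto
  then obtain n where n: "(LINT x|lebesgue. cmod (G n x - F R x)) < e / 2"
    by (auto simp: eventually_sequentially)
  have F_int: "integrable lebesgue (F R)"
  proof (rule Bochner_Integration.integrable_bound[OF f F_meas[OF R]])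
    show "AE x in lebesgue. norm (F R x) \<le> norm (f x)"
    proof (rule AE_I2)
      fix x
      have "cmod (F R x) \<le> 1 * cmod (f x)"
        unfolding F_def norm_scaleR using \<phi>01[of R x] cl_norm(2)[OF R, of "f x"] by (intro mult_mono) auto
      then show "norm (F R x) \<le> norm (f x)" by simp
    qed
  qed
  have "Lp_norm 1 (\<lambda>x. G n x - f x) \<le> Lp_norm 1 (\<lambda>x. G n x - F R x) + Lp_norm 1 (\<lambda>x. F R x - f x)"
    by (rule Lp_norm_1_triangle[OF Cc_space_integrable_lebesgue[OF G_Cc] F_int f])
  also have "\<dots> < e" using n k by (simp add: Lp_norm_1 R_def)
  finally show ?thesis using G_Cc by blast
qed

section \<open>Extension to integrable functions\<close>

lemma Cc_space_subset_L2: "f \<in> Cc_space \<Longrightarrow> f \<in> Lp_space 2"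
proof -
  assume f: "f \<in> Cc_space"
  obtain B where "\<And>x. cmod (f x) \<le> B" using Cc_space_bounded[OF f] by blast
  then show "f \<in> Lp_space 2"
    using bounded_integrable_Lp2(1)[OF Cc_space_integrable[OF f], of B "LINT x|lborel. cmod (f x)"] Cc_space_integrable[OF f]
    by (simp add: nn_integral_eq_integral)
qed

text \<open>The infimum of the admissible bounds is attained: divide by the product of norms if it
  is positive, and use any admissible bound if it is zero. The constants may thus be expressed
  through \<open>opnorm_L2 T\<close>.\<close>

lemma bound_L2_opnorm:
  assumes "bound_L2 T B"
  shows "bound_L2 T (opnorm_L2 T)"
proof -
  let ?S = "{B. bound_L2 T B}"
  have ne: "?S \<noteq> {}" using assms by blast
  have "Lp_norm (2 / real CARD('a)) (T f) \<le> opnorm_L2 T * (\<Prod>i\<in>UNIV. Lp_norm 2 (f i))"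
    if f: "\<forall>i. f i \<in> Lp_space 2" for f
  proof (cases "(\<Prod>i\<in>UNIV. Lp_norm 2 (f i)) = 0")
    case True
    then show ?thesis using assms f unfolding bound_L2_def by (metis mult_zero_right)
  next
    case False
    moreover have "0 \<le> (\<Prod>i\<in>UNIV. Lp_norm 2 (f i))"
      by (intro prod_nonneg) (simp add: Lp_norm_nonneg)
    ultimately have pos: "0 < (\<Prod>i\<in>UNIV. Lp_norm 2 (f i))" by linarith
    have "Lp_norm (2 / real CARD('a)) (T f) / (\<Prod>i\<in>UNIV. Lp_norm 2 (f i)) \<le> opnorm_L2 T"
      unfolding opnorm_L2_def
    proof (rule cInf_greatest[OF ne])
      fix B assume "B \<in> ?S"
      then show "Lp_norm (2 / real CARD('a)) (T f) / (\<Prod>i\<in>UNIV. Lp_norm 2 (f i)) \<le> B"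
        using f pos unfolding bound_L2_def by (simp add: pos_divide_le_eq)
    qed
    then show ?thesis using pos by (simp add: pos_divide_le_eq)
  qed
  moreover have "0 \<le> opnorm_L2 T"
    unfolding opnorm_L2_def using ne by (rule cInf_greatest) (simp add: bound_L2_def)
  ultimately show ?thesis by (simp add: bound_L2_def)
qed

lemma Cc_space_sequence_dense:
  fixes f :: "'m \<Rightarrow> 'a::euclidean_space \<Rightarrow> complex"
  assumes f: "\<And>i. integrable lebesgue (f i)" and \<theta>: "\<And>k. 0 < \<theta> k"
  shows "\<exists>G :: nat \<Rightarrow> 'm \<Rightarrow> 'a \<Rightarrow> complex.
    (\<forall>k i. G k i \<in> Cc_space) \<and> (\<forall>k i. Lp_norm 1 (\<lambda>x. G k i x - f i x) < \<theta> k)"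
proof -
  have "\<exists>g. g \<in> Cc_space \<and> Lp_norm 1 (\<lambda>x. g x - f i x) < \<theta> k" for k i
    using Cc_space_dense_L1[OF f[of i] \<theta>[of k]] by blast
  then have "\<forall>k. \<forall>i. \<exists>g. g \<in> Cc_space \<and> Lp_norm 1 (\<lambda>x. g x - f i x) < \<theta> k" by blast
  then show ?thesis by (simp only: choice_iff) blast
qed

text \<open>A Lipschitz constant of \<open>T\<close> on the L1 ball of radius \<open>R\<close>:
  \<open>m\<close> telescoping terms are added by \<open>weak_qnorm_sum\<close>, and in each one
  \<open>m - 1\<close> arguments have norm at most \<open>R\<close>.\<close>

definition diff_const :: "nat \<Rightarrow> real \<Rightarrow> real \<Rightarrow> real" where
  "diff_const m A R = (2 ^ Suc (Suc m)) ^ m * (A * R ^ (m - 1))"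

text \<open>Isolates what the extension by density needs of \<open>T\<close>; no kernel is involved
  from here on. Allowing any positive \<open>a i\<close> above the norms lets a difference of
  possibly zero norm be used with a positive bound.\<close>

locale weak_type_on_Cc =
  fixes T :: "('m::finite \<Rightarrow> real ^ 'n \<Rightarrow> complex) \<Rightarrow> real ^ 'n \<Rightarrow> complex" and A :: real
  assumes A: "0 < A" and lin: "multilinear_L2 T"
    and meas: "\<And>f. (\<And>i. f i \<in> Cc_space) \<Longrightarrow> T f \<in> borel_measurable lebesgue"
    and weak: "\<And>f a. (\<And>i. f i \<in> Cc_space) \<Longrightarrow> (\<And>i. 0 < a i) \<Longrightarrow> (\<And>i. Lp_norm 1 (f i) \<le> a i) \<Longrightarrow>
      weak_qnorm CARD('m) (T f) \<le> ennreal (A * (\<Prod>i\<in>UNIV. a i))"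
begin

text \<open>In every telescoping term one slot holds the difference, of norm at most
  \<open>\<eta>\<close>, and all others have norm at most \<open>R\<close>.\<close>

lemma weak_diff:
  assumes F: "\<And>i. F i \<in> Cc_space" and G: "\<And>i. G i \<in> Cc_space" and R: "0 < R" and \<eta>: "0 < \<eta>"
    and FR: "\<And>i. Lp_norm 1 (F i) \<le> R" and GR: "\<And>i. Lp_norm 1 (G i) \<le> R"
    and FG: "\<And>i. Lp_norm 1 (\<lambda>x. F i x - G i x) \<le> \<eta>"
  shows "weak_qnorm CARD('m) (\<lambda>x. T F x - T G x) \<le> ennreal (diff_const CARD('m) A R * \<eta>)"
proof -
  obtain idx where idx: "bij_betw idx (UNIV :: 'm set) {..<CARD('m)}"
    using ex_bij_betw_finite_nat[of "UNIV :: 'm set"] by (auto simp: atLeast0LessThan)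
  define H where "H j = (\<lambda>i. if idx i < idx j then G i else if i = j then (\<lambda>y. F i y - G i y) else F i)" for j
  have H: "H j i \<in> Cc_space" for j i by (simp add: H_def F G Cc_space_diff)
  have "AE x in lebesgue. T F x = T G x + (\<Sum>j\<in>UNIV. T (H j) x)"
    unfolding H_def by (rule multilinear_L2_telescope[OF lin _ _ idx]) (simp_all add: F G Cc_space_subset_L2)
  then have ae: "AE x in lebesgue. T F x - T G x = (\<Sum>j\<in>UNIV. T (H j) x)"
    by eventually_elim simp
  have T_meas: "T F \<in> borel_measurable lebesgue" "T G \<in> borel_measurable lebesgue" "\<And>j. T (H j) \<in> borel_measurable lebesgue"
    by (rule meas[OF F], rule meas[OF G], rule meas[OF H])
  have each: "weak_qnorm CARD('m) (T (H j)) \<le> ennreal (A * R ^ (CARD('m) - 1) * \<eta>)" for j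
  proof -
    have "weak_qnorm CARD('m) (T (H j)) \<le> ennreal (A * (\<Prod>i\<in>UNIV. if i = j then \<eta> else R))"
      by (rule weak[OF H]) (auto simp: H_def R \<eta> FR GR FG)
    also have "(\<Prod>i\<in>UNIV. if i = j then \<eta> else R) = \<eta> * R ^ (CARD('m) - 1)"
      by (subst prod.remove[of _ j]) (auto simp: card_Diff_singleton intro!: prod.cong)
    finally show ?thesis by (simp add: mult_ac)
  qed
  have "weak_qnorm CARD('m) (\<lambda>x. T F x - T G x) = weak_qnorm CARD('m) (\<lambda>x. \<Sum>j\<in>UNIV. T (H j) x)"
    using T_meas by (intro weak_qnorm_cong_AE ae borel_measurable_diff borel_measurable_sum) auto
  also have "\<dots> \<le> ennreal ((2 ^ Suc (Suc CARD('m))) ^ CARD('m) * (A * R ^ (CARD('m) - 1) * \<eta>))"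
    using A R \<eta> each T_meas by (intro weak_qnorm_sum) auto
  finally show ?thesis by (simp add: diff_const_def mult_ac)
qed

lemma Lp_norm_1_near:
  assumes "integrable lebesgue f" "G \<in> Cc_space" "Lp_norm 1 (\<lambda>x. G x - f x) \<le> \<eta>"
  shows "Lp_norm 1 G \<le> Lp_norm 1 f + \<eta>"
  using Lp_norm_1_triangle[of G f "\<lambda>_. 0"] assms Cc_space_integrable_lebesgue by fastforce

text \<open>Convergence in the quasi-norm is first traded for convergence almost everywhere along
  one fast sequence \<open>G\<close>. The limit \<open>h\<close> then serves for every approximating
  sequence, since the difference estimate is uniform and passes to the limit by lower
  semicontinuity.\<close>

lemma extension_exists:
  assumes f: "\<And>i. integrable lebesgue (f i)"
  shows "\<exists>h. L1_extension T f h"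
proof -
  let ?m = "CARD('m)"
  \<comment> \<open>A radius containing every \<open>f i\<close> and all functions within distance 1
    of it, so that one Lipschitz constant covers all approximants.\<close>
  define R where "R = 1 + (\<Sum>i\<in>UNIV. Lp_norm 1 (f i))"
  have fR: "Lp_norm 1 (f i) + 1 \<le> R" for i
    unfolding R_def using member_le_sum[of i UNIV "\<lambda>i. Lp_norm 1 (f i)"] Lp_norm_nonneg[of 1] by auto
  have R: "0 < R" using fR[of undefined] Lp_norm_nonneg[of 1 "f undefined"] by linarith
  have DR: "0 < diff_const CARD('m) A R" using A R by (simp add: diff_const_def)
  have diff: "weak_qnorm ?m (\<lambda>x. T F x - T G x) \<le> ennreal (diff_const CARD('m) A R * (2 * \<eta>))"
    if F: "\<And>i. F i \<in> Cc_space" and G: "\<And>i. G i \<in> Cc_space" and \<eta>: "0 < \<eta>" "\<eta> \<le> 1"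
      and Ff: "\<And>i. Lp_norm 1 (\<lambda>x. F i x - f i x) \<le> \<eta>" and Gf: "\<And>i. Lp_norm 1 (\<lambda>x. G i x - f i x) \<le> \<eta>" for F G \<eta>
  proof (rule weak_diff[OF F G R])
    show "Lp_norm 1 (F i) \<le> R" "Lp_norm 1 (G i) \<le> R" for i
      using Lp_norm_1_near[OF f F Ff, of i] Lp_norm_1_near[OF f G Gf, of i] fR[of i] \<eta> by linarith+
    show "Lp_norm 1 (\<lambda>x. F i x - G i x) \<le> 2 * \<eta>" for i
    proof -
      have "Lp_norm 1 (\<lambda>x. F i x - G i x) \<le> Lp_norm 1 (\<lambda>x. F i x - f i x) + Lp_norm 1 (\<lambda>x. f i x - G i x)"
        by (intro Lp_norm_1_triangle Cc_space_integrable_lebesgue F G f)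
      also have "Lp_norm 1 (\<lambda>x. f i x - G i x) = Lp_norm 1 (\<lambda>x. G i x - f i x)"
        by (simp add: Lp_norm_1 norm_minus_commute)
      finally show ?thesis using Ff[of i] Gf[of i] by linarith
    qed
  qed (use \<eta> in simp)
  \<comment> \<open>Makes the quasi-norm of consecutive differences at most
    \<open>(1 / 2) ^ (k * Suc ?m)\<close>; at level \<open>(1 / 2) ^ k\<close> the measure is then
    at most \<open>(1 / 2) ^ k\<close>. The 2 in the denominator pays for comparing two approximants
    through \<open>f\<close>.\<close>
  define \<theta> where "\<theta> k = min 1 ((1 / 2) ^ (k * Suc ?m) / (2 * diff_const CARD('m) A R))" for k :: nat
  have \<theta>: "0 < \<theta> k" "\<theta> k \<le> 1" for k using DR by (auto simp: \<theta>_def)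
  have \<theta>_anti: "\<theta> (Suc k) \<le> \<theta> k" for k
  proof -
    have "(1 / 2 :: real) ^ (Suc k * Suc ?m) \<le> (1 / 2) ^ (k * Suc ?m)" by (rule power_decreasing) auto
    then have "(1 / 2 :: real) ^ (Suc k * Suc ?m) / (2 * diff_const CARD('m) A R) \<le> (1 / 2) ^ (k * Suc ?m) / (2 * diff_const CARD('m) A R)"
      using DR by (intro divide_right_mono) auto
    then show ?thesis unfolding \<theta>_def by (rule min.mono[OF order_refl])
  qed
  have \<theta>_lim: "\<theta> \<longlonglongrightarrow> 0"
  proof (rule tendsto_sandwich[OF _ _ tendsto_const])
    have "(\<lambda>k. ((1 / 2) ^ Suc ?m) ^ k / (2 * diff_const CARD('m) A R)) \<longlonglongrightarrow> 0 / (2 * diff_const CARD('m) A R)"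
      using DR by (intro tendsto_divide tendsto_const LIMSEQ_power_zero) (auto simp: power_less_one_iff norm_power simp del: power_Suc)
    then show "(\<lambda>k. ((1 / 2) ^ Suc ?m) ^ k / (2 * diff_const CARD('m) A R)) \<longlonglongrightarrow> 0" by simp
    show "eventually (\<lambda>k. \<theta> k \<le> ((1 / 2) ^ Suc ?m) ^ k / (2 * diff_const CARD('m) A R)) sequentially"
      by (intro always_eventually allI) (simp only: \<theta>_def power_mult[symmetric] mult.commute[of "Suc ?m"] min.cobounded2)
  qed (use \<theta> in \<open>auto intro!: always_eventually less_imp_le\<close>)
  obtain G where G: "\<And>k i. G k i \<in> Cc_space" and Gf: "\<And>k i. Lp_norm 1 (\<lambda>x. G k i x - f i x) < \<theta> k"
    using Cc_space_sequence_dense[of f \<theta>, OF f \<theta>(1)] by blast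
  have TG [measurable]: "T (G k) \<in> borel_measurable lebesgue" for k by (rule meas[OF G])
  define E where "E k = {x. (1 / 2) ^ k < cmod (T (G (Suc k)) x - T (G k) x)}" for k
  have E_sets: "E k \<in> sets lebesgue" for k
    unfolding E_def by (rule level_set_measurable) measurable
  have E_le: "emeasure lebesgue (E k) \<le> ennreal ((1 / 2) ^ k)" for k
  proof -
    have "weak_qnorm ?m (\<lambda>x. T (G (Suc k)) x - T (G k) x) \<le> ennreal (diff_const CARD('m) A R * (2 * \<theta> k))"
      by (rule diff[OF G G \<theta> order_trans[OF less_imp_le[OF Gf] \<theta>_anti] less_imp_le[OF Gf]])
    also have "\<dots> \<le> ennreal ((1 / 2) ^ (k * Suc ?m))"
    proof (rule ennreal_leI)
      have "\<theta> k \<le> (1 / 2) ^ (k * Suc ?m) / (2 * diff_const CARD('m) A R)" by (simp add: \<theta>_def)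
      then show "diff_const CARD('m) A R * (2 * \<theta> k) \<le> (1 / 2) ^ (k * Suc ?m)" using DR by (simp add: pos_le_divide_eq mult_ac)
    qed
    finally have "emeasure lebesgue (E k) \<le> ennreal (((1 / 2) ^ (k * Suc ?m) / (1 / 2) ^ k) powr (1 / real ?m))"
      unfolding E_def by (subst (asm) weak_qnorm_le_iff) auto
    also have "(1 / 2 :: real) ^ (k * Suc ?m) / (1 / 2) ^ k = ((1 / 2) ^ k) ^ ?m"
      by (simp add: power_add power_mult)
    also have "(((1 / 2 :: real) ^ k) ^ ?m) powr (1 / real ?m) = (1 / 2) ^ k"
      by (simp add: powr_powr flip: powr_realpow)
    finally show ?thesis .
  qed
  \<comment> \<open>Borel-Cantelli: almost every \<open>x\<close> leaves the sets \<open>E k\<close>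
    eventually, so the telescoping series of differences is dominated by a geometric one.\<close>
  have "AE x in lebesgue. eventually (\<lambda>k. x \<in> space lebesgue - E k) sequentially"
  proof (rule borel_cantelli_AE1[OF E_sets])
    show "emeasure lebesgue (E k) < \<infinity>" for k
      using E_le[of k] by (rule le_less_trans) simp
    have le: "measure lebesgue (E k) \<le> (1 / 2) ^ k" for k
      using E_le[of k] unfolding measure_def by (intro enn2real_leI) auto
    show "summable (\<lambda>k. measure lebesgue (E k))"
    proof (rule summable_comparison_test'[of "\<lambda>k. (1 / 2 :: real) ^ k" 0])
      show "summable (\<lambda>k. (1 / 2 :: real) ^ k)" by (rule summable_geometric) simp
      show "norm (measure lebesgue (E k)) \<le> (1 / 2) ^ k" for k using le[of k] by simp
    qed
  qed
  then have conv: "AE x in lebesgue. convergent (\<lambda>k. T (G k) x)"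
  proof eventually_elim
    case (elim x)
    have "summable (\<lambda>k. T (G (Suc k)) x - T (G k) x)"
    proof (rule summable_comparison_test_ev)
      show "eventually (\<lambda>k. norm (T (G (Suc k)) x - T (G k) x) \<le> (1 / 2) ^ k) sequentially"
        using elim by eventually_elim (simp add: E_def not_less)
    qed simp
    then have "convergent (\<lambda>n. \<Sum>k<n. T (G (Suc k)) x - T (G k) x)"
      by (simp add: summable_iff_convergent)
    then have "convergent (\<lambda>n. T (G n) x - T (G 0) x)"
      by (simp only: sum_lessThan_telescope[of "\<lambda>k. T (G k) x"])
    then have "convergent (\<lambda>n. (T (G n) x - T (G 0) x) + T (G 0) x)"
      by (rule convergent_add) (rule convergent_const)
    then show ?case by simp
  qed
  \<comment> \<open>On the null set where the sequence diverges, \<open>lim\<close> has an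
    unspecified value; only measurability matters there.\<close>
  define h where "h x = lim (\<lambda>k. T (G k) x)" for x
  have h_meas [measurable]: "h \<in> borel_measurable lebesgue" unfolding h_def by measurable
  have h_lim: "AE x in lebesgue. (\<lambda>k. T (G k) x) \<longlonglongrightarrow> h x"
    using conv by eventually_elim (simp add: h_def convergent_LIMSEQ_iff)
  have close: "weak_qnorm ?m (\<lambda>x. T F x - h x) \<le> ennreal (diff_const CARD('m) A R * (2 * \<eta>))"
    if F: "\<And>i. F i \<in> Cc_space" and \<eta>: "0 < \<eta>" "\<eta> \<le> 1" and Ff: "\<And>i. Lp_norm 1 (\<lambda>x. F i x - f i x) \<le> \<eta>" for F \<eta>
  proof (rule weak_qnorm_lower_semicontinuous)
    have [measurable]: "T F \<in> borel_measurable lebesgue" by (rule meas[OF F])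
    show "(\<lambda>x. T F x - T (G l) x) \<in> borel_measurable lebesgue" for l by measurable
    show "AE x in lebesgue. (\<lambda>l. T F x - T (G l) x) \<longlonglongrightarrow> T F x - h x"
      using h_lim by eventually_elim (intro tendsto_diff tendsto_const)
    have "eventually (\<lambda>l. \<theta> l < \<eta>) sequentially" using \<theta>_lim \<eta>(1) by (rule order_tendstoD(2))
    then show "eventually (\<lambda>l. weak_qnorm ?m (\<lambda>x. T F x - T (G l) x) \<le> ennreal (diff_const CARD('m) A R * (2 * \<eta>))) sequentially"
    proof eventually_elim
      case (elim l)
      have "Lp_norm 1 (\<lambda>x. G l i x - f i x) \<le> \<eta>" for i using Gf[of l i] elim by linarith
      then show ?case by (intro diff[OF F G \<eta> Ff])
    qed
    show "0 \<le> diff_const CARD('m) A R * (2 * \<eta>)" using DR \<eta> by simp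
  qed simp
  have "L1_extension T f h"
    unfolding L1_extension_def
  proof (intro conjI allI impI h_meas)
    fix F :: "nat \<Rightarrow> 'm \<Rightarrow> real ^ 'n \<Rightarrow> complex"
    assume "(\<forall>k i. F k i \<in> Cc_space) \<and> (\<forall>i. (\<lambda>k. Lp_norm 1 (\<lambda>x. F k i x - f i x)) \<longlonglongrightarrow> 0)"
    then have F: "\<And>k i. F k i \<in> Cc_space" and F_lim: "\<And>i. (\<lambda>k. Lp_norm 1 (\<lambda>x. F k i x - f i x)) \<longlonglongrightarrow> 0" by auto
    \<comment> \<open>The summand \<open>1 / real (Suc k)\<close> keeps \<open>\<eta> k\<close>
      positive, as \<open>close\<close> requires, even when the approximation is exact.\<close>
    define \<eta> where "\<eta> k = (\<Sum>i\<in>UNIV. Lp_norm 1 (\<lambda>x. F k i x - f i x)) + 1 / real (Suc k)" for k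
    have \<eta>_lim: "\<eta> \<longlonglongrightarrow> 0"
    proof -
      have "\<eta> \<longlonglongrightarrow> (\<Sum>i\<in>(UNIV :: 'm set). 0) + 0"
        unfolding \<eta>_def by (intro tendsto_add tendsto_sum F_lim LIMSEQ_Suc lim_1_over_n)
      then show ?thesis by simp
    qed
    have \<eta>_pos: "0 < \<eta> k" for k
      unfolding \<eta>_def by (intro add_nonneg_pos sum_nonneg Lp_norm_nonneg) simp
    have F\<eta>: "Lp_norm 1 (\<lambda>x. F k i x - f i x) \<le> \<eta> k" for k i
    proof -
      have "Lp_norm 1 (\<lambda>x. F k i x - f i x) \<le> (\<Sum>i\<in>UNIV. Lp_norm 1 (\<lambda>x. F k i x - f i x))"
        by (intro member_le_sum Lp_norm_nonneg) auto
      then show ?thesis by (simp add: \<eta>_def add_increasing2)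
    qed
    have "eventually (\<lambda>k. \<eta> k < 1) sequentially" using \<eta>_lim by (rule order_tendstoD(2)) simp
    then have ev: "eventually (\<lambda>k. weak_qnorm ?m (\<lambda>x. T (F k) x - h x) \<le> ennreal (diff_const CARD('m) A R * (2 * \<eta> k))) sequentially"
      by eventually_elim (intro close F \<eta>_pos F\<eta>, simp)
    have "(\<lambda>k. ennreal (diff_const CARD('m) A R * (2 * \<eta> k))) \<longlonglongrightarrow> ennreal (diff_const CARD('m) A R * (2 * 0))"
      by (intro tendsto_ennrealI tendsto_mult tendsto_const \<eta>_lim)
    then have "(\<lambda>k. ennreal (diff_const CARD('m) A R * (2 * \<eta> k))) \<longlonglongrightarrow> 0" by simp
    from tendsto_sandwich[OF _ ev tendsto_const this]
    show "(\<lambda>k. weak_qnorm ?m (\<lambda>x. T (F k) x - h x)) \<longlonglongrightarrow> 0" by simp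
  qed
  then show ?thesis by blast
qed

text \<open>Applies to every representative \<open>h\<close>, not just the one constructed: split
  \<open>h\<close> as \<open>T (G k)\<close> plus a remainder tending to 0. The quasi-triangle
  inequality costs \<open>2 ^ Suc CARD('m)\<close>.\<close>

lemma extension_weak_bound:
  assumes f: "\<And>i. integrable lebesgue (f i)" and h: "L1_extension T f h"
  shows "weak_qnorm CARD('m) h \<le> ennreal (2 ^ Suc CARD('m) * A * (\<Prod>i\<in>UNIV. Lp_norm 1 (f i)))"
proof -
  let ?m = "CARD('m)"
  have h_meas: "h \<in> borel_measurable lebesgue" using h by (simp add: L1_extension_def)
  define \<theta> where "\<theta> k = 1 / real (Suc k)" for k
  have \<theta>: "0 < \<theta> k" for k by (simp add: \<theta>_def)
  have \<theta>_lim: "\<theta> \<longlonglongrightarrow> 0" unfolding \<theta>_def by (rule LIMSEQ_Suc[OF lim_1_over_n])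
  obtain G where G: "\<And>k i. G k i \<in> Cc_space" and Gf: "\<And>k i. Lp_norm 1 (\<lambda>x. G k i x - f i x) < \<theta> k"
    using Cc_space_sequence_dense[of f \<theta>, OF f \<theta>] by blast
  have "(\<lambda>k. Lp_norm 1 (\<lambda>x. G k i x - f i x)) \<longlonglongrightarrow> 0" for i
    by (rule tendsto_sandwich[OF _ _ tendsto_const \<theta>_lim])
       (auto intro!: always_eventually less_imp_le[OF Gf] Lp_norm_nonneg)
  then have lim: "(\<lambda>k. weak_qnorm ?m (\<lambda>x. T (G k) x - h x)) \<longlonglongrightarrow> 0"
    using h G unfolding L1_extension_def by blast
  \<comment> \<open>Adding \<open>\<theta> k\<close> covers the norm of \<open>G k i\<close> and
    keeps each factor positive; it disappears in the limit.\<close>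
  define B where "B k = (\<Prod>i\<in>UNIV. Lp_norm 1 (f i) + \<theta> k)" for k
  have two: "(2 :: ennreal) ^ Suc ?m = ennreal (2 ^ Suc ?m)"
    using ennreal_power[of 2 "Suc ?m"] by (simp del: power_Suc)
  have B0: "0 \<le> B k" for k
    unfolding B_def using Lp_norm_nonneg[of 1] \<theta> by (intro prod_nonneg) (auto intro: add_nonneg_nonneg less_imp_le)
  have "weak_qnorm ?m h \<le> 2 ^ Suc ?m * (ennreal (A * B k) + weak_qnorm ?m (\<lambda>x. T (G k) x - h x))" for k
  proof -
    have TG: "T (G k) \<in> borel_measurable lebesgue" by (rule meas[OF G])
    have "weak_qnorm ?m h = weak_qnorm ?m (\<lambda>x. T (G k) x + (h x - T (G k) x))" by simp
    also have "\<dots> \<le> 2 ^ Suc ?m * (weak_qnorm ?m (T (G k)) + weak_qnorm ?m (\<lambda>x. h x - T (G k) x))"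
      using TG h_meas by (intro weak_qnorm_add) auto
    also have "weak_qnorm ?m (\<lambda>x. h x - T (G k) x) = weak_qnorm ?m (\<lambda>x. T (G k) x - h x)"
      by (rule weak_qnorm_minus_commute)
    also have "weak_qnorm ?m (T (G k)) \<le> ennreal (A * B k)"
      unfolding B_def
    proof (rule weak[OF G])
      show "0 < Lp_norm 1 (f i) + \<theta> k" for i using Lp_norm_nonneg[of 1 "f i"] \<theta>[of k] by linarith
      show "Lp_norm 1 (G k i) \<le> Lp_norm 1 (f i) + \<theta> k" for i
        by (rule Lp_norm_1_near[OF f G less_imp_le[OF Gf]])
    qed
    finally show ?thesis by (simp add: add_right_mono mult_left_mono)
  qed
  moreover have "(\<lambda>k. 2 ^ Suc ?m * (ennreal (A * B k) + weak_qnorm ?m (\<lambda>x. T (G k) x - h x)))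
      \<longlonglongrightarrow> 2 ^ Suc ?m * (ennreal (A * (\<Prod>i\<in>UNIV. Lp_norm 1 (f i) + 0)) + 0)"
    unfolding B_def two
    by (intro ennreal_tendsto_cmult tendsto_add lim tendsto_ennrealI tendsto_mult tendsto_prod tendsto_const \<theta>_lim) auto
  ultimately have "weak_qnorm ?m h \<le> 2 ^ Suc ?m * (ennreal (A * (\<Prod>i\<in>UNIV. Lp_norm 1 (f i) + 0)) + 0)"
    by (intro LIMSEQ_le_const) auto
  also have "\<dots> = ennreal (2 ^ Suc ?m * A * (\<Prod>i\<in>UNIV. Lp_norm 1 (f i)))"
    unfolding two using A Lp_norm_nonneg[of 1] by (simp add: ennreal_mult' prod_nonneg mult.assoc del: power_Suc)
  finally show ?thesis .
qed

end

text \<open>Choosing \<open>A2\<close> after \<open>K\<close> and \<open>N\<close> but before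
  \<open>T\<close> encodes that it depends on the kernel, the dimensions and the operator norm
  only.\<close>

theorem theorem1:
  fixes K :: "real ^ 'n \<Rightarrow> (real ^ 'n) ^ 'm \<Rightarrow> complex" and N :: real
  shows "\<exists>A2\<ge>0. \<forall>T. CZ_operator T K \<and> opnorm_L2 T = N \<longrightarrow>
    (\<forall>f. (\<forall>i. f i \<in> Lp_space 1) \<longrightarrow>
      (\<exists>h. L1_extension T f h) \<and>
      (\<forall>h. L1_extension T f h \<longrightarrow>
        weak_qnorm CARD('m) h \<le> ennreal (A2 * (\<Prod>i\<in>UNIV. Lp_norm 1 (f i))) \<and>
        (\<forall>t>0. emeasure lebesgue {x. t < cmod (h x)} \<le>
           ennreal (A2 powr (1 / real CARD('m)) * t powr (- 1 / real CARD('m)) *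
             (\<Prod>i\<in>UNIV. Lp_norm 1 (f i) powr (1 / real CARD('m)))))))"
proof (cases "CZ_kernel K \<and> 0 \<le> N")
  case False
  \<comment> \<open>Here no operator qualifies, since \<open>opnorm_L2\<close> of a bounded operator
    is nonnegative; any constant will do.\<close>
  have "\<not> (CZ_operator T K \<and> opnorm_L2 T = N)" for T
  proof
    assume T: "CZ_operator T K \<and> opnorm_L2 T = N"
    then obtain B where "bound_L2 T B" by (auto simp: CZ_operator_def bounded_multilinear_L2_def)
    from bound_L2_opnorm[OF this] T False show False by (auto simp: CZ_operator_def bound_L2_def)
  qed
  then show ?thesis by (intro exI[of _ 0]) auto
next
  case True
  then obtain C \<delta> where "CZ_kernel_bounds K C \<delta>"
    unfolding CZ_kernel_def CZ_kernel_bounds_def by blast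
  then interpret CZ_kernel_bounds K C \<delta> .
  let ?m = "CARD('m)"
  obtain A where A: "0 < A" and bound: "\<forall>T :: ('m \<Rightarrow> real ^ 'n \<Rightarrow> complex) \<Rightarrow> real ^ 'n \<Rightarrow> complex.
    CZ_operator T K \<longrightarrow> bound_L2 T N \<longrightarrow>
    (\<forall>f a t. (\<forall>i. f i \<in> Cc_space) \<longrightarrow> (\<forall>i. 0 < a i) \<longrightarrow>
      (\<forall>i. (\<integral>\<^sup>+ y. ennreal (cmod (f i y)) \<partial>lborel) \<le> ennreal (a i)) \<longrightarrow> 0 < t \<longrightarrow>
      emeasure lebesgue {x. t < cmod (T f x)} \<le> ennreal (A * ((\<Prod>i\<in>UNIV. a i) / t) powr (1 / real ?m)))"
    using weak_bound_Cc[OF conjunct2[OF True]] by blast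
  \<comment> \<open>A level-set constant \<open>A\<close> becomes \<open>A ^ ?m\<close> in the
    quasi-norm, which raises the measure to the m-th power; the power of 2 is the loss in
    \<open>extension_weak_bound\<close>.\<close>
  define A2 where "A2 = 2 ^ Suc ?m * A ^ ?m"
  have A2: "0 < A2" using A by (simp add: A2_def)
  show ?thesis
  proof (intro exI[of _ A2] conjI allI impI)
    show "0 \<le> A2" using A2 by simp
    fix T :: "('m \<Rightarrow> real ^ 'n \<Rightarrow> complex) \<Rightarrow> real ^ 'n \<Rightarrow> complex" and f :: "'m \<Rightarrow> real ^ 'n \<Rightarrow> complex"
    assume T: "CZ_operator T K \<and> opnorm_L2 T = N" and f: "\<forall>i. f i \<in> Lp_space 1"
    obtain B where "bound_L2 T B" using T by (auto simp: CZ_operator_def bounded_multilinear_L2_def)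
    from bound_L2_opnorm[OF this] have TN: "bound_L2 T N" using T by simp
    have TL: "\<forall>f. (\<forall>i. f i \<in> Lp_space 2) \<longrightarrow> T f \<in> Lp_space (2 / real ?m)" and lin: "multilinear_L2 T"
      using T unfolding CZ_operator_def bounded_multilinear_L2_def by blast+
    interpret weak_type_on_Cc T "A ^ ?m"
    proof
      show "0 < A ^ ?m" using A by simp
      show "multilinear_L2 T" by (rule lin)
      show "T g \<in> borel_measurable lebesgue" if "\<And>i. g i \<in> Cc_space" for g
        using TL that Cc_space_subset_L2 unfolding Lp_space_def[of "2 / real ?m"] by blast
      fix g :: "'m \<Rightarrow> real ^ 'n \<Rightarrow> complex" and a :: "'m \<Rightarrow> real"
      assume g: "\<And>i. g i \<in> Cc_space" and a: "\<And>i. 0 < a i" and ga: "\<And>i. Lp_norm 1 (g i) \<le> a i"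
      have \<pi>: "0 < (\<Prod>i\<in>UNIV. a i)" using a by (simp add: prod_pos)
      have ga': "(\<integral>\<^sup>+ y. ennreal (cmod (g i y)) \<partial>lborel) \<le> ennreal (a i)" for i
        using ga[of i] nn_integral_Lp_norm_1[OF Cc_space_integrable_lebesgue[OF g[of i]]] by (simp add: ennreal_leI)
      show "weak_qnorm ?m (T g) \<le> ennreal (A ^ ?m * (\<Prod>i\<in>UNIV. a i))"
      proof (subst weak_qnorm_le_iff)
        show "\<forall>t>0. emeasure lebesgue {x. t < cmod (T g x)} \<le> ennreal ((A ^ ?m * (\<Prod>i\<in>UNIV. a i) / t) powr (1 / real ?m))"
        proof (intro allI impI)
          fix t :: real assume t: "0 < t"
          have "(A ^ ?m * (\<Prod>i\<in>UNIV. a i) / t) powr (1 / real ?m) = (A ^ ?m * ((\<Prod>i\<in>UNIV. a i) / t)) powr (1 / real ?m)" by simp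
          also have "\<dots> = (A ^ ?m) powr (1 / real ?m) * ((\<Prod>i\<in>UNIV. a i) / t) powr (1 / real ?m)"
            by (rule powr_mult)
          also have "(A ^ ?m) powr (1 / real ?m) = A" using A by (simp add: powr_powr flip: powr_realpow)
          finally show "emeasure lebesgue {x. t < cmod (T g x)} \<le> ennreal ((A ^ ?m * (\<Prod>i\<in>UNIV. a i) / t) powr (1 / real ?m))"
            using bound[rule_format, of T g a t] T TN g a ga' t by simp
        qed
      qed (use A \<pi> in auto)
    qed
    have fi: "\<And>i. integrable lebesgue (f i)" using f by (simp add: Lp_space_1_iff)
    show "\<exists>h. L1_extension T f h" by (rule extension_exists[OF fi])
    fix h assume h: "L1_extension T f h"
    show W: "weak_qnorm ?m h \<le> ennreal (A2 * (\<Prod>i\<in>UNIV. Lp_norm 1 (f i)))"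
      unfolding A2_def by (rule extension_weak_bound[OF fi h])
    fix t :: real assume t: "0 < t"
    have \<pi>: "0 \<le> (\<Prod>i\<in>UNIV. Lp_norm 1 (f i))" by (intro prod_nonneg) (simp add: Lp_norm_nonneg)
    have "emeasure lebesgue {x. t < cmod (h x)} \<le> ennreal ((A2 * (\<Prod>i\<in>UNIV. Lp_norm 1 (f i)) / t) powr (1 / real ?m))"
      using W weak_qnorm_le_iff[of ?m "A2 * (\<Prod>i\<in>UNIV. Lp_norm 1 (f i))" h] A2 \<pi> t by simp
    also have "(A2 * (\<Prod>i\<in>UNIV. Lp_norm 1 (f i)) / t) powr (1 / real ?m) =
        A2 powr (1 / real ?m) * t powr (- 1 / real ?m) * (\<Prod>i\<in>UNIV. Lp_norm 1 (f i) powr (1 / real ?m))"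
      using A2 \<pi> t by (simp add: powr_divide powr_mult powr_minus_divide prod_powr_distrib Lp_norm_nonneg)
    finally show "emeasure lebesgue {x. t < cmod (h x)} \<le>
        ennreal (A2 powr (1 / real ?m) * t powr (- 1 / real ?m) * (\<Prod>i\<in>UNIV. Lp_norm 1 (f i) powr (1 / real ?m)))" .
  qed
qed

end
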